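(* Suppose that there exists a pseudorandom quantum states generator which, on input $k\in\{0,1\}^n$, outputs an $m$-qubit state, where $m=m(n)\ge cn$ for some constant $c>1$. Then there exists a non-interactive quantum commitment scheme (for committing a classical bit) that satisfies computational hiding and statistical sum-binding.
   Context: Conventions. QPT means (uniform) quantum polynomial time. A function $f$ is negligible if for every constant $c>0$, $f(\lambda)<\lambda^{-c}$ for all large enough $\lambda$; $\mathsf{negl}$ denotes a negligible function. $k\leftarrow\{0,1\}^n$ means $k$ is sampled uniformly at random. $\lambda$ denotes the security parameter; all states, registers and algorithms below are families indexed by it. Pseudorandom quantum states generator (PRSG). A PRSG is a QPT algorithm $\mathsf{StateGen}$ that, on input $k\in\{0,1\}^n$, outputs an $m$-qubit quantum state $|\phi_k\rangle$, such that for every polynomial $t$ and every non-uniform QPT adversary $\mathcal{A}$ there is a negligible function $\mathsf{negl}$ such that for all $n$, $$\Big|\Pr_{k\leftarrow\{0,1\}^n}[\mathcal{A}(|\phi_k\rangle^{\otimes t(n)})\to1]-\Pr_{|\psi\rangle\leftarrow\mu_m}[\mathcal{A}(|\psi\rangle^{\otimes t(n)})\to1]\Big|\le\mathsf{negl}(n),$$ where $\mu_m$ is the Haar measure on $m$-qubit pure states. Standing convention: the output is pure and no ancilla is left over, i.e. on input $k$, $\mathsf{StateGen}$ computes in classical polynomial time a description of a unitary quantum circuit $U_k$ and outputs $|\phi_k\rangle=U_k|0\ldots0\rangle$. Non-interactive quantum commitment scheme. It is given by two pure states $|\psi_0\rangle_{RC},|\psi_1\rangle_{RC}$ on registers $R$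 and $C$ (for each security parameter), each of which can be generated in quantum polynomial time by a unitary circuit from the all-zero state. Commit phase: to commit $b\in\{0,1\}$, the sender generates $|\psi_b\rangle_{RC}$ and sends register $C$ to the receiver. Reveal phase: the sender sends $b$ and register $R$; the receiver measures $\{|\psi_b\rangle\langle\psi_b|,I-|\psi_b\rangle\langle\psi_b|\}$ on $RC$ and outputs $b$ if the result is $|\psi_b\rangle\langle\psi_b|$, and $\bot$ otherwise. Computational hiding. For $b\in\{0,1\}$ let $\mathsf{Exp}(b)$ be the experiment in which a challenger generates $|\psi_b\rangle_{RC}$ and sends register $C$ to the adversary $\mathcal{A}$, who outputs a bit $b'$, which is the output of the experiment. The scheme is computationally hiding if for every QPT $\mathcal{A}$ there is a negligible function with $|\Pr[\mathsf{Exp}(0)=1]-\Pr[\mathsf{Exp}(1)=1]|\le\mathsf{negl}(\lambda)$. Statistical sum-binding. A computationally unbounded adversary prepares a state $|\Psi\rangle_{ERC}$ on registers $E,R,C$ (with $E$ arbitrary) and sends $C$ to the challenger. To open $b\in\{0,1\}$ it applies a unitary $U^{(b)}_{ER}$ on $E$ and $R$ and sends $b$ and $R$; the challenger measures $\{|\psi_b\rangle\langle\psi_b|,I-|\psi_b\rangle\langle\psi_b|\}$ on $RC$ and accepts $b$ iff the result is $|\psi_b\rangle\langle\psi_b|$. Let $$p_b:=\langle\psi_b|_{RC}\,\mathrm{Tr}_E\big(U^{(b)}_{ER}|\Psi\rangle\langle\Psi|_{ERC}U^{(b)\dagger}_{ER}\big)|\psi_b\rangle_{RC}.$$ The scheme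 is statistically sum-binding if for every such adversary there is a negligible function with $p_0+p_1\le1+\mathsf{negl}(\lambda)$. *)

theory Defs
  imports "HOL-Probability.Probability" "HOL-Computational_Algebra.Polynomial"
begin

section \<open>Asymptotics\<close>

definition negligible :: "(nat \<Rightarrow> real) \<Rightarrow> bool" where
  "negligible f \<longleftrightarrow>
     (\<forall>c::real. c > 0 \<longrightarrow> (\<forall>\<^sub>F n in sequentially. f n < real n powr (- c)))"

definition poly_bounded :: "(nat \<Rightarrow> nat) \<Rightarrow> bool" where
  "poly_bounded f \<longleftrightarrow> (\<exists>p :: nat poly. \<forall>n. f n \<le> poly p n)"


section \<open>Classical polynomial time\<close>

text \<open>
  The model of deterministic computation is a WHILE language over finitely many registers, each
  holding a bit string that is accessed only at its head. Two such registers are the two halves of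
  a Turing tape and one such register is a one-sided tape, so these programs are multi-tape Turing
  machines with a structured finite control, and the running time (one unit for each push, pop
  and test) agrees with that of multi-tape machines up to a constant factor.
\<close>

datatype test = Nonempty nat | Head_True nat

datatype program =
    Skip
  | Push nat bool
  | Pop nat
  | Seq program program
  | Cond test program program
  | Loop test program

type_synonym store = "nat \<Rightarrow> bool list"

fun holds :: "test \<Rightarrow> store \<Rightarrow> bool" where
  "holds (Nonempty r) s \<longleftrightarrow> s r \<noteq> []"
| "holds (Head_True r) s \<longleftrightarrow> s r \<noteq> [] \<and> hd (s r)"

inductive exec :: "program \<Rightarrow> store \<Rightarrow> nat \<Rightarrow> store \<Rightarrow> bool" where
  Skip: "exec Skip s 1 s"
| Push: "exec (Push r b) s 1 (s(r := b # s r))"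
| Pop: "exec (Pop r) s 1 (s(r := tl (s r)))"
| Seq: "exec P s k s' \<Longrightarrow> exec Q s' l s'' \<Longrightarrow> exec (Seq P Q) s (k + l) s''"
| Cond_True: "holds t s \<Longrightarrow> exec P s k s' \<Longrightarrow> exec (Cond t P Q) s (k + 1) s'"
| Cond_False: "\<not> holds t s \<Longrightarrow> exec Q s k s' \<Longrightarrow> exec (Cond t P Q) s (k + 1) s'"
| Loop_True: "holds t s \<Longrightarrow> exec P s k s' \<Longrightarrow> exec (Loop t P) s' l s''
    \<Longrightarrow> exec (Loop t P) s (k + l + 1) s''"
| Loop_False: "\<not> holds t s \<Longrightarrow> exec (Loop t P) s 1 s"

text \<open>Input and output are in register 0; all other registers are initially empty.\<close>

definition poly_time_on :: "bool list set \<Rightarrow> (bool list \<Rightarrow> bool list) \<Rightarrow> bool" where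
  "poly_time_on D f \<longleftrightarrow>
     (\<exists>P. \<exists>p :: nat poly. \<forall>x\<in>D. \<exists>k s.
        exec P ((\<lambda>r. [])(0 := x)) k s \<and> s 0 = f x \<and> k \<le> poly p (length x))"

text \<open>Uniform generation of a family of strings from the security parameter in unary.\<close>

definition poly_time_family :: "(nat \<Rightarrow> bool list) \<Rightarrow> bool" where
  "poly_time_family g \<longleftrightarrow> poly_time_on (range (\<lambda>n. replicate n True)) (\<lambda>x. g (length x))"


section \<open>States and operators of qubits\<close>

text \<open>
  A vector of the state space of \<open>n\<close> qubits is a function on bit strings, of which only the values
  at the strings in \<open>bits n\<close> (the computational basis) are relevant. An operator is a matrix
  indexed by bit strings. Registers are concatenated: a basis state of \<open>RC\<close> is \<open>x @ y\<close>
  with \<open>x\<close> in \<open>R\<close> and \<open>y\<close> in \<open>C\<close>.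
\<close>

type_synonym ket = "bool list \<Rightarrow> complex"
type_synonym op = "bool list \<Rightarrow> bool list \<Rightarrow> complex"

definition bits :: "nat \<Rightarrow> bool list set" where
  "bits n = {x. length x = n}"

definition unit_ket :: "nat \<Rightarrow> ket \<Rightarrow> bool" where
  "unit_ket n \<psi> \<longleftrightarrow> (\<Sum>x\<in>bits n. (cmod (\<psi> x))\<^sup>2) = 1"

definition basis_ket :: "bool list \<Rightarrow> ket" where
  "basis_ket y = (\<lambda>x. if x = y then 1 else 0)"

definition zero_ket :: "nat \<Rightarrow> ket" where
  "zero_ket n = basis_ket (replicate n False)"

text \<open>In the tensor products, \<open>a\<close> is the number of qubits of the left factor.\<close>

definition ket_tensor :: "nat \<Rightarrow> ket \<Rightarrow> ket \<Rightarrow> ket" where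
  "ket_tensor a \<psi> \<phi> = (\<lambda>x. \<psi> (take a x) * \<phi> (drop a x))"

fun ket_power :: "nat \<Rightarrow> ket \<Rightarrow> nat \<Rightarrow> ket" where
  "ket_power a \<psi> 0 = zero_ket 0"
| "ket_power a \<psi> (Suc t) = ket_tensor a \<psi> (ket_power a \<psi> t)"

definition op_tensor :: "nat \<Rightarrow> op \<Rightarrow> op \<Rightarrow> op" where
  "op_tensor a A B = (\<lambda>x y. A (take a x) (take a y) * B (drop a x) (drop a y))"

definition id_op :: op where
  "id_op = (\<lambda>x y. if x = y then 1 else 0)"

definition adj :: "op \<Rightarrow> op" where
  "adj A = (\<lambda>x y. cnj (A y x))"

definition op_mult :: "nat \<Rightarrow> op \<Rightarrow> op \<Rightarrow> op" where
  "op_mult n A B = (\<lambda>x y. \<Sum>z\<in>bits n. A x z * B z y)"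

definition op_apply :: "nat \<Rightarrow> op \<Rightarrow> ket \<Rightarrow> ket" where
  "op_apply n A \<psi> = (\<lambda>x. \<Sum>y\<in>bits n. A x y * \<psi> y)"

definition conj_by :: "nat \<Rightarrow> op \<Rightarrow> op \<Rightarrow> op" where
  "conj_by n U \<rho> = op_mult n (op_mult n U \<rho>) (adj U)"

definition unitary_op :: "nat \<Rightarrow> op \<Rightarrow> bool" where
  "unitary_op n U \<longleftrightarrow>
     (\<forall>x\<in>bits n. \<forall>y\<in>bits n. op_mult n (adj U) U x y = id_op x y \<and> op_mult n U (adj U) x y = id_op x y)"

definition ketbra :: "ket \<Rightarrow> op" where
  "ketbra \<psi> = (\<lambda>x y. \<psi> x * cnj (\<psi> y))"

definition trace_left :: "nat \<Rightarrow> op \<Rightarrow> op" where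
  "trace_left e \<rho> = (\<lambda>y y'. \<Sum>x\<in>bits e. \<rho> (x @ y) (x @ y'))"

text \<open>The probability \<open>\<langle>\<psi>|\<rho>|\<psi>\<rangle>\<close>; it is real for a density operator \<open>\<rho>\<close>.\<close>

definition expect :: "nat \<Rightarrow> ket \<Rightarrow> op \<Rightarrow> real" where
  "expect n \<psi> \<rho> = Re (\<Sum>x\<in>bits n. \<Sum>y\<in>bits n. cnj (\<psi> x) * \<rho> x y * \<psi> y)"


section \<open>Quantum circuits\<close>

text \<open>
  Unitary circuits over the universal gate set Clifford+T. (The Toffoli gate has an exact
  implementation from the other three without ancillas.)
\<close>

datatype gate = Had nat | TGate nat | CNOT nat nat | Toffoli nat nat nat

datatype circuit = Circuit (width: nat) (gates: "gate list")

fun wf_gate :: "nat \<Rightarrow> gate \<Rightarrow> bool" where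
  "wf_gate w (Had q) \<longleftrightarrow> q < w"
| "wf_gate w (TGate q) \<longleftrightarrow> q < w"
| "wf_gate w (CNOT a q) \<longleftrightarrow> a < w \<and> q < w \<and> a \<noteq> q"
| "wf_gate w (Toffoli a b q) \<longleftrightarrow> a < w \<and> b < w \<and> q < w \<and> a \<noteq> b \<and> a \<noteq> q \<and> b \<noteq> q"

definition wf_circuit :: "circuit \<Rightarrow> bool" where
  "wf_circuit C \<longleftrightarrow> (\<forall>g\<in>set (gates C). wf_gate (width C) g)"

fun gate_apply :: "gate \<Rightarrow> ket \<Rightarrow> ket" where
  "gate_apply (Had q) \<psi> =
     (\<lambda>x. (\<psi> (x[q := False]) + (if x ! q then - 1 else 1) * \<psi> (x[q := True])) / complex_of_real (sqrt 2))"
| "gate_apply (TGate q) \<psi> = (\<lambda>x. (if x ! q then cis (pi / 4) else 1) * \<psi> x)"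
| "gate_apply (CNOT a q) \<psi> = (\<lambda>x. \<psi> (x[q := (x ! q \<noteq> x ! a)]))"
| "gate_apply (Toffoli a b q) \<psi> = (\<lambda>x. \<psi> (x[q := (x ! q \<noteq> (x ! a \<and> x ! b))]))"

definition circuit_apply :: "circuit \<Rightarrow> ket \<Rightarrow> ket" where
  "circuit_apply C \<psi> = fold gate_apply (gates C) \<psi>"

definition circuit_op :: "circuit \<Rightarrow> op" where
  "circuit_op C = (\<lambda>x y. circuit_apply C (basis_ket y) x)"

definition circuit_state :: "circuit \<Rightarrow> ket" where
  "circuit_state C = circuit_apply C (zero_ket (width C))"

text \<open>
  Descriptions of circuits. Numbers are written in unary, so that a description computed in
  polynomial time is that of a circuit with polynomially many wires and gates.
\<close>

definition enc_nat :: "nat \<Rightarrow> bool list" where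
  "enc_nat n = replicate n True @ [False]"

fun enc_gate :: "gate \<Rightarrow> bool list" where
  "enc_gate (Had q) = [False, False] @ enc_nat q"
| "enc_gate (TGate q) = [False, True] @ enc_nat q"
| "enc_gate (CNOT a q) = [True, False] @ enc_nat a @ enc_nat q"
| "enc_gate (Toffoli a b q) = [True, True] @ enc_nat a @ enc_nat b @ enc_nat q"

definition enc_circuit :: "circuit \<Rightarrow> bool list" where
  "enc_circuit C = enc_nat (width C) @ concat (map enc_gate (gates C))"


section \<open>Quantum polynomial time adversaries\<close>

text \<open>
  An adversary with one output bit and \<open>i\<close> input qubits is, at each security parameter, a unitary
  circuit that is run on the input, placed on the first \<open>i\<close> wires, and on ancillas in the state
  zero; afterwards wire 0 is measured and the outcome is the output. Non-uniformity is a choice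
  of polynomial-size circuits, without quantum advice; security of a generator against this class
  follows from security against quantum advice.
\<close>

definition adversary_circuit :: "nat \<Rightarrow> circuit \<Rightarrow> bool" where
  "adversary_circuit i A \<longleftrightarrow> wf_circuit A \<and> 0 < width A \<and> i \<le> width A"

definition accept_prob :: "circuit \<Rightarrow> nat \<Rightarrow> op \<Rightarrow> real" where
  "accept_prob A i \<rho> =
     Re (\<Sum>x\<in>{x \<in> bits (width A). x ! 0}.
           conj_by (width A) (circuit_op A)
             (op_tensor i \<rho> (ketbra (zero_ket (width A - i)))) x x)"

definition uniform_QPT :: "(nat \<Rightarrow> nat) \<Rightarrow> (nat \<Rightarrow> circuit) \<Rightarrow> bool" where
  "uniform_QPT i A \<longleftrightarrow>
     (\<forall>n. adversary_circuit (i n) (A n)) \<and> poly_time_family (\<lambda>n. enc_circuit (A n))"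

definition nonuniform_QPT :: "(nat \<Rightarrow> nat) \<Rightarrow> (nat \<Rightarrow> circuit) \<Rightarrow> bool" where
  "nonuniform_QPT i A \<longleftrightarrow>
     (\<forall>n. adversary_circuit (i n) (A n)) \<and> poly_bounded (\<lambda>n. width (A n) + length (gates (A n)))"


section \<open>Haar measure on pure states\<close>

text \<open>
  The Haar measure on \<open>m\<close>-qubit pure states is the (existing and unique) unitarily invariant
  Borel probability measure on the unit vectors. The unit sphere is embedded into the product
  space \<open>\<complex>\<^bsup>bits m\<^esup>\<close>, whose points are extensional functions; hence the \<open>restrict\<close>.
\<close>

definition is_haar :: "nat \<Rightarrow> ket measure \<Rightarrow> bool" where
  "is_haar m \<mu> \<longleftrightarrow>
     prob_space \<mu> \<and>
     sets \<mu> = sets (\<Pi>\<^sub>M x\<in>bits m. (borel :: complex measure)) \<and>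
     (AE \<psi> in \<mu>. unit_ket m \<psi>) \<and>
     (\<forall>U. unitary_op m U \<longrightarrow> distr \<mu> \<mu> (\<lambda>\<psi>. restrict (op_apply m U \<psi>) (bits m)) = \<mu>)"

definition haar :: "nat \<Rightarrow> ket measure" where
  "haar m = (SOME \<mu>. is_haar m \<mu>)"


section \<open>Pseudorandom quantum states generators\<close>

text \<open>
  \<open>U k\<close> is the unitary circuit whose description is computed in classical polynomial time from
  the key \<open>k\<close>. It acts on exactly the \<open>m (length k)\<close> output qubits.
\<close>

definition state_gen :: "(nat \<Rightarrow> nat) \<Rightarrow> (bool list \<Rightarrow> circuit) \<Rightarrow> bool" where
  "state_gen m U \<longleftrightarrow>
     (\<forall>k. wf_circuit (U k) \<and> width (U k) = m (length k)) \<and>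
     poly_time_on UNIV (\<lambda>k. enc_circuit (U k))"

definition prs_advantage ::
    "(nat \<Rightarrow> nat) \<Rightarrow> (bool list \<Rightarrow> circuit) \<Rightarrow> (nat \<Rightarrow> nat) \<Rightarrow> (nat \<Rightarrow> circuit) \<Rightarrow> nat \<Rightarrow> real" where
  "prs_advantage m U t A n =
     (let Pr = (\<lambda>\<psi>. accept_prob (A n) (m n * t n) (ketbra (ket_power (m n) \<psi> (t n))))
      in \<bar>(\<Sum>k\<in>bits n. Pr (circuit_state (U k))) / 2 ^ n - (\<integral>\<psi>. Pr \<psi> \<partial>haar (m n))\<bar>)"

definition PRSG :: "(nat \<Rightarrow> nat) \<Rightarrow> (bool list \<Rightarrow> circuit) \<Rightarrow> bool" where
  "PRSG m U \<longleftrightarrow>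
     state_gen m U \<and>
     (\<forall>t :: nat poly. \<forall>A. nonuniform_QPT (\<lambda>n. m n * poly t n) A \<longrightarrow>
        (\<exists>negl. negligible negl \<and> (\<forall>n. prs_advantage m U (poly t) A n \<le> negl n)))"


section \<open>Non-interactive quantum commitments\<close>

text \<open>
  \<open>reg_R S \<lambda>\<close> and \<open>reg_C S \<lambda>\<close> are the numbers of qubits of the registers, and \<open>prep S b \<lambda>\<close> is the
  circuit that prepares the pure state \<open>|\<psi>\<^sub>b\<rangle>\<close> on \<open>RC\<close> from the all-zero state. These data
  determine the commit and the reveal phase.
\<close>

record commitment =
  reg_R :: "nat \<Rightarrow> nat"
  reg_C :: "nat \<Rightarrow> nat"
  prep :: "bool \<Rightarrow> nat \<Rightarrow> circuit"

definition commitment_scheme :: "commitment \<Rightarrow> bool" where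
  "commitment_scheme S \<longleftrightarrow>
     (\<forall>b. (\<forall>l. wf_circuit (prep S b l) \<and> width (prep S b l) = reg_R S l + reg_C S l) \<and>
          poly_time_family (\<lambda>l. enc_nat (reg_R S l) @ enc_circuit (prep S b l)))"

definition commit_state :: "commitment \<Rightarrow> bool \<Rightarrow> nat \<Rightarrow> ket" where
  "commit_state S b l = circuit_state (prep S b l)"

text \<open>\<open>Pr[Exp(b) = 1]\<close>: the adversary receives the register \<open>C\<close> of \<open>|\<psi>\<^sub>b\<rangle>\<close>.\<close>

definition hiding_prob :: "commitment \<Rightarrow> (nat \<Rightarrow> circuit) \<Rightarrow> bool \<Rightarrow> nat \<Rightarrow> real" where
  "hiding_prob S A b l =
     accept_prob (A l) (reg_C S l) (trace_left (reg_R S l) (ketbra (commit_state S b l)))"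

definition computationally_hiding :: "commitment \<Rightarrow> bool" where
  "computationally_hiding S \<longleftrightarrow>
     (\<forall>A. uniform_QPT (reg_C S) A \<longrightarrow>
        (\<exists>negl. negligible negl \<and>
           (\<forall>l. \<bar>hiding_prob S A False l - hiding_prob S A True l\<bar> \<le> negl l)))"

text \<open>
  The probability \<open>p\<^sub>b\<close> of opening \<open>b\<close>: \<open>\<Psi>\<close> is the adversary's state on \<open>ERC\<close>, where \<open>E\<close> has \<open>e\<close>
  qubits, and \<open>V\<close> is the unitary on \<open>ER\<close> applied for opening \<open>b\<close>.
\<close>

definition opening_prob :: "commitment \<Rightarrow> bool \<Rightarrow> nat \<Rightarrow> nat \<Rightarrow> ket \<Rightarrow> op \<Rightarrow> real" where
  "opening_prob S b l e \<Psi> V =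
     (let r = reg_R S l; c = reg_C S l
      in expect (r + c) (commit_state S b l)
           (trace_left e (conj_by (e + r + c) (op_tensor (e + r) V id_op) (ketbra \<Psi>))))"

definition statistically_sum_binding :: "commitment \<Rightarrow> bool" where
  "statistically_sum_binding S \<longleftrightarrow>
     (\<forall>e \<Psi> V.
        (\<forall>l. unit_ket (e l + reg_R S l + reg_C S l) (\<Psi> l)) \<and>
        (\<forall>b l. unitary_op (e l + reg_R S l) (V b l)) \<longrightarrow>
        (\<exists>negl. negligible negl \<and>
           (\<forall>l. opening_prob S False l (e l) (\<Psi> l) (V False l)
               + opening_prob S True l (e l) (\<Psi> l) (V True l) \<le> 1 + negl l)))"

end

theory Submission
  imports Defs "HOL-Real_Asymp.Real_Asymp"
begin

text \<open>
  Commit to 1 with the maximally entangled state of \<open>C\<close> and \<open>m\<close> wires of \<open>R\<close>, and to 0 with the uniform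
  superposition over \<open>k\<close> of \<open>|\<xi>\<^sub>k\<rangle>\<close> on \<open>R\<close> and \<open>|\<phi>\<^sub>k\<rangle>\<close> on \<open>C\<close>, where the basis state
  \<open>\<xi>\<^sub>k\<close> consists of \<open>k\<close> and the workspace in which the description of \<open>U\<^sub>k\<close> was computed. This garbage is harmless
  because the \<open>\<xi>\<^sub>k\<close> are distinct anyway.

  Hiding: the reduced states on \<open>C\<close> are the average of one copy of \<open>|\<phi>\<^sub>k\<rangle>\<close> and the maximally mixed
  state, which is the Haar average of one copy.

  Binding: \<open>\<psi>\<^sub>0\<close> has Schmidt rank at most \<open>2\<^sup>n\<close> and the Schmidt coefficients of \<open>\<psi>\<^sub>1\<close> are
  \<open>2\<^bsup>-m/2\<^esup>\<close>, so the two vectors that are projected on when opening 0 and 1 have an overlap of at most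
  \<open>2\<^bsup>(n-m)/2\<^esup>\<close>, whatever unitary acts on \<open>R\<close> and the adversary's register. Two
  projection probabilities sum to at most 1 plus the overlap.

  Uniformity: the program that prints \<open>U\<^sub>k\<close> has to be run coherently on \<open>k\<close>. With a polynomial bound
  on its time it becomes a Toffoli circuit (a loop is that many controlled rounds, a stack is a shift register). The gates
  of \<open>U\<^sub>k\<close> are then decoded one by one and applied, controlled on the decoded positions. The resulting circuit
  is regular enough to be printed by nested loops, hence by a program.
\<close>

subsection \<open>Circuit generators\<close>

text \<open>The construction looks circular: the data qubits follow the register \<open>R\<close>,
  so the emitted gates mention its width \<open>W\<close>, but \<open>W\<close> is known only when
  all garbage wires are allocated. The amount of allocation depends on loop bounds alone, neither on
  \<open>W\<close> nor on data. So the printing program runs the generator once with a dummy width,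
  discards the output, and runs it again with the right one; for the same reason all keys in the
  superposition share one layout. The function \<open>m\<close> is not assumed to be computable
  either: it is read from the header of the description that belongs to the all-ones key, which is
  the unary security parameter itself. An operand \<open>q\<close> of a decoded gate is stored as
  \<open>q\<close> zeros followed by a one. This is a one-hot address: swaps controlled by it bring
  data qubit \<open>q\<close> to a fixed work wire, where the gate acts, and the same swaps return
  it. Finally, \<open>haar\<close> is defined by choice, so every statement about it rests on the
  existence of an invariant measure, which is derived from the translation invariance of Lebesgue
  measure.\<close>

type_synonym env = "nat \<Rightarrow> nat"

text \<open>Wire addresses are linear in the loop variables. A constant multiple of a variable is
  its repetition in the list, so that printing an address needs only copies of unary
  numbers.\<close>

datatype aexp = AExp nat "nat list"

primrec aval :: "env \<Rightarrow> aexp \<Rightarrow> nat" where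
  "aval \<rho> (AExp c vs) = c + (\<Sum>v\<leftarrow>vs. \<rho> v)"

datatype tmpl = THad aexp | TT aexp | TCNOT aexp aexp | TToffoli aexp aexp aexp

primrec inst :: "env \<Rightarrow> tmpl \<Rightarrow> gate" where
  "inst \<rho> (THad a) = Had (aval \<rho> a)"
| "inst \<rho> (TT a) = TGate (aval \<rho> a)"
| "inst \<rho> (TCNOT a b) = CNOT (aval \<rho> a) (aval \<rho> b)"
| "inst \<rho> (TToffoli a b c) = Toffoli (aval \<rho> a) (aval \<rho> b) (aval \<rho> c)"

text \<open>There are loops but no tests: the emitted gates may depend on numbers such as the
  security parameter, but not on data. All case distinctions on data are controls of gates.\<close>

datatype gen = Nop | Emit tmpl | Fresh | Then gen gen (infixr \<open>;;\<close> 60) | For nat gen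

primrec forF :: "(nat \<Rightarrow> nat \<Rightarrow> nat) \<Rightarrow> nat \<Rightarrow> nat \<Rightarrow> nat \<Rightarrow> nat" where
  "forF h 0 i F = F"
| "forF h (Suc c) i F = forF h c (Suc i) (h i F)"

primrec forE :: "(nat \<Rightarrow> nat \<Rightarrow> nat) \<Rightarrow> (nat \<Rightarrow> nat \<Rightarrow> 'g list) \<Rightarrow> nat \<Rightarrow> nat \<Rightarrow> nat \<Rightarrow> 'g list" where
  "forE h e 0 i F = []"
| "forE h e (Suc c) i F = e i F @ forE h e c (Suc i) (h i F)"

text \<open>
  A generator emits the gates \<open>em\<close> and leaves \<open>fr\<close> as the next free wire, which variable 0 holds;
  the loop variable of a loop at depth \<open>d\<close> is \<open>d\<close>.
\<close>

primrec fr :: "gen \<Rightarrow> nat \<Rightarrow> env \<Rightarrow> nat" where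
  "fr Nop d \<rho> = \<rho> 0"
| "fr (Emit t) d \<rho> = \<rho> 0"
| "fr Fresh d \<rho> = Suc (\<rho> 0)"
| "fr (g ;; h) d \<rho> = fr h d (\<rho>(0 := fr g d \<rho>))"
| "fr (For b g) d \<rho> = forF (\<lambda>i F. fr g (Suc d) (\<rho>(0 := F, d := i))) (\<rho> b) 0 (\<rho> 0)"

primrec em :: "gen \<Rightarrow> nat \<Rightarrow> env \<Rightarrow> gate list" where
  "em Nop d \<rho> = []"
| "em (Emit t) d \<rho> = [inst \<rho> t]"
| "em Fresh d \<rho> = []"
| "em (g ;; h) d \<rho> = em g d \<rho> @ em h d (\<rho>(0 := fr g d \<rho>))"
| "em (For b g) d \<rho> = forE (\<lambda>i F. fr g (Suc d) (\<rho>(0 := F, d := i)))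
      (\<lambda>i F. em g (Suc d) (\<rho>(0 := F, d := i))) (\<rho> b) 0 (\<rho> 0)"

lemma forF_id: "(\<And>i F. h i F = F) \<Longrightarrow> forF h c i F = F"
  by (induction c arbitrary: i) auto

lemma forE_id: "(\<And>i F. h i F = F) \<Longrightarrow> forE h e c i F = concat (map (\<lambda>i. e i F) [i..<i + c])"
proof (induction c arbitrary: i)
  case (Suc c)
  have "[i..<i + Suc c] = i # [Suc i..<Suc i + c]" by (subst upt_conv_Cons) auto
  then show ?case using Suc by simp
qed auto

subsection \<open>Classical reversible circuits\<close>

text \<open>Assignments are total functions on wires, not bit lists, because the number of wires is
  not fixed while garbage wires are still being allocated. Gates outside \<open>cgate\<close> get a
  dummy action.\<close>

primrec cg :: "gate \<Rightarrow> (nat \<Rightarrow> bool) \<Rightarrow> (nat \<Rightarrow> bool)" where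
  "cg (Had q) f = f"
| "cg (TGate q) f = f"
| "cg (CNOT a q) f = f(q := (f q \<noteq> f a))"
| "cg (Toffoli a b q) f = f(q := (f q \<noteq> (f a \<and> f b)))"

primrec cgate :: "gate \<Rightarrow> bool" where
  "cgate (Had q) = False"
| "cgate (TGate q) = False"
| "cgate (CNOT a q) = True"
| "cgate (Toffoli a b q) = True"

definition cl :: "gate list \<Rightarrow> (nat \<Rightarrow> bool) \<Rightarrow> (nat \<Rightarrow> bool)" where
  "cl gs f = fold cg gs f"

lemma cl_simps [simp]: "cl [] f = f" "cl (g # gs) f = cl gs (cg g f)" "cl (gs @ hs) f = cl hs (cl gs f)"
  by (simp_all add: cl_def)

lemma wf_gate_mono: "wf_gate w g \<Longrightarrow> w \<le> w' \<Longrightarrow> wf_gate w' g"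
  by (cases g) auto

section \<open>Controlled swaps, and stacks as shift registers\<close>

definition cswap :: "nat \<Rightarrow> nat \<Rightarrow> nat \<Rightarrow> gate list" where
  "cswap c a b = [Toffoli c a b, Toffoli c b a, Toffoli c a b]"

text \<open>A Fredkin gate: three alternating CNOTs swap two wires, and \<open>c\<close> is added to
  each of them as a second control.\<close>

lemma cl_cswap:
  assumes "c \<noteq> a" "c \<noteq> b" "a \<noteq> b"
  shows "cl (cswap c a b) f = (if f c then f(a := f b, b := f a) else f)"
  using assms by (auto simp: cswap_def fun_eq_iff)

definition gcswap :: "aexp \<Rightarrow> aexp \<Rightarrow> aexp \<Rightarrow> gen" where
  "gcswap c a b = Emit (TToffoli c a b) ;; Emit (TToffoli c b a) ;; Emit (TToffoli c a b)"

lemma gcswap [simp]: "em (gcswap c a b) d \<rho> = cswap (aval \<rho> c) (aval \<rho> a) (aval \<rho> b)"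
  "fr (gcswap c a b) d \<rho> = \<rho> 0"
  by (simp_all add: gcswap_def cswap_def)

text \<open>This is a push. The carry wire 0 visits the cells in ascending order and exchanges bits
  with each, so every cell receives the bit of its predecessor, cell 0 that of the carry, and the
  bit of the last cell remains in the carry.\<close>

lemma shift_up:
  fixes A :: nat
  assumes "f fl" "fl \<noteq> 0" "\<And>i. fl \<noteq> A + K * i" "A > 0" "K > 0"
  defines "f' \<equiv> \<lambda>n. cl (concat (map (\<lambda>i. cswap fl 0 (A + K * i)) [0..<n])) f"
  shows "f' n 0 = (case n of 0 \<Rightarrow> f 0 | Suc k \<Rightarrow> f (A + K * k)) \<and>
    (\<forall>i<n. f' n (A + K * i) = (case i of 0 \<Rightarrow> f 0 | Suc k \<Rightarrow> f (A + K * k))) \<and>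
    (\<forall>w. w \<noteq> 0 \<longrightarrow> (\<forall>i<n. w \<noteq> A + K * i) \<longrightarrow> f' n w = f w)"
proof (induction n)
  case 0 then show ?case by (simp add: f'_def)
next
  case (Suc n)
  have "f' n fl" using Suc assms by metis
  then have *: "f' (Suc n) = (f' n)(0 := f' n (A + K * n), A + K * n := f' n 0)"
    using assms(2-4) by (simp add: f'_def cl_cswap)
  have [simp]: "A + K * i = A + K * j \<longleftrightarrow> i = j" for i j using \<open>K > 0\<close> by simp
  have fn: "f' n (A + K * n) = f (A + K * n)"
  proof -
    have "\<forall>i<n. A + K * n \<noteq> A + K * i" using \<open>K > 0\<close> by auto
    then show ?thesis using Suc \<open>A > 0\<close> by blast
  qed
  show ?case
    unfolding *
    using Suc fn \<open>A > 0\<close> \<open>K > 0\<close> by (auto simp: less_Suc_eq split: nat.split)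
qed

text \<open>This is a pop. Adjacent swaps carry the bit of cell 0 to the far end and move every
  other bit one cell towards the head.\<close>

lemma shift_down:
  fixes A :: nat
  assumes "f fl" "\<And>i. fl \<noteq> A + K * i" "K > 0"
  defines "f' \<equiv> \<lambda>n. cl (concat (map (\<lambda>i. cswap fl (A + K * i) (A + K * Suc i)) [0..<n])) f"
  shows "f' n (A + K * n) = f A \<and>
    (\<forall>i<n. f' n (A + K * i) = f (A + K * Suc i)) \<and>
    (\<forall>w. (\<forall>i\<le>n. w \<noteq> A + K * i) \<longrightarrow> f' n w = f w)"
proof (induction n)
  case 0 then show ?case by (simp add: f'_def)
next
  case (Suc n)
  have [simp]: "A + K * i = A + K * j \<longleftrightarrow> i = j" for i j using \<open>K > 0\<close> by simp
  have "f' n fl" using Suc assms by metis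
  then have *: "f' (Suc n) = (f' n)(A + K * n := f' n (A + K * Suc n), A + K * Suc n := f' n (A + K * n))"
    using assms(2,3) by (simp add: f'_def cl_cswap del: mult_Suc_right)
  have fn: "f' n (A + K * Suc n) = f (A + K * Suc n)"
  proof -
    have "\<forall>i\<le>n. A + K * Suc n \<noteq> A + K * i" using \<open>K > 0\<close> by (auto simp del: mult_Suc_right)
    then show ?thesis using Suc by blast
  qed
  show ?case
    unfolding *
    using Suc fn \<open>K > 0\<close> by (auto simp: less_Suc_eq le_Suc_eq simp del: mult_Suc_right)
qed

lemma cl_inactive:
  assumes "\<And>i. i \<in> set is \<Longrightarrow> c \<noteq> a i \<and> c \<noteq> b i \<and> a i \<noteq> b i" "\<not> f c"
  shows "cl (concat (map (\<lambda>i. cswap c (a i) (b i)) is)) f = f"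
  using assms by (induction "is") (auto simp: cl_cswap)

section \<open>Compilation of programs into reversible circuits\<close>

primrec regs :: "program \<Rightarrow> nat set" where
  "regs Skip = {}"
| "regs (Push r b) = {r}"
| "regs (Pop r) = {r}"
| "regs (Seq P Q) = regs P \<union> regs Q"
| "regs (Cond t P Q) = insert (case t of Nonempty r \<Rightarrow> r | Head_True r \<Rightarrow> r) (regs P \<union> regs Q)"
| "regs (Loop t P) = insert (case t of Nonempty r \<Rightarrow> r | Head_True r \<Rightarrow> r) (regs P)"

text \<open>The number of control wires: one for the guard of a loop, two for the branches of a
  conditional. Sequential and alternative parts share wires, since a control wire is emptied before
  it is set again.\<close>

primrec flags :: "program \<Rightarrow> nat" where
  "flags Skip = 0"
| "flags (Push r b) = 0"
| "flags (Pop r) = 0"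
| "flags (Seq P Q) = max (flags P) (flags Q)"
| "flags (Cond t P Q) = 2 + max (flags P) (flags Q)"
| "flags (Loop t P) = 1 + flags P"

lemma exec_length: "exec P s k s' \<Longrightarrow> length (s' r) \<le> length (s r) + k"
  by (induction arbitrary: rule: exec.induct) auto

text \<open>Both lanes are false beyond the length. So an empty stack is all zeros, and each of the
  two tests is the single wire at cell 0 of a lane.\<close>

definition lanes :: "store \<Rightarrow> nat \<Rightarrow> nat \<Rightarrow> bool" where
  "lanes s j i \<longleftrightarrow> i < length (s (j div 2)) \<and> (odd j \<longrightarrow> s (j div 2) ! i)"

definition lcons :: "bool \<Rightarrow> (nat \<Rightarrow> bool) \<Rightarrow> (nat \<Rightarrow> bool)" where
  "lcons b l i = (case i of 0 \<Rightarrow> b | Suc k \<Rightarrow> l k)"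

lemma lanes_push:
  "lanes (s(r := b # s r)) = (lanes s)(2 * r := lcons True (lanes s (2 * r)), Suc (2 * r) := lcons b (lanes s (Suc (2 * r))))"
  by (intro ext) (auto simp: lanes_def lcons_def split: nat.splits elim!: evenE oddE)

lemma lanes_pop:
  "lanes (s(r := tl (s r))) = (lanes s)(2 * r := (\<lambda>i. lanes s (2 * r) (Suc i)), Suc (2 * r) := (\<lambda>i. lanes s (Suc (2 * r)) (Suc i)))"
  by (intro ext) (auto simp: lanes_def nth_tl elim!: evenE oddE)

text \<open>
  Wire 0 is the carry, wires 1, 2, 3 are for fetched qubits and the flags start at wire 4.
  Cell \<open>i\<close> of lane \<open>j\<close> is wire \<open>C + j + K * i\<close>; lanes \<open>2r\<close> and \<open>2r + 1\<close> hold the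
  lengths (in unary) and the contents of register \<open>r\<close>. Variable 2 holds the bound \<open>T\<close> of time and space.
\<close>

locale layout =
  fixes C K :: nat
  assumes C: "C > 4" and K: "K > 0"
begin

definition const :: "nat \<Rightarrow> aexp" where "const c = AExp c []"
definition cell :: "nat \<Rightarrow> nat \<Rightarrow> aexp" where "cell j v = AExp (C + j) (replicate K v)"
definition cell_next :: "nat \<Rightarrow> nat \<Rightarrow> aexp" where "cell_next j v = AExp (C + j + K) (replicate K v)"
definition fresh :: aexp where "fresh = AExp 0 [0]"

lemma aval_simps [simp]: "aval \<rho> (const c) = c" "aval \<rho> (cell j v) = C + j + K * \<rho> v"
  "aval \<rho> (cell_next j v) = C + j + K * Suc (\<rho> v)" "aval \<rho> fresh = \<rho> 0"
  by (simp_all add: const_def cell_def cell_next_def fresh_def sum_list_replicate)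

text \<open>The carry is set by a CNOT from the flag, so an inactive push neither sets it nor swaps
  anything. The loop stops before cell \<open>T\<close>, the last of the \<open>T + 1\<close>
  cells.\<close>

definition lane_push :: "nat \<Rightarrow> nat \<Rightarrow> nat \<Rightarrow> bool \<Rightarrow> gen" where
  "lane_push d fl j b =
     (if b then Emit (TCNOT (const fl) (const 0)) else Nop) ;;
     For 2 (gcswap (const fl) (const 0) (cell j d))"

text \<open>The popped bit cannot be erased, so it is exchanged for the zero of a fresh wire and
  stays there as garbage; the zero then moves to the far end. The fresh wire is consumed whether or
  not the flag is set.\<close>

definition lane_pop :: "nat \<Rightarrow> nat \<Rightarrow> nat \<Rightarrow> gen" where
  "lane_pop d fl j =
     gcswap (const fl) (const (C + j)) fresh ;; Fresh ;;
     For 2 (gcswap (const fl) (cell j d) (cell_next j d))"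

primrec twire :: "test \<Rightarrow> nat" where
  "twire (Nonempty r) = C + 2 * r"
| "twire (Head_True r) = C + Suc (2 * r)"

text \<open>The reversible substitute for erasing: two CNOTs move the bit to a wire that is known to
  be zero.\<close>

definition clear_wire :: "nat \<Rightarrow> gen" where
  "clear_wire w = Emit (TCNOT (const w) fresh) ;; Emit (TCNOT fresh (const w)) ;; Fresh"

definition set_flag :: "nat \<Rightarrow> test \<Rightarrow> nat \<Rightarrow> gen" where
  "set_flag fl t nx = clear_wire nx ;; Emit (TToffoli (const fl) (const (twire t)) (const nx))"

primrec comp :: "nat \<Rightarrow> nat \<Rightarrow> nat \<Rightarrow> program \<Rightarrow> gen" where
  "comp d fl nx Skip = Nop"
| "comp d fl nx (Push r b) = lane_push d fl (2 * r) True ;; lane_push d fl (Suc (2 * r)) b"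
| "comp d fl nx (Pop r) = lane_pop d fl (2 * r) ;; lane_pop d fl (Suc (2 * r))"
| "comp d fl nx (Seq P Q) = comp d fl nx P ;; comp d fl nx Q"
| "comp d fl nx (Cond t P Q) = set_flag fl t nx ;; clear_wire (Suc nx) ;;
     Emit (TCNOT (const fl) (const (Suc nx))) ;; Emit (TCNOT (const nx) (const (Suc nx))) ;;
     comp d nx (nx + 2) P ;; comp d (Suc nx) (nx + 2) Q"
| "comp d fl nx (Loop t P) = For 2 (set_flag fl t nx ;; comp (Suc d) nx (Suc nx) P)"

text \<open>The invariant between instructions. Zeros from \<open>F\<close> on make the allocation
  of fresh wires sound, and the empty carry lets the next push start.\<close>

definition ok :: "nat \<Rightarrow> nat \<Rightarrow> (nat \<Rightarrow> nat \<Rightarrow> bool) \<Rightarrow> (nat \<Rightarrow> bool) \<Rightarrow> bool" where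
  "ok T F L f \<longleftrightarrow> \<not> f 0 \<and> (\<forall>i\<ge>F. \<not> f i) \<and> (\<forall>j<K. \<forall>i\<le>T. f (C + j + K * i) = L j i)"

text \<open>Protects the control wires of the enclosing programs and all that is stored between the
  cells and \<open>F\<close>: old garbage and, above all, the key, whose survival makes the basis
  states of different keys distinct.\<close>

definition frame :: "nat \<Rightarrow> nat \<Rightarrow> nat \<Rightarrow> (nat \<Rightarrow> bool) \<Rightarrow> (nat \<Rightarrow> bool) \<Rightarrow> bool" where
  "frame T nx F f f' \<longleftrightarrow> (\<forall>w. w < nx \<or> C + K * Suc T \<le> w \<and> w < F \<longrightarrow> f' w = f w)"

definition trans :: "nat \<Rightarrow> nat \<Rightarrow> nat \<Rightarrow> (nat \<Rightarrow> bool) \<Rightarrow> gate list \<Rightarrow> nat \<Rightarrow> (nat \<Rightarrow> nat \<Rightarrow> bool) \<Rightarrow> bool" where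
  "trans T nx F f gs F' L' \<longleftrightarrow> F \<le> F' \<and> (\<forall>g\<in>set gs. cgate g \<and> wf_gate F' g) \<and>
     ok T F' L' (cl gs f) \<and> frame T nx F f (cl gs f)"

lemma trans_append:
  assumes "trans T nx F f gs F1 L1" "trans T nx F1 (cl gs f) hs F2 L2"
  shows "trans T nx F f (gs @ hs) F2 L2"
  using assms unfolding trans_def frame_def by (auto intro: wf_gate_mono)

lemma trans_weaken: "trans T nx' F f gs F' L' \<Longrightarrow> nx \<le> nx' \<Longrightarrow> trans T nx F f gs F' L'"
  unfolding trans_def frame_def by auto

lemma trans_Nil: "ok T F L f \<Longrightarrow> trans T nx F f [] F L"
  by (auto simp: trans_def frame_def)

lemma cell_inj: "j < K \<Longrightarrow> j' < K \<Longrightarrow> C + j + K * i = C + j' + K * i' \<longleftrightarrow> j = j' \<and> i = i'"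
proof
  assume *: "j < K" "j' < K" "C + j + K * i = C + j' + K * i'"
  then have e: "j + K * i = j' + K * i'" by simp
  from arg_cong[OF e, of "\<lambda>x. x div K"] arg_cong[OF e, of "\<lambda>x. x mod K"] * show "j = j' \<and> i = i'" by simp
qed auto

lemma cell_less: "j < K \<Longrightarrow> i \<le> T \<Longrightarrow> C + j + K * i < C + K * Suc T"
proof -
  assume "j < K" "i \<le> T"
  moreover from \<open>i \<le> T\<close> have "K * i \<le> K * T" by simp
  ultimately have "j + K * i < K + K * T" by linarith
  then show ?thesis by simp
qed

lemma ok_upd:
  assumes "j < K"
  shows "ok T F (L(j := l)) f \<longleftrightarrow> \<not> f 0 \<and> (\<forall>i\<ge>F. \<not> f i) \<and>
    (\<forall>j'<K. \<forall>i\<le>T. j' \<noteq> j \<longrightarrow> f (C + j' + K * i) = L j' i) \<and> (\<forall>i\<le>T. f (C + j + K * i) = l i)"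
  using assms unfolding ok_def by (auto simp: fun_upd_def)

lemma em_lane_push:
  assumes "\<rho> 2 = T" "d > 2"
  shows "em (lane_push d fl j b) d \<rho> = (if b then [CNOT fl 0] else []) @
    concat (map (\<lambda>i. cswap fl 0 (C + j + K * i)) [0..<T])" "fr (lane_push d fl j b) d \<rho> = \<rho> 0"
  using assms by (auto simp: lane_push_def forE_id forF_id)

text \<open>The hypothesis \<open>act\<close> provides room: the two last cells are empty, so no bit
  is lost beyond the end and the carry is empty again afterwards.\<close>

lemma trans_lane_push:
  assumes "ok T (\<rho> 0) L f" "\<rho> 2 = T" "d > 2" "C + K * Suc T \<le> \<rho> 0" "j < K"
    "0 < fl" "fl < C" "0 < nx" "nx \<le> C"
    and act: "f fl \<Longrightarrow> \<not> L j T \<and> \<not> L j (T - 1) \<and> 0 < T"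
  shows "trans T nx (\<rho> 0) f (em (lane_push d fl j b) d \<rho>) (fr (lane_push d fl j b) d \<rho>)
    (if f fl then L(j := lcons b (L j)) else L)"
proof -
  define A where "A = C + j"
  define b' where "b' = (f fl \<and> b)"
  define g where "g = f(0 := b')"
  define gs where "gs = concat (map (\<lambda>i. cswap fl 0 (A + K * i)) [0..<T])"
  have A: "A > 0" "A \<ge> C" using C by (auto simp: A_def)
  have flA: "fl \<noteq> A + K * i" "fl \<noteq> 0" for i using A assms by auto
  have "\<not> f 0" using assms by (simp add: ok_def)
  then have em: "cl (em (lane_push d fl j b) d \<rho>) f = cl gs g"
    using assms(2,3) by (auto simp: em_lane_push g_def gs_def A_def b'_def fun_upd_idem)
  have small: "A + K * i < C + K * Suc T" if "i \<le> T" for i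
    using cell_less[OF \<open>j < K\<close> that] by (simp add: A_def)
  have wf: "\<forall>x\<in>set (em (lane_push d fl j b) d \<rho>). cgate x \<and> wf_gate (\<rho> 0) x"
  proof -
    have "wf_gate (\<rho> 0) x \<and> cgate x" if "x \<in> set (cswap fl 0 (A + K * i))" "i < T" for x i
      using that small[of i] flA(1)[of i] flA A assms by (auto simp: cswap_def)
    then show ?thesis using assms(2,3) flA assms C
      by (auto simp: em_lane_push A_def)
  qed
  have gfl: "g fl = f fl" using assms by (simp add: g_def)
  have "ok T (\<rho> 0) (if f fl then L(j := lcons b (L j)) else L) (cl gs g) \<and> frame T nx (\<rho> 0) f (cl gs g)"
  proof (cases "f fl")
    case False
    then have "g = f" using \<open>\<not> f 0\<close> by (auto simp: g_def b'_def fun_upd_idem)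
    moreover have "cl gs f = f" unfolding gs_def using A flA False
      by (intro cl_inactive) auto
    ultimately show ?thesis using False assms by (simp add: frame_def)
  next
    case True
    obtain T' where T': "T = Suc T'" using act[OF True] by (cases T) auto
    note su = shift_up[of g fl A K T, folded gs_def]
    have su: "cl gs g 0 = g (A + K * T')" 
      "\<And>i. i < T \<Longrightarrow> cl gs g (A + K * i) = lcons b (\<lambda>i. f (A + K * i)) i"
      "\<And>w. w \<noteq> 0 \<Longrightarrow> \<forall>i<T. w \<noteq> A + K * i \<Longrightarrow> cl gs g w = f w"
      using su gfl True flA A K by (auto simp: T' g_def lcons_def b'_def split: nat.splits)
    have L: "f (A + K * i) = L j i" if "i \<le> T" for i
      using assms that by (auto simp: ok_def A_def)
    have other: "cl gs g w = f w" if "\<And>i. i < T \<Longrightarrow> w \<noteq> A + K * i" "w \<noteq> 0" for w using su(3) that by blast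
    \<comment> \<open>Cell \<open>T\<close> is not reached by the swaps. It keeps a false bit, and
      the bit of cell \<open>T - 1\<close> that should arrive there is false as well.\<close>
    have "cl gs g (A + K * i) = lcons b (L j) i" if "i \<le> T" for i
    proof (cases "i = T")
      case True
      then have "cl gs g (A + K * i) = f (A + K * T)" using K A by (subst other) auto
      then show ?thesis using True act[OF \<open>f fl\<close>] L[of T] by (simp add: T' lcons_def)
    next
      case False then show ?thesis using su(2)[of i] that L by (auto simp: lcons_def split: nat.splits)
    qed
    moreover have "\<not> cl gs g 0" using su(1) L[of T'] act[OF True] A by (simp add: T' g_def)
    moreover have "\<not> cl gs g i" if "i \<ge> \<rho> 0" for i
    proof -
      have "i \<noteq> A + K * k" if "k < T" for k using small[of k] that \<open>i \<ge> \<rho> 0\<close> assms by auto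
      then have "cl gs g i = f i" using \<open>i \<ge> \<rho> 0\<close> assms C by (intro other) auto
      then show ?thesis using that assms by (simp add: ok_def)
    qed
    moreover have "cl gs g (C + j' + K * i) = L j' i" if "j' < K" "i \<le> T" "j' \<noteq> j" for j' i
    proof -
      have "C + j' + K * i \<noteq> A + K * k" for k using cell_inj[of j' j i k] that assms by (simp add: A_def)
      then show ?thesis using that assms C by (subst other) (auto simp: ok_def)
    qed
    moreover have "frame T nx (\<rho> 0) f (cl gs g)"
    proof -
      have "cl gs g 0 = f 0" using \<open>\<not> f 0\<close> \<open>\<not> cl gs g 0\<close> by simp
      moreover have "w \<noteq> A + K * i" if "w < nx \<or> C + K * Suc T \<le> w" "i < T" for w i
        using that small[of i] A assms by auto
      ultimately show ?thesis unfolding frame_def by (metis other)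
    qed
    ultimately show ?thesis using True assms by (simp add: ok_upd A_def)
  qed
  then show ?thesis unfolding trans_def em using wf assms by (simp add: em_lane_push)
qed

lemma em_lane_pop:
  assumes "\<rho> 2 = T" "d > 2"
  shows "em (lane_pop d fl j) d \<rho> = cswap fl (C + j) (\<rho> 0) @
    concat (map (\<lambda>i. cswap fl (C + j + K * i) (C + j + K * Suc i)) [0..<T])"
    "fr (lane_pop d fl j) d \<rho> = Suc (\<rho> 0)"
  using assms by (auto simp: lane_pop_def forE_id forF_id)

text \<open>Cell \<open>T\<close> receives the zero from the fresh wire, which is right only if
  nothing is stored beyond it; this is the hypothesis \<open>act\<close>.\<close>

lemma trans_lane_pop:
  assumes "ok T (\<rho> 0) L f" "\<rho> 2 = T" "d > 2" "C + K * Suc T \<le> \<rho> 0" "j < K"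
    "0 < fl" "fl < C" "0 < nx" "nx \<le> C"
    and act: "f fl \<Longrightarrow> \<not> L j (Suc T)"
  shows "trans T nx (\<rho> 0) f (em (lane_pop d fl j) d \<rho>) (fr (lane_pop d fl j) d \<rho>)
    (if f fl then L(j := (\<lambda>i. L j (Suc i))) else L)"
proof -
  define A where "A = C + j"
  define g where "g = cl (cswap fl A (\<rho> 0)) f"
  define gs where "gs = concat (map (\<lambda>i. cswap fl (A + K * i) (A + K * Suc i)) [0..<T])"
  have A: "A > 0" "A \<ge> C" using C by (auto simp: A_def)
  have flA: "fl \<noteq> A + K * i" "fl \<noteq> A" "fl \<noteq> 0" "fl \<noteq> \<rho> 0" for i using A assms by auto
  have "\<not> f (\<rho> 0)" using assms by (simp add: ok_def)
  have em: "cl (em (lane_pop d fl j) d \<rho>) f = cl gs g"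
    using assms(2,3) by (simp add: em_lane_pop g_def gs_def A_def)
  have small: "A + K * i < C + K * Suc T" if "i \<le> T" for i
    using cell_less[OF \<open>j < K\<close> that] by (simp add: A_def)
  have small0: "A < C + K * Suc T" using small[of 0] by simp
  have ne: "A \<noteq> \<rho> 0" using small0 assms by simp
  have g: "g = (if f fl then f(A := False, \<rho> 0 := f A) else f)"
    using flA ne \<open>\<not> f (\<rho> 0)\<close> by (simp add: g_def cl_cswap)
  have wf: "\<forall>x\<in>set (em (lane_pop d fl j) d \<rho>). cgate x \<and> wf_gate (Suc (\<rho> 0)) x"
  proof -
    have "wf_gate (Suc (\<rho> 0)) x \<and> cgate x" if "x \<in> set (cswap fl (A + K * i) (A + K * Suc i))" "i < T" for x i
      using that small[of i] small[of "Suc i"] flA(1)[of i] flA(1)[of "Suc i"] flA A K assms by (auto simp: cswap_def)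
    moreover have "wf_gate (Suc (\<rho> 0)) x \<and> cgate x" if "x \<in> set (cswap fl A (\<rho> 0))" for x
      using that small0 flA ne assms by (auto simp: cswap_def)
    ultimately show ?thesis using assms(2,3)
      by (auto simp: em_lane_pop A_def)
  qed
  have "ok T (Suc (\<rho> 0)) (if f fl then L(j := (\<lambda>i. L j (Suc i))) else L) (cl gs g) \<and> frame T nx (\<rho> 0) f (cl gs g)"
  proof (cases "f fl")
    case False
    then have "g = f" by (simp add: g)
    moreover have "cl gs f = f" unfolding gs_def using A flA False K
      by (intro cl_inactive) (auto simp del: mult_Suc_right)
    ultimately show ?thesis using False assms by (auto simp: frame_def ok_def)
  next
    case True
    then have gfl: "g fl" using flA by (simp add: g)
    note su = shift_down[of g fl A K T, folded gs_def]
    have su: "cl gs g (A + K * T) = False" 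
      "\<And>i. i < T \<Longrightarrow> cl gs g (A + K * i) = g (A + K * Suc i)"
      "\<And>w. \<forall>i\<le>T. w \<noteq> A + K * i \<Longrightarrow> cl gs g w = g w"
      using su gfl True flA A K ne by (auto simp: g)
    have L: "f (A + K * i) = L j i" if "i \<le> T" for i
      using assms that by (auto simp: ok_def A_def)
    have other: "cl gs g w = f w" if "\<And>i. i \<le> T \<Longrightarrow> w \<noteq> A + K * i" "w \<noteq> \<rho> 0" for w
    proof -
      have "w \<noteq> A" using that(1)[of 0] by simp
      then show ?thesis using su(3)[of w] that True by (simp add: g)
    qed
    have "cl gs g (A + K * i) = L j (Suc i)" if "i \<le> T" for i
    proof (cases "i = T")
      case True
      then show ?thesis using su(1) act[OF \<open>f fl\<close>] by simp
    next
      case False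
      then have i: "Suc i \<le> T" using that by simp
      have "g (A + K * Suc i) = f (A + K * Suc i)" using small[OF i] K assms by (simp add: g)
      then show ?thesis using su(2)[of i] L[OF i] that False by simp
    qed
    moreover have "\<not> cl gs g 0" using A C assms by (subst other) (auto simp: ok_def)
    moreover have "\<not> cl gs g i" if "i \<ge> Suc (\<rho> 0)" for i
    proof -
      have "i \<noteq> A + K * k" if "k \<le> T" for k using small[of k] that \<open>i \<ge> Suc (\<rho> 0)\<close> assms by auto
      then have "cl gs g i = f i" using \<open>i \<ge> Suc (\<rho> 0)\<close> assms C by (intro other) auto
      then show ?thesis using that assms by (simp add: ok_def)
    qed
    moreover have "cl gs g (C + j' + K * i) = L j' i" if "j' < K" "i \<le> T" "j' \<noteq> j" for j' i
    proof -
      have "C + j' + K * i \<noteq> A + K * k" for k using cell_inj[of j' j i k] that assms by (simp add: A_def)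
      moreover have "C + j' + K * i < C + K * Suc T" using cell_less that by blast
      ultimately show ?thesis using that assms C by (subst other) (auto simp: ok_def)
    qed
    moreover have "frame T nx (\<rho> 0) f (cl gs g)"
    proof -
      have "w \<noteq> A + K * i" if "w < nx \<or> C + K * Suc T \<le> w" "i \<le> T" for w i
        using that small[of i] A assms by auto
      moreover have "w \<noteq> \<rho> 0" if "w < nx \<or> C + K * Suc T \<le> w \<and> w < \<rho> 0" for w
        using that assms by auto
      ultimately show ?thesis unfolding frame_def by (metis other)
    qed
    ultimately show ?thesis using True assms by (simp add: ok_upd A_def)
  qed
  then show ?thesis unfolding trans_def em using wf assms by (simp add: em_lane_pop)
qed


lemma cell_ne: "j < K \<Longrightarrow> i \<le> T \<Longrightarrow> w < C \<or> C + K * Suc T \<le> w \<Longrightarrow> C + j + K * i \<noteq> w"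
  using cell_less[of j i T] by auto

lemma trans_clear_wire:
  assumes "ok T (\<rho> 0) L f" "C + K * Suc T \<le> \<rho> 0" "0 < w" "w < C"
  shows "trans T w (\<rho> 0) f (em (clear_wire w) d \<rho>) (fr (clear_wire w) d \<rho>) L"
    "\<not> cl (em (clear_wire w) d \<rho>) f w"
    "v < C \<Longrightarrow> v \<noteq> w \<Longrightarrow> cl (em (clear_wire w) d \<rho>) f v = f v"
    "twire t < C + K \<Longrightarrow> cl (em (clear_wire w) d \<rho>) f (twire t) = f (twire t)"
proof -
  have f: "cl (em (clear_wire w) d \<rho>) f = f(\<rho> 0 := f w, w := False)"
    using assms by (auto simp: clear_wire_def ok_def fun_eq_iff)
  have ne: "C + j + K * i \<noteq> \<rho> 0" "C + j + K * i \<noteq> w" if "j < K" "i \<le> T" for i j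
    using cell_ne[of j i T] that assms by auto
  have "twire t \<ge> C" by (cases t) auto
  then show "\<not> cl (em (clear_wire w) d \<rho>) f w"
    "v < C \<Longrightarrow> v \<noteq> w \<Longrightarrow> cl (em (clear_wire w) d \<rho>) f v = f v"
    "twire t < C + K \<Longrightarrow> cl (em (clear_wire w) d \<rho>) f (twire t) = f (twire t)"
    using assms by (auto simp: f)
  show "trans T w (\<rho> 0) f (em (clear_wire w) d \<rho>) (fr (clear_wire w) d \<rho>) L"
    using assms ne unfolding trans_def f by (auto simp: ok_def frame_def clear_wire_def)
qed

lemma trans_flag_gate:
  assumes "ok T F L f" "C + K * Suc T \<le> F" "0 < nx" "nx < C" "cgate g" "wf_gate (C + K) g"
    "\<And>v. v \<noteq> nx \<Longrightarrow> cg g f v = f v"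
  shows "trans T nx F f [g] F L"
proof -
  have "C + K \<le> F" using assms(2) by simp
  then have "wf_gate F g" using assms(6) wf_gate_mono by blast
  moreover have "C + j + K * i \<noteq> nx" if "j < K" "i \<le> T" for i j
    using cell_ne[of j i T] that assms by auto
  moreover have "\<not> cg g f i" if "F \<le> i" for i
  proof -
    have "i \<noteq> nx" using that assms by auto
    then show ?thesis using assms that by (auto simp: ok_def)
  qed
  moreover have "0 \<noteq> nx" "\<not> f 0" using assms by (auto simp: ok_def)
  then have "\<not> cg g f 0" using assms(7)[of 0] by simp
  ultimately show ?thesis
    using assms unfolding trans_def by (auto simp: ok_def frame_def)
qed

lemma trans_set_flag:
  assumes "ok T (\<rho> 0) L f" "C + K * Suc T \<le> \<rho> 0" "twire t < C + K" 
    "0 < fl" "fl < nx" "nx < C"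
  shows "trans T nx (\<rho> 0) f (em (set_flag fl t nx) d \<rho>) (fr (set_flag fl t nx) d \<rho>) L"
    "cl (em (set_flag fl t nx) d \<rho>) f nx \<longleftrightarrow> f fl \<and> f (twire t)"
proof -
  have "0 < nx" using assms by simp
  note cw = trans_clear_wire[of T \<rho> L f nx, OF assms(1,2) this assms(6)]
  let ?f = "cl (em (clear_wire nx) d \<rho>) f" and ?F = "fr (clear_wire nx) d \<rho>"
  have tw: "twire t \<ge> C" by (cases t) auto
  have "trans T nx ?F ?f [Toffoli fl (twire t) nx] ?F L"
    using cw(1)[of d] assms tw by (intro trans_flag_gate) (auto simp: trans_def)
  from trans_append[OF cw(1) this]
  show "trans T nx (\<rho> 0) f (em (set_flag fl t nx) d \<rho>) (fr (set_flag fl t nx) d \<rho>) L"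
    by (simp add: set_flag_def)
  show "cl (em (set_flag fl t nx) d \<rho>) f nx \<longleftrightarrow> f fl \<and> f (twire t)"
    using cw(2) cw(3)[of fl] cw(4)[of t] assms tw by (simp add: set_flag_def)
qed

end

lemma exec_simps:
  "exec Skip s k s' \<longleftrightarrow> k = 1 \<and> s' = s"
  "exec (Push r b) s k s' \<longleftrightarrow> k = 1 \<and> s' = s(r := b # s r)"
  "exec (Pop r) s k s' \<longleftrightarrow> k = 1 \<and> s' = s(r := tl (s r))"
  by (auto simp: exec.simps[of Skip] exec.simps[of "Push r b"] exec.simps[of "Pop r"])

section \<open>Correctness of compiled programs\<close>

context layout
begin

lemma transD:
  assumes "trans T nx F f gs F' L'"
  shows "F \<le> F'" "ok T F' L' (cl gs f)" "w < nx \<Longrightarrow> cl gs f w = f w"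
  using assms by (auto simp: trans_def frame_def)

lemma ok_twire:
  assumes "ok T F L f" "twire t < C + K"
  shows "f (twire t) = L (twire t - C) 0"
proof -
  have *: "f (C + j + K * 0) = L j 0" if "j < K" for j
    using assms(1) that unfolding ok_def by blast
  have tw: "C \<le> twire t" by (cases t) auto
  then have "C + (twire t - C) + K * 0 = twire t" by simp
  moreover have "twire t - C < K" using assms tw by simp
  ultimately show ?thesis using * by metis
qed

lemma lanes_twire: "lanes s (twire t - C) 0 = holds t s"
  by (cases t) (auto simp: lanes_def hd_conv_nth)

definition cond_prefix :: "nat \<Rightarrow> test \<Rightarrow> nat \<Rightarrow> gen" where
  "cond_prefix fl t nx = set_flag fl t nx ;; clear_wire (Suc nx) ;;
     Emit (TCNOT (const fl) (const (Suc nx))) ;; Emit (TCNOT (const nx) (const (Suc nx)))"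

lemma comp_Cond:
  "em (comp d fl nx (Cond t P Q)) d \<rho> = em (cond_prefix fl t nx ;; comp d nx (nx + 2) P ;; comp d (Suc nx) (nx + 2) Q) d \<rho>"
  "fr (comp d fl nx (Cond t P Q)) d \<rho> = fr (cond_prefix fl t nx ;; comp d nx (nx + 2) P ;; comp d (Suc nx) (nx + 2) Q) d \<rho>"
  by (simp_all add: cond_prefix_def)

lemma trans_Then:
  assumes "trans T nx (\<rho> 0) f (em g d \<rho>) (fr g d \<rho>) L1"
    "\<And>\<rho>1 f1. \<lbrakk>f1 = cl (em g d \<rho>) f; \<rho> 0 \<le> \<rho>1 0; \<And>v. v \<noteq> 0 \<Longrightarrow> \<rho>1 v = \<rho> v; ok T (\<rho>1 0) L1 f1; \<And>w. w < nx \<Longrightarrow> f1 w = f w\<rbrakk> \<Longrightarrow>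
       trans T nx (\<rho>1 0) f1 (em h d \<rho>1) (fr h d \<rho>1) L2"
  shows "trans T nx (\<rho> 0) f (em (g ;; h) d \<rho>) (fr (g ;; h) d \<rho>) L2"
proof -
  have "trans T nx (fr g d \<rho>) (cl (em g d \<rho>) f) (em h d (\<rho>(0 := fr g d \<rho>))) (fr h d (\<rho>(0 := fr g d \<rho>))) L2"
    using assms(2)[of "cl (em g d \<rho>) f" "\<rho>(0 := fr g d \<rho>)"] transD[OF assms(1)] by simp
  from trans_append[OF assms(1) this] show ?thesis by simp
qed

lemma trans_cond_prefix:
  assumes "ok T (\<rho> 0) L f" "C + K * Suc T \<le> \<rho> 0" "twire t < C + K" 
    "0 < fl" "fl < nx" "Suc nx < C"
  shows "trans T nx (\<rho> 0) f (em (cond_prefix fl t nx) d \<rho>) (fr (cond_prefix fl t nx) d \<rho>) L"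
    "cl (em (cond_prefix fl t nx) d \<rho>) f nx \<longleftrightarrow> f fl \<and> f (twire t)"
    "cl (em (cond_prefix fl t nx) d \<rho>) f (Suc nx) \<longleftrightarrow> f fl \<and> \<not> f (twire t)"
proof -
  have nx: "nx < C" "0 < Suc nx" using assms by auto
  note sf = trans_set_flag[where \<rho> = \<rho>, OF assms(1-5) nx(1)]
  let ?f1 = "cl (em (set_flag fl t nx) d \<rho>) f" and ?F1 = "fr (set_flag fl t nx) d \<rho>"
  let ?\<rho>1 = "\<rho>(0 := ?F1)"
  have F1: "\<rho> 0 \<le> ?F1" and ok1: "ok T (?\<rho>1 0) L ?f1" using transD[OF sf(1)[of d]] by auto
  have "C + K * Suc T \<le> ?\<rho>1 0" using F1 assms by simp
  note cw = trans_clear_wire[where \<rho> = ?\<rho>1, OF ok1 this nx(2) assms(6)]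
  let ?f2 = "cl (em (clear_wire (Suc nx)) d ?\<rho>1) ?f1" and ?F2 = "fr (clear_wire (Suc nx)) d ?\<rho>1"
  have F2: "?F1 \<le> ?F2" and ok2: "ok T ?F2 L ?f2" using transD[OF cw(1)[of d]] by auto
  have le: "C + K * Suc T \<le> ?F2" using F1 F2 assms by simp
  have g1: "trans T (Suc nx) ?F2 ?f2 [CNOT fl (Suc nx)] ?F2 L"
    using assms ok2 le by (intro trans_flag_gate) auto
  have g2: "trans T (Suc nx) ?F2 (cl [CNOT fl (Suc nx)] ?f2) [CNOT nx (Suc nx)] ?F2 L"
    using assms transD(2)[OF g1] le by (intro trans_flag_gate) auto
  have "trans T nx ?F1 ?f1 (em (clear_wire (Suc nx)) d ?\<rho>1 @ [CNOT fl (Suc nx)] @ [CNOT nx (Suc nx)]) ?F2 L"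
    using trans_append[OF cw(1)[of d] trans_append[OF g1 g2]] trans_weaken by fastforce
  from trans_append[OF sf(1) this]
  show "trans T nx (\<rho> 0) f (em (cond_prefix fl t nx) d \<rho>) (fr (cond_prefix fl t nx) d \<rho>) L"
    by (simp add: cond_prefix_def)
  have "?f2 nx = ?f1 nx" "?f2 fl = ?f1 fl" "\<not> ?f2 (Suc nx)" "?f1 fl = f fl"
    using cw(2)[of d] cw(3)[of nx d] cw(3)[of fl d] transD(3)[OF sf(1)[of d], of fl] assms by auto
  then show "cl (em (cond_prefix fl t nx) d \<rho>) f nx \<longleftrightarrow> f fl \<and> f (twire t)"
    "cl (em (cond_prefix fl t nx) d \<rho>) f (Suc nx) \<longleftrightarrow> f fl \<and> \<not> f (twire t)"
    using sf(2)[of d] by (auto simp: cond_prefix_def)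
qed

text \<open>If the guard or the control fails, the new flag is unset, so the round changes no lane
  and the guard fails in the next round as well. This pads a finished loop to any number of
  rounds.\<close>

lemma loop_idle:
  assumes P: "\<And>d \<rho> fl nx f. \<lbrakk>d > 2; \<rho> 2 = T; C + K * Suc T \<le> \<rho> 0; 0 < fl; fl < nx; nx + flags P \<le> C;
      ok T (\<rho> 0) L f; \<not> f fl\<rbrakk> \<Longrightarrow> trans T nx (\<rho> 0) f (em (comp d fl nx P) d \<rho>) (fr (comp d fl nx P) d \<rho>) L"
    and "d > 2" "\<rho> 2 = T" "0 < fl" "fl < nx" "Suc nx + flags P \<le> C" "twire t < C + K"
  defines "g \<equiv> set_flag fl t nx ;; comp (Suc d) nx (Suc nx) P"
  shows "\<lbrakk>C + K * Suc T \<le> F; ok T F L f; \<not> (f fl \<and> L (twire t - C) 0)\<rbrakk> \<Longrightarrow>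
    trans T nx F f (forE (\<lambda>i F. fr g (Suc d) (\<rho>(0 := F, d := i))) (\<lambda>i F. em g (Suc d) (\<rho>(0 := F, d := i))) c i F)
      (forF (\<lambda>i F. fr g (Suc d) (\<rho>(0 := F, d := i))) c i F) L"
proof (induction c arbitrary: i F f)
  case 0 then show ?case by (simp add: trans_Nil)
next
  case (Suc c)
  define \<rho>' where "\<rho>' = \<rho>(0 := F, d := i)"
  have \<rho>': "\<rho>' 0 = F" "\<rho>' 2 = T" using assms(2,3) by (auto simp: \<rho>'_def)
  note sf = trans_set_flag[of T \<rho>' L f t fl nx "Suc d"]
  have t: "f (twire t) = L (twire t - C) 0" using ok_twire Suc.prems assms by blast
  have "trans T nx (\<rho>' 0) f (em g (Suc d) \<rho>') (fr g (Suc d) \<rho>') L" unfolding g_def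
  proof (rule trans_Then)
    show "trans T nx (\<rho>' 0) f (em (set_flag fl t nx) (Suc d) \<rho>') (fr (set_flag fl t nx) (Suc d) \<rho>') L"
      using sf(1) Suc.prems assms \<rho>' by simp
  next
    fix \<rho>1 f1 assume "f1 = cl (em (set_flag fl t nx) (Suc d) \<rho>') f" "\<rho>' 0 \<le> \<rho>1 0" "ok T (\<rho>1 0) L f1"
      "\<And>v. v \<noteq> 0 \<Longrightarrow> \<rho>1 v = \<rho>' v"
    then have "trans T (Suc nx) (\<rho>1 0) f1 (em (comp (Suc d) nx (Suc nx) P) (Suc d) \<rho>1) (fr (comp (Suc d) nx (Suc nx) P) (Suc d) \<rho>1) L"
      using sf(2) Suc.prems assms \<rho>' t by (intro P) auto
    then show "trans T nx (\<rho>1 0) f1 (em (comp (Suc d) nx (Suc nx) P) (Suc d) \<rho>1) (fr (comp (Suc d) nx (Suc nx) P) (Suc d) \<rho>1) L"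
      by (rule trans_weaken) simp
  qed
  then have step: "trans T nx F f (em g (Suc d) \<rho>') (fr g (Suc d) \<rho>') L" by (simp add: \<rho>')
  note td = transD[OF step]
  have "cl (em g (Suc d) \<rho>') f fl = f fl" using td(3) assms by blast
  moreover have "C + K * Suc T \<le> fr g (Suc d) \<rho>'" using td(1) Suc.prems by simp
  ultimately show ?case
    using trans_append[OF step Suc.IH[OF _ td(2)]] Suc.prems by (simp add: \<rho>'_def del: fun_upd_apply)
qed

lemma twire_less: "\<forall>r\<in>insert (case t of Nonempty r \<Rightarrow> r | Head_True r \<Rightarrow> r) R. Suc (2 * r) < K \<Longrightarrow> twire t < C + K"
  by (cases t) auto

text \<open>Inactive code still consumes fresh wires and recomputes its flags, but it leaves the
  lanes alone. The branch of a conditional that is not taken and the surplus rounds of a loop rest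
  on this.\<close>

lemma comp_inactive:
  assumes "\<forall>r\<in>regs P. Suc (2 * r) < K" 
    "d > 2" "\<rho> 2 = T" "C + K * Suc T \<le> \<rho> 0" "0 < fl" "fl < nx" "nx + flags P \<le> C"
      "ok T (\<rho> 0) L f" "\<not> f fl"
  shows "trans T nx (\<rho> 0) f (em (comp d fl nx P) d \<rho>) (fr (comp d fl nx P) d \<rho>) L"
  using assms
proof (induction P arbitrary: d fl nx \<rho> f)
  case Skip
  then show ?case by (simp add: trans_Nil)
next
  case (Push r b)
  have 1: "trans T nx (\<rho> 0) f (em (lane_push d fl j b) d \<rho>) (fr (lane_push d fl j b) d \<rho>) L"
    if "j < K" "ok T (\<rho> 0) L f" "\<not> f fl" "C + K * Suc T \<le> \<rho> 0" "\<rho> 2 = T" for \<rho> f j b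
    using trans_lane_push[where \<rho> = \<rho> and f = f and d = d and j = j and fl = fl and nx = nx and b = b and L = L and T = T] that Push.prems by simp
  show ?case
    unfolding comp.simps
  proof (rule trans_Then)
    show "trans T nx (\<rho> 0) f (em (lane_push d fl (2 * r) True) d \<rho>) (fr (lane_push d fl (2 * r) True) d \<rho>) L"
      using Push.prems by (intro 1) auto
  qed (rule 1, use Push.prems in auto)
next
  case (Pop r)
  have 1: "trans T nx (\<rho> 0) f (em (lane_pop d fl j) d \<rho>) (fr (lane_pop d fl j) d \<rho>) L"
    if "j < K" "ok T (\<rho> 0) L f" "\<not> f fl" "C + K * Suc T \<le> \<rho> 0" "\<rho> 2 = T" for \<rho> f j
    using trans_lane_pop[where \<rho> = \<rho> and f = f and d = d and j = j and fl = fl and nx = nx and L = L and T = T] that Pop.prems by simp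
  show ?case
    unfolding comp.simps
  proof (rule trans_Then)
    show "trans T nx (\<rho> 0) f (em (lane_pop d fl (2 * r)) d \<rho>) (fr (lane_pop d fl (2 * r)) d \<rho>) L"
      using Pop.prems by (intro 1) auto
  qed (rule 1, use Pop.prems in auto)
next
  case (Seq P Q)
  show ?case
    unfolding comp.simps
  proof (rule trans_Then)
    show "trans T nx (\<rho> 0) f (em (comp d fl nx P) d \<rho>) (fr (comp d fl nx P) d \<rho>) L"
      using Seq.prems by (intro Seq.IH(1)) auto
  qed (rule Seq.IH(2), use Seq.prems in auto)
next
  case (Cond t P Q)
  have tw: "twire t < C + K" using Cond.prems(1) by (intro twire_less) auto
  note cp = trans_cond_prefix[of T \<rho> L f t fl nx d]
  show ?case unfolding comp_Cond
  proof (rule trans_Then)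
    show "trans T nx (\<rho> 0) f (em (cond_prefix fl t nx) d \<rho>) (fr (cond_prefix fl t nx) d \<rho>) L"
      using cp(1) Cond.prems tw by simp
    fix \<rho>1 f1 assume f1: "f1 = cl (em (cond_prefix fl t nx) d \<rho>) f" "\<rho> 0 \<le> \<rho>1 0" "ok T (\<rho>1 0) L f1"
      "\<And>v. v \<noteq> 0 \<Longrightarrow> \<rho>1 v = \<rho> v"
    have nf: "\<not> f1 nx" "\<not> f1 (Suc nx)" using f1 cp(2,3) Cond.prems tw by auto
    have "trans T (nx + 2) (\<rho>1 0) f1 (em (comp d nx (nx + 2) P ;; comp d (Suc nx) (nx + 2) Q) d \<rho>1)
         (fr (comp d nx (nx + 2) P ;; comp d (Suc nx) (nx + 2) Q) d \<rho>1) L"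
    proof (rule trans_Then)
      show "trans T (nx + 2) (\<rho>1 0) f1 (em (comp d nx (nx + 2) P) d \<rho>1) (fr (comp d nx (nx + 2) P) d \<rho>1) L"
        using Cond.prems nf f1 by (intro Cond.IH(1)) auto
    qed (rule Cond.IH(2), use Cond.prems nf f1 in auto)
    then show "trans T nx (\<rho>1 0) f1 (em (comp d nx (nx + 2) P ;; comp d (Suc nx) (nx + 2) Q) d \<rho>1)
         (fr (comp d nx (nx + 2) P ;; comp d (Suc nx) (nx + 2) Q) d \<rho>1) L"
      by (rule trans_weaken) simp
  qed
next
  case (Loop t P)
  have tw: "twire t < C + K" using Loop.prems(1) by (intro twire_less) auto
  show ?case unfolding comp.simps em.simps(5) fr.simps(5)
    using Loop.prems tw by (intro loop_idle[OF Loop.IH]) auto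
qed


text \<open>Induction on the remaining rounds \<open>c\<close>. Every iteration costs at least one
  unit of time, so \<open>c\<close> rounds suffice for an execution of time at most
  \<open>c\<close>; once the guard fails, \<open>loop_idle\<close> covers the rest.\<close>

lemma loop_active:
  assumes P: "\<And>d \<rho> fl nx f s k s'. \<lbrakk>d > 2; \<rho> 2 = T; C + K * Suc T \<le> \<rho> 0; 0 < fl; fl < nx; nx + flags P \<le> C;
      ok T (\<rho> 0) (lanes s) f; f fl; exec P s k s'; \<And>r. length (s r) + k \<le> T\<rbrakk> \<Longrightarrow>
      trans T nx (\<rho> 0) f (em (comp d fl nx P) d \<rho>) (fr (comp d fl nx P) d \<rho>) (lanes s')"
    and regs: "\<forall>r\<in>regs P. Suc (2 * r) < K" 
    and "d > 2" "\<rho> 2 = T" "0 < fl" "fl < nx" "Suc nx + flags P \<le> C" "twire t < C + K"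
  defines "g \<equiv> set_flag fl t nx ;; comp (Suc d) nx (Suc nx) P"
  shows "\<lbrakk>C + K * Suc T \<le> F; ok T F (lanes s) f; f fl; exec (Loop t P) s k s'; \<And>r. length (s r) + k \<le> T; k \<le> c\<rbrakk> \<Longrightarrow>
    trans T nx F f (forE (\<lambda>i F. fr g (Suc d) (\<rho>(0 := F, d := i))) (\<lambda>i F. em g (Suc d) (\<rho>(0 := F, d := i))) c i F)
      (forF (\<lambda>i F. fr g (Suc d) (\<rho>(0 := F, d := i))) c i F) (lanes s')"
proof (induction c arbitrary: i F f s k)
  case 0
  \<comment> \<open>Vacuous, since no execution takes time 0.\<close>
  from 0(4) 0(6) show ?case by cases auto
next
  case (Suc c)
  from Suc.prems(4) show ?case
  proof cases
    case Loop_False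
    show ?thesis unfolding g_def
    proof (rule loop_idle)
      show "\<not> (f fl \<and> lanes s' (twire t - C) 0)" using Loop_False by (simp add: lanes_twire)
      show "ok T F (lanes s') f" using Loop_False Suc.prems by simp
    qed (use Suc.prems assms comp_inactive[OF regs] in auto)
  next
    case (Loop_True k1 s1 k2)
    define \<rho>' where "\<rho>' = \<rho>(0 := F, d := i)"
    have \<rho>': "\<rho>' 0 = F" "\<rho>' 2 = T" using assms(3,4) by (auto simp: \<rho>'_def)
    note sf = trans_set_flag[of T \<rho>' "lanes s" f t fl nx "Suc d"]
    have t: "f (twire t)" using ok_twire[OF Suc.prems(2)] assms Loop_True by (simp add: lanes_twire)
    have "trans T nx (\<rho>' 0) f (em g (Suc d) \<rho>') (fr g (Suc d) \<rho>') (lanes s1)" unfolding g_def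
    proof (rule trans_Then)
      show "trans T nx (\<rho>' 0) f (em (set_flag fl t nx) (Suc d) \<rho>') (fr (set_flag fl t nx) (Suc d) \<rho>') (lanes s)"
        using sf(1) Suc.prems assms \<rho>' by simp
    next
      fix \<rho>1 f1 assume f1: "f1 = cl (em (set_flag fl t nx) (Suc d) \<rho>') f" "\<rho>' 0 \<le> \<rho>1 0" "ok T (\<rho>1 0) (lanes s) f1"
        "\<And>v. v \<noteq> 0 \<Longrightarrow> \<rho>1 v = \<rho>' v"
      have le: "length (s r) + k1 \<le> T" for r using Suc.prems(5)[of r] Loop_True by simp
      have "f1 nx" using f1 sf(2) Suc.prems assms \<rho>' t by auto
      then have "trans T (Suc nx) (\<rho>1 0) f1 (em (comp (Suc d) nx (Suc nx) P) (Suc d) \<rho>1) (fr (comp (Suc d) nx (Suc nx) P) (Suc d) \<rho>1) (lanes s1)"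
        using f1 Suc.prems assms \<rho>' le by (intro P[OF _ _ _ _ _ _ _ _ \<open>exec P s k1 s1\<close>]) auto
      then show "trans T nx (\<rho>1 0) f1 (em (comp (Suc d) nx (Suc nx) P) (Suc d) \<rho>1) (fr (comp (Suc d) nx (Suc nx) P) (Suc d) \<rho>1) (lanes s1)"
        by (rule trans_weaken) simp
    qed
    then have step: "trans T nx F f (em g (Suc d) \<rho>') (fr g (Suc d) \<rho>') (lanes s1)" by (simp add: \<rho>')
    note td = transD[OF step]
    have "cl (em g (Suc d) \<rho>') f fl" using td(3) assms Suc.prems by blast
    moreover have "C + K * Suc T \<le> fr g (Suc d) \<rho>'" using td(1) Suc.prems by simp
    moreover have "length (s1 r) + k2 \<le> T" for r
      using exec_length[OF \<open>exec P s k1 s1\<close>, of r] Suc.prems(5)[of r] Loop_True by simp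
    moreover have "k2 \<le> c" using Suc.prems Loop_True by simp
    ultimately show ?thesis
      using trans_append[OF step Suc.IH[OF _ td(2) _ \<open>exec (Loop t P) s1 k2 s'\<close>]] by (simp add: \<rho>'_def del: fun_upd_apply)
  qed
qed

text \<open>The bound on length plus remaining time is inherited by all later instructions, since a
  unit of time lengthens a stack by at most one. It gives every push its room, and every loop enough
  rounds, as all loops are unrolled \<open>T\<close> times.\<close>

lemma comp_active:
  assumes "\<forall>r\<in>regs P. Suc (2 * r) < K" 
    "d > 2" "\<rho> 2 = T" "C + K * Suc T \<le> \<rho> 0" "0 < fl" "fl < nx" "nx + flags P \<le> C"
    "ok T (\<rho> 0) (lanes s) f" "f fl" "exec P s k s'" "\<And>r. length (s r) + k \<le> T"
  shows "trans T nx (\<rho> 0) f (em (comp d fl nx P) d \<rho>) (fr (comp d fl nx P) d \<rho>) (lanes s')"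
  using assms
proof (induction P arbitrary: d fl nx \<rho> f s k s')
  case Skip
  then show ?case by (auto simp: exec_simps trans_Nil)
next
  case (Push r b)
  have k: "k = 1" and s': "s' = s(r := b # s r)" using Push.prems(10) by (auto simp: exec_simps)
  have len: "length (s r) < T" using Push.prems(11)[of r] k by simp
  then have nl: "\<not> lanes s (2 * r) T" "\<not> lanes s (Suc (2 * r)) T" "\<not> lanes s (2 * r) (T - 1)" "\<not> lanes s (Suc (2 * r)) (T - 1)"
    "\<not> lanes s (2 * r) (Suc T)" "\<not> lanes s (Suc (2 * r)) (Suc T)"
    by (auto simp: lanes_def)
  show ?case unfolding comp.simps s' lanes_push
  proof (rule trans_Then)
    show "trans T nx (\<rho> 0) f (em (lane_push d fl (2 * r) True) d \<rho>) (fr (lane_push d fl (2 * r) True) d \<rho>)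
      ((lanes s)(2 * r := lcons True (lanes s (2 * r))))"
      using trans_lane_push[of T \<rho> "lanes s" f d "2 * r" fl nx True] Push.prems len nl by auto
    fix \<rho>1 f1 assume "\<rho> 0 \<le> \<rho>1 0" "\<And>v. v \<noteq> 0 \<Longrightarrow> \<rho>1 v = \<rho> v" 
      "ok T (\<rho>1 0) ((lanes s)(2 * r := lcons True (lanes s (2 * r)))) f1" "\<And>w. w < nx \<Longrightarrow> f1 w = f w"
    then show "trans T nx (\<rho>1 0) f1 (em (lane_push d fl (Suc (2 * r)) b) d \<rho>1) (fr (lane_push d fl (Suc (2 * r)) b) d \<rho>1)
      ((lanes s)(2 * r := lcons True (lanes s (2 * r)), Suc (2 * r) := lcons b (lanes s (Suc (2 * r)))))"
      using trans_lane_push[of T \<rho>1 "(lanes s)(2 * r := lcons True (lanes s (2 * r)))" f1 d "Suc (2 * r)" fl nx b] Push.prems len nl by auto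
  qed
next
  case (Pop r)
  have k: "k = 1" and s': "s' = s(r := tl (s r))" using Pop.prems(10) by (auto simp: exec_simps)
  have len: "length (s r) < T" using Pop.prems(11)[of r] k by simp
  then have nl: "\<not> lanes s (2 * r) T" "\<not> lanes s (Suc (2 * r)) T" "\<not> lanes s (2 * r) (T - 1)" "\<not> lanes s (Suc (2 * r)) (T - 1)"
    "\<not> lanes s (2 * r) (Suc T)" "\<not> lanes s (Suc (2 * r)) (Suc T)"
    by (auto simp: lanes_def)
  show ?case unfolding comp.simps s' lanes_pop
  proof (rule trans_Then)
    show "trans T nx (\<rho> 0) f (em (lane_pop d fl (2 * r)) d \<rho>) (fr (lane_pop d fl (2 * r)) d \<rho>)
      ((lanes s)(2 * r := (\<lambda>i. lanes s (2 * r) (Suc i))))"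
      using trans_lane_pop[of T \<rho> "lanes s" f d "2 * r" fl nx] Pop.prems len nl by auto
    fix \<rho>1 f1 assume "\<rho> 0 \<le> \<rho>1 0" "\<And>v. v \<noteq> 0 \<Longrightarrow> \<rho>1 v = \<rho> v" 
      "ok T (\<rho>1 0) ((lanes s)(2 * r := (\<lambda>i. lanes s (2 * r) (Suc i)))) f1" "\<And>w. w < nx \<Longrightarrow> f1 w = f w"
    then show "trans T nx (\<rho>1 0) f1 (em (lane_pop d fl (Suc (2 * r))) d \<rho>1) (fr (lane_pop d fl (Suc (2 * r))) d \<rho>1)
      ((lanes s)(2 * r := (\<lambda>i. lanes s (2 * r) (Suc i)), Suc (2 * r) := (\<lambda>i. lanes s (Suc (2 * r)) (Suc i))))"
      using trans_lane_pop[of T \<rho>1 "(lanes s)(2 * r := (\<lambda>i. lanes s (2 * r) (Suc i)))" f1 d "Suc (2 * r)" fl nx] Pop.prems len nl by auto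
  qed
next
  case (Seq P Q)
  from Seq.prems(10) obtain k1 s1 k2 where e: "exec P s k1 s1" "exec Q s1 k2 s'" "k = k1 + k2"
    by cases auto
  have le: "length (s r) + k1 \<le> T" "length (s1 r) + k2 \<le> T" for r
    using exec_length[OF e(1), of r] Seq.prems(11)[of r] e(3) by auto
  show ?case unfolding comp.simps 
  proof (rule trans_Then)
    show "trans T nx (\<rho> 0) f (em (comp d fl nx P) d \<rho>) (fr (comp d fl nx P) d \<rho>) (lanes s1)"
      using Seq.prems le by (intro Seq.IH(1)[OF _ _ _ _ _ _ _ _ _ e(1)]) auto
  qed (rule Seq.IH(2)[OF _ _ _ _ _ _ _ _ _ e(2)], use Seq.prems le in auto)
next
  case (Cond t P Q)
  have tw: "twire t < C + K" using Cond.prems(1) by (intro twire_less) auto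
  note cp = trans_cond_prefix[of T \<rho> "lanes s" f t fl nx d]
  have ft: "f (twire t) = holds t s" using ok_twire[OF Cond.prems(8) tw] by (simp add: lanes_twire)
  show ?case unfolding comp_Cond
  proof (rule trans_Then)
    show "trans T nx (\<rho> 0) f (em (cond_prefix fl t nx) d \<rho>) (fr (cond_prefix fl t nx) d \<rho>) (lanes s)"
      using cp(1) Cond.prems tw by simp
    fix \<rho>1 f1 assume f1: "f1 = cl (em (cond_prefix fl t nx) d \<rho>) f" "\<rho> 0 \<le> \<rho>1 0" "ok T (\<rho>1 0) (lanes s) f1"
      "\<And>v. v \<noteq> 0 \<Longrightarrow> \<rho>1 v = \<rho> v"
    have nf: "f1 nx = holds t s" "f1 (Suc nx) = (\<not> holds t s)" using f1(1) cp(2,3) Cond.prems tw ft by auto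
    have "trans T (nx + 2) (\<rho>1 0) f1 (em (comp d nx (nx + 2) P ;; comp d (Suc nx) (nx + 2) Q) d \<rho>1)
         (fr (comp d nx (nx + 2) P ;; comp d (Suc nx) (nx + 2) Q) d \<rho>1) (lanes s')"
      using Cond.prems(10)
    proof cases
      case (Cond_True k')
      have le: "length (s r) + k' \<le> T" for r using Cond.prems(11)[of r] Cond_True by simp
      show ?thesis
      proof (rule trans_Then)
        show "trans T (nx + 2) (\<rho>1 0) f1 (em (comp d nx (nx + 2) P) d \<rho>1) (fr (comp d nx (nx + 2) P) d \<rho>1) (lanes s')"
          using Cond.prems le f1 nf Cond_True by (intro Cond.IH(1)[OF _ _ _ _ _ _ _ _ _ \<open>exec P s k' s'\<close>]) auto
      qed (rule comp_inactive, use Cond.prems f1 nf Cond_True in auto)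
    next
      case (Cond_False k')
      have le: "length (s r) + k' \<le> T" for r using Cond.prems(11)[of r] Cond_False by simp
      show ?thesis
      proof (rule trans_Then)
        show "trans T (nx + 2) (\<rho>1 0) f1 (em (comp d nx (nx + 2) P) d \<rho>1) (fr (comp d nx (nx + 2) P) d \<rho>1) (lanes s)"
          using Cond.prems f1 nf Cond_False by (intro comp_inactive) auto
      qed (rule Cond.IH(2)[OF _ _ _ _ _ _ _ _ _ \<open>exec Q s k' s'\<close>], use Cond.prems le f1 nf Cond_False in auto)
    qed
    then show "trans T nx (\<rho>1 0) f1 (em (comp d nx (nx + 2) P ;; comp d (Suc nx) (nx + 2) Q) d \<rho>1)
         (fr (comp d nx (nx + 2) P ;; comp d (Suc nx) (nx + 2) Q) d \<rho>1) (lanes s')"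
      by (rule trans_weaken) simp
  qed
next
  case (Loop t P)
  have tw: "twire t < C + K" using Loop.prems(1) by (intro twire_less) auto
  have "k \<le> T" using Loop.prems(11)[of 0] by simp
  moreover have "\<forall>r\<in>regs P. Suc (2 * r) < K" using Loop.prems by simp
  ultimately show ?case unfolding comp.simps em.simps(5) fr.simps(5)
    using Loop.prems tw by (intro loop_active[OF Loop.IH _ _ _ _ _ _ _ _ _ _ Loop.prems(10)]) auto
qed

end

subsection \<open>Quantum gates on fetched qubits\<close>

text \<open>The product of the basis state \<open>f\<close> on the first \<open>W\<close> wires with
  a vector on \<open>m\<close> data qubits. It is zero on strings of the wrong length, so that kets
  can be compared as functions.\<close>

definition ketf :: "nat \<Rightarrow> nat \<Rightarrow> (nat \<Rightarrow> bool) \<Rightarrow> ket \<Rightarrow> ket" where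
  "ketf W m f \<Phi> = (\<lambda>z. if length z = W + m \<and> (\<forall>i<W. z ! i = f i) then \<Phi> (drop W z) else 0)"

text \<open>Gates act on kets by substitution in the argument, but on assignments forwards. The two
  agree because CNOT and Toffoli are involutions.\<close>

lemma cg_ketf:
  assumes "cgate g" "wf_gate W g"
  shows "gate_apply g (ketf W m f \<Phi>) = ketf W m (cg g f) \<Phi>"
proof
  fix z :: "bool list"
  show "gate_apply g (ketf W m f \<Phi>) z = ketf W m (cg g f) \<Phi> z"
  proof (cases "length z = W + m")
    case True
    show ?thesis
    proof (cases g)
      case (CNOT a q)
      have "(\<forall>i<W. z[q := z ! q \<noteq> z ! a] ! i = f i) \<longleftrightarrow> (\<forall>i<W. z ! i = cg g f i)"
        using assms CNOT True by (auto simp: nth_list_update split: if_splits)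
      moreover have "drop W (z[q := b]) = drop W z" for b using assms CNOT by simp
      ultimately show ?thesis unfolding CNOT gate_apply.simps ketf_def length_list_update by (simp only:)
    next
      case (Toffoli a b q)
      have "(\<forall>i<W. z[q := z ! q \<noteq> (z ! a \<and> z ! b)] ! i = f i) \<longleftrightarrow> (\<forall>i<W. z ! i = cg g f i)"
        using assms Toffoli True by (auto simp: nth_list_update split: if_splits)
      moreover have "drop W (z[q := b]) = drop W z" for b using assms Toffoli by simp
      ultimately show ?thesis unfolding Toffoli gate_apply.simps ketf_def length_list_update by (simp only:)
    qed (use assms in auto)
  qed (use assms in \<open>cases g; auto simp: ketf_def\<close>)
qed

lemma cl_ketf:
  assumes "\<forall>g\<in>set gs. cgate g \<and> wf_gate W g"
  shows "fold gate_apply gs (ketf W m f \<Phi>) = ketf W m (cl gs f) \<Phi>"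
  using assms by (induction gs arbitrary: f) (auto simp: cg_ketf)

primrec ren :: "(nat \<Rightarrow> nat) \<Rightarrow> gate \<Rightarrow> gate" where
  "ren f (Had q) = Had (f q)"
| "ren f (TGate q) = TGate (f q)"
| "ren f (CNOT a q) = CNOT (f a) (f q)"
| "ren f (Toffoli a b q) = Toffoli (f a) (f b) (f q)"

lemma ren_ketf:
  assumes "wf_gate m g"
  shows "gate_apply (ren ((+) W) g) (ketf W m f \<Phi>) = ketf W m f (gate_apply g \<Phi>)"
proof
  fix z :: "bool list"
  have u: "z[W + q := b] ! i = z ! i" if "i < W" for b q i using that by simp
  have d: "drop W (z[W + q := b]) = (drop W z)[q := b]" for b q by (simp add: drop_update_swap)
  show "gate_apply (ren ((+) W) g) (ketf W m f \<Phi>) z = ketf W m f (gate_apply g \<Phi>) z"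
    using assms by (cases g) (auto simp: ketf_def u d nth_append)
qed

section \<open>Swapping data qubits into work wires\<close>

definition swp :: "nat \<Rightarrow> nat \<Rightarrow> nat \<Rightarrow> nat" where
  "swp a b i = (if i = a then b else if i = b then a else i)"

definition swapl :: "nat \<Rightarrow> nat \<Rightarrow> 'b list \<Rightarrow> 'b list" where
  "swapl a b z = z[a := z ! b, b := z ! a]"

definition swapket :: "nat \<Rightarrow> nat \<Rightarrow> ket \<Rightarrow> ket" where
  "swapket a b \<psi> = (\<lambda>z. \<psi> (swapl a b z))"

lemma length_swapl [simp]: "length (swapl a b z) = length z"
  by (simp add: swapl_def)

lemma nth_swapl:
  assumes "a < length z" "b < length z" "i < length z"
  shows "swapl a b z ! i = z ! (swp a b i)"
  using assms by (auto simp: swapl_def swp_def nth_list_update)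

lemma swapl_swapl: "a < length z \<Longrightarrow> b < length z \<Longrightarrow> swapl a b (swapl a b z) = z"
  by (rule nth_equalityI) (auto simp: nth_swapl swp_def)

lemma swapl_update:
  assumes "a < length z" "b < length z" "i < length z"
  shows "swapl a b (z[i := v]) = (swapl a b z)[swp a b i := v]"
  using assms by (intro nth_equalityI) (auto simp: nth_swapl nth_list_update swp_def split: if_splits)

definition kets :: "nat \<Rightarrow> ket set" where
  "kets N = {\<psi>. \<forall>z. length z \<noteq> N \<longrightarrow> \<psi> z = 0}"

lemma kets_gate [intro]: "\<psi> \<in> kets N \<Longrightarrow> gate_apply g \<psi> \<in> kets N"
  by (cases g) (auto simp: kets_def)

lemma kets_gates [intro]: "\<psi> \<in> kets N \<Longrightarrow> fold gate_apply gs \<psi> \<in> kets N"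
  by (induction gs arbitrary: \<psi>) auto

lemma kets_swapket [intro]: "\<psi> \<in> kets N \<Longrightarrow> swapket a b \<psi> \<in> kets N"
  by (auto simp: kets_def swapket_def)

lemma kets_ketf [intro, simp]: "ketf W m f \<Phi> \<in> kets (W + m)"
  by (auto simp: kets_def ketf_def)

lemma kets_eqI:
  assumes "\<psi> \<in> kets N" "\<phi> \<in> kets N" "\<And>z. length z = N \<Longrightarrow> \<psi> z = \<phi> z"
  shows "\<psi> = \<phi>"
proof
  fix z show "\<psi> z = \<phi> z"
    using assms by (cases "length z = N") (auto simp: kets_def)
qed

text \<open>The reason why fetching works: a gate on a fixed work wire, placed between two swaps, is
  the same gate on the fetched qubit.\<close>

lemma swapket_conj:
  assumes "\<psi> \<in> kets N" "a < N" "b < N" "wf_gate N g"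
  shows "swapket a b (gate_apply g (swapket a b \<psi>)) = gate_apply (ren (swp a b) g) \<psi>"
proof (rule kets_eqI)
  fix z :: "bool list" assume "length z = N"
  then show "swapket a b (gate_apply g (swapket a b \<psi>)) z = gate_apply (ren (swp a b) g) \<psi> z"
    using assms by (cases g) (simp_all add: swapket_def swapl_update swapl_swapl nth_swapl)
qed (use assms in auto)

text \<open>While a data qubit sits in a work wire, the state is no longer a product with a basis
  state. The wires in \<open>S\<close>, among them all controls, are still classical, and controlled
  swaps need no more than that.\<close>

definition supp :: "nat \<Rightarrow> nat set \<Rightarrow> (nat \<Rightarrow> bool) \<Rightarrow> ket set" where
  "supp N S f = {\<psi>. \<forall>z. \<psi> z \<noteq> 0 \<longrightarrow> length z = N \<and> (\<forall>i\<in>S. z ! i = f i)}"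

lemma supp_kets: "\<psi> \<in> supp N S f \<Longrightarrow> \<psi> \<in> kets N"
  by (auto simp: supp_def kets_def)

lemma supp_ketf: "S \<subseteq> {..<W} \<Longrightarrow> ketf W m f \<Phi> \<in> supp (W + m) S f"
  by (auto simp: supp_def ketf_def split: if_splits)

lemma supp_swapket: 
  assumes "\<psi> \<in> supp N S f" "a \<notin> S" "b \<notin> S" 
  shows "swapket a b \<psi> \<in> supp N S f"
proof -
  have "swapl a b z ! i = z ! i" if "i \<in> S" for z :: "bool list" and i
    using that assms by (metis nth_list_update_neq swapl_def)
  then show ?thesis using assms by (auto simp: supp_def swapket_def)
qed

lemma cswap_ket:
  assumes "\<psi> \<in> supp N S f" "c \<in> S" "a \<notin> S" "b \<notin> S" "a \<noteq> b" "a < N" "b < N" "c < N"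
  shows "fold gate_apply (cswap c a b) \<psi> = (if f c then swapket a b \<psi> else \<psi>)"
proof (rule kets_eqI)
  fix z :: "bool list" assume z: "length z = N"
  have ne: "c \<noteq> a" "c \<noteq> b" using assms by auto
  let ?z = "if z ! c then swapl a b z else z"
  have "fold gate_apply (cswap c a b) \<psi> z = \<psi> ?z"
    using ne assms z
    by (auto simp: cswap_def intro!: arg_cong[of _ _ \<psi>] nth_equalityI) (auto simp: nth_list_update swapl_def)
  also have "\<psi> ?z = (if f c then swapket a b \<psi> else \<psi>) z"
  proof (cases "z ! c = f c")
    case True then show ?thesis by (simp add: swapket_def)
  next
    case False
    moreover have "swapl a b z ! c = z ! c" using ne by (simp add: swapl_def)
    ultimately have "\<psi> z = 0" "\<psi> (swapl a b z) = 0" using assms(1,2) by (auto simp: supp_def)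
    then show ?thesis by (simp add: swapket_def)
  qed
  finally show "fold gate_apply (cswap c a b) \<psi> z = (if f c then swapket a b \<psi> else \<psi>) z" .
next
  have "\<psi> \<in> kets N" using assms(1) by (rule supp_kets)
  then show "fold gate_apply (cswap c a b) \<psi> \<in> kets N" "(if f c then swapket a b \<psi> else \<psi>) \<in> kets N" by auto
qed

text \<open>The address wires \<open>A q\<close> are meant to be one-hot or all zero, so that of the
  \<open>m\<close> controlled swaps at most one acts.\<close>

definition fetch :: "(nat \<Rightarrow> nat) \<Rightarrow> nat \<Rightarrow> nat \<Rightarrow> nat \<Rightarrow> gate list" where
  "fetch A W m w = concat (map (\<lambda>q. cswap (A q) (W + q) w) [0..<m])"

lemma fetch_ket:
  assumes "\<psi> \<in> supp N S f" "\<And>q. q < m \<Longrightarrow> A q \<in> S" "\<And>q. W + q \<notin> S" "w \<notin> S" "w < W" "W + m \<le> N" "S \<subseteq> {..<N}"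
  shows "\<forall>q<m. \<not> f (A q) \<Longrightarrow> fold gate_apply (fetch A W m w) \<psi> = \<psi>"
    "q0 < m \<Longrightarrow> \<forall>q<m. f (A q) = (q = q0) \<Longrightarrow> fold gate_apply (fetch A W m w) \<psi> = swapket (W + q0) w \<psi>"
proof -
  have aux: "fold gate_apply (concat (map (\<lambda>q. cswap (A q) (W + q) w) qs)) \<phi> = \<phi>"
    if "set qs \<subseteq> {..<m}" "\<forall>q\<in>set qs. \<not> f (A q)" "\<phi> \<in> supp N S f" for qs \<phi>
    using that
  proof (induction qs)
    case (Cons q qs)
    have "fold gate_apply (cswap (A q) (W + q) w) \<phi> = \<phi>"
      using Cons.prems assms cswap_ket[of \<phi> N S f "A q" "W + q" w] by auto
    then show ?case using Cons by simp
  qed auto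
  show "\<forall>q<m. \<not> f (A q) \<Longrightarrow> fold gate_apply (fetch A W m w) \<psi> = \<psi>"
    unfolding fetch_def using assms by (intro aux) auto
  assume q0: "q0 < m" and f: "\<forall>q<m. f (A q) = (q = q0)"
  have "[0..<m] = [0..<q0] @ [q0] @ [Suc q0..<m]" 
    using q0 upt_add_eq_append[of 0 q0 "m - q0"] upt_conv_Cons[of q0 m] by simp
  then have "fold gate_apply (fetch A W m w) \<psi> = 
      fold gate_apply (concat (map (\<lambda>q. cswap (A q) (W + q) w) [Suc q0..<m]))
       (fold gate_apply (cswap (A q0) (W + q0) w)
        (fold gate_apply (concat (map (\<lambda>q. cswap (A q) (W + q) w) [0..<q0])) \<psi>))"
    by (simp add: fetch_def)
  also have "fold gate_apply (concat (map (\<lambda>q. cswap (A q) (W + q) w) [0..<q0])) \<psi> = \<psi>"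
    using q0 f assms by (intro aux) auto
  also have "fold gate_apply (cswap (A q0) (W + q0) w) \<psi> = swapket (W + q0) w \<psi>"
    using q0 f assms cswap_ket[of \<psi> N S f "A q0" "W + q0" w] by auto
  also have "fold gate_apply (concat (map (\<lambda>q. cswap (A q) (W + q) w) [Suc q0..<m])) (swapket (W + q0) w \<psi>) = swapket (W + q0) w \<psi>"
    using q0 f assms by (intro aux supp_swapket) auto
  finally show "fold gate_apply (fetch A W m w) \<psi> = swapket (W + q0) w \<psi>" .
qed

declare gate_apply.simps [simp del]

primrec tgt :: "gate \<Rightarrow> nat" where
  "tgt (Had q) = q"
| "tgt (TGate q) = q"
| "tgt (CNOT a q) = q"
| "tgt (Toffoli a b q) = q"

lemma gate_apply_nonzero:
  assumes "gate_apply g \<psi> z \<noteq> 0"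
  shows "\<exists>b. \<psi> (z[tgt g := b]) \<noteq> 0"
proof (rule ccontr)
  assume "\<not> ?thesis"
  then have *: "\<psi> (z[tgt g := b]) = 0" for b by blast
  from *[of "z ! tgt g"] have "\<psi> z = 0" by simp
  with * assms show False by (cases g) (auto simp: gate_apply.simps)
qed

lemma supp_gate:
  assumes "\<psi> \<in> supp N S f" "tgt g \<notin> S"
  shows "gate_apply g \<psi> \<in> supp N S f"
proof -
  have "length z = N \<and> (\<forall>i\<in>S. z ! i = f i)" if z: "gate_apply g \<psi> z \<noteq> 0" for z
  proof -
    obtain b where "\<psi> (z[tgt g := b]) \<noteq> 0" using gate_apply_nonzero[OF z] by blast
    then have *: "length (z[tgt g := b]) = N" "\<forall>i\<in>S. z[tgt g := b] ! i = f i" using assms(1) by (auto simp: supp_def)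
    have "z[tgt g := b] ! i = z ! i" if "i \<in> S" for i using that assms(2) by (metis nth_list_update_neq)
    with * show ?thesis by simp
  qed
  then show ?thesis by (simp add: supp_def)
qed

section \<open>The controlled Hadamard gate\<close>

definition branch :: "nat \<Rightarrow> bool list \<Rightarrow> ket \<Rightarrow> complex \<times> complex" where
  "branch w z \<psi> = (\<psi> (z[w := False]), \<psi> (z[w := True]))"

abbreviation \<omega> :: complex where "\<omega> \<equiv> cis (pi / 4)"

text \<open>Circuits on one qubit become products of 2 by 2 matrices on the two amplitudes that
  differ only at \<open>w\<close>; the control is a constant of the pair.\<close>

lemma branch_gate:
  assumes "w < length z"
  shows "branch w z (gate_apply (TGate w) \<psi>) = (fst (branch w z \<psi>), \<omega> * snd (branch w z \<psi>))"
    "branch w z (gate_apply (Had w) \<psi>) =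
       ((fst (branch w z \<psi>) + snd (branch w z \<psi>)) / complex_of_real (sqrt 2),
        (fst (branch w z \<psi>) - snd (branch w z \<psi>)) / complex_of_real (sqrt 2))"
    "c \<noteq> w \<Longrightarrow> branch w z (gate_apply (CNOT c w) \<psi>) =
       (if z ! c then (snd (branch w z \<psi>), fst (branch w z \<psi>)) else branch w z \<psi>)"
  using assms by (auto simp: branch_def gate_apply.simps)

lemma branch_eqI:
  assumes "w < length z" "branch w z \<psi> = branch w z \<phi>"
  shows "\<psi> z = \<phi> z"
  using assms by (cases "z ! w") (auto simp: branch_def, (metis (full_types) list_update_id)+)

lemma u_powers: "\<omega> ^ 2 = \<i>" "\<omega> = (1 + \<i>) / complex_of_real (sqrt 2)"
proof -
  show "\<omega> ^ 2 = \<i>" by (simp add: Complex.DeMoivre)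
  show "\<omega> = (1 + \<i>) / complex_of_real (sqrt 2)"
    by (simp add: complex_eq_iff cos_45 sin_45 field_simps)
qed

text \<open>\<open>H = A X A\<^sup>\<dagger>\<close> for \<open>A = S H T\<close>, hence controlling the \<open>X\<close> controls the Hadamard gate.\<close>

definition chad :: "nat \<Rightarrow> nat \<Rightarrow> gate list" where
  "chad c w = replicate 6 (TGate w) @ [Had w] @ replicate 7 (TGate w) @ [CNOT c w, TGate w, Had w, TGate w, TGate w]"

lemma branch_T: "w < length z \<Longrightarrow> branch w z ((gate_apply (TGate w) ^^ k) \<psi>) = (fst (branch w z \<psi>), \<omega> ^ k * snd (branch w z \<psi>))"
  by (induction k) (simp_all add: branch_gate mult_ac)

text \<open>The inverses of \<open>S\<close> and \<open>T\<close> are \<open>T^6\<close> and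
  \<open>T^7\<close>. If the control is unset, the two halves cancel exactly; if it is set, the
  conjugate of \<open>X\<close> is the Hadamard gate without a stray phase.\<close>

lemma chad_ket:
  assumes "\<psi> \<in> supp N S f" "c \<in> S" "w \<notin> S" "w < N"
  shows "fold gate_apply (chad c w) \<psi> = (if f c then gate_apply (Had w) \<psi> else \<psi>)"
proof (rule kets_eqI)
  have k: "\<psi> \<in> kets N" using assms(1) by (rule supp_kets)
  show "fold gate_apply (chad c w) \<psi> \<in> kets N" "(if f c then gate_apply (Had w) \<psi> else \<psi>) \<in> kets N"
    using k by auto
  fix z :: "bool list" assume z: "length z = N"
  have cw: "c \<noteq> w" using assms by auto
  obtain a b where ab: "branch w z \<psi> = (a, b)" by force
  define r where "r = complex_of_real (sqrt 2)"
  have r: "r * r = 2" "r \<noteq> 0" by (simp_all add: r_def flip: of_real_mult)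
  have u2: "\<omega> * (\<omega> * x) = \<i> * x" for x using u_powers(1) by (simp add: power2_eq_square mult.assoc[symmetric])
  have "\<omega> * \<omega> = \<i>" using u_powers(1) by (simp add: power2_eq_square)
  then have u6: "\<omega> ^ 6 = - \<i>" "\<omega> ^ 7 = - \<i> * \<omega>" by (simp_all add: u2 eval_nat_numeral)
  have u2': "\<omega> * (\<i> * \<omega> * x) = - x" for x
    using u2[of "\<i> * x"] by (simp add: mult_ac)
  have ur: "\<omega> = (1 + \<i>) / r" using u_powers(2) by (simp add: r_def)
  show "fold gate_apply (chad c w) \<psi> z = (if f c then gate_apply (Had w) \<psi> else \<psi>) z"
  proof (cases "z ! c = f c")
    case False
    have "\<psi> (z[w := b]) = 0" for b
    proof -
      have "z[w := b] ! c \<noteq> f c" using False cw by simp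
      then show ?thesis using assms(1,2) by (auto simp: supp_def)
    qed
    then have "branch w z \<psi> = (0, 0)" by (simp add: branch_def)
    then show ?thesis using z assms
      by (intro branch_eqI[of w]) (simp_all add: chad_def branch_gate branch_T cw)
  next
    case True
    show ?thesis
    proof (rule branch_eqI[of w])
      show "branch w z (fold gate_apply (chad c w) \<psi>) = branch w z (if f c then gate_apply (Had w) \<psi> else \<psi>)"
      proof (cases "f c")
        case f: True
        have "branch w z (fold gate_apply (chad c w) \<psi>) =
          ((- \<i> * \<omega> * ((a - \<omega> ^ 6 * b) / r) + \<omega> * ((a + \<omega> ^ 6 * b) / r)) / r, \<i> * ((- \<i> * \<omega> * ((a - \<omega> ^ 6 * b) / r) - \<omega> * ((a + \<omega> ^ 6 * b) / r)) / r))"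
          using z assms True f by (simp add: chad_def branch_gate branch_T cw ab u2 u6 r_def[symmetric])
        also have "\<dots> = ((\<omega> * (1 - \<i>)) * (a + b) / (r * r), (\<omega> * (1 - \<i>)) * (a - b) / (r * r))"
          by (simp add: u6 field_simps r(2))
        also have "\<omega> * (1 - \<i>) = r" using r by (simp add: ur field_simps)
        finally show ?thesis using z assms True f r(2) by (simp add: branch_gate ab r_def[symmetric])
      next
        case f: False
        have "branch w z (fold gate_apply (chad c w) \<psi>) =
          (((a + \<omega> ^ 6 * b) / r + (a - \<omega> ^ 6 * b) / r) / r, \<i> * (((a + \<omega> ^ 6 * b) / r - (a - \<omega> ^ 6 * b) / r) / r))"
          using z assms True f by (simp add: chad_def branch_gate branch_T cw ab u2 u2' u6 r_def[symmetric]) (simp add: divide_inverse algebra_simps)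
        also have "\<dots> = (2 * a / (r * r), 2 * b / (r * r))" using r(2) by (simp add: u6 field_simps)
        finally show ?thesis using r(1) f ab by simp
      qed
    qed (use z assms in auto)
  qed
qed


text \<open>The operands of a gate, by gate type in different registers.\<close>

fun operand :: "gate option \<Rightarrow> nat \<Rightarrow> nat option" where
  "operand None = (\<lambda>r. None)"
| "operand (Some (Had q)) = [1 \<mapsto> q]"
| "operand (Some (TGate q)) = [2 \<mapsto> q]"
| "operand (Some (CNOT a q)) = [3 \<mapsto> a, 4 \<mapsto> q]"
| "operand (Some (Toffoli a b q)) = [5 \<mapsto> a, 6 \<mapsto> b, 7 \<mapsto> q]"

text \<open>Every kind of gate is tried, without a test. Kinds that were not decoded fetch nothing,
  and T, CNOT and Toffoli fix the zero work wires. Only the Hadamard gate does not, hence its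
  control \<open>c\<close>, which says that a Hadamard gate was decoded.\<close>

definition gate_step :: "(nat \<Rightarrow> nat \<Rightarrow> nat) \<Rightarrow> nat \<Rightarrow> nat \<Rightarrow> nat \<Rightarrow> gate list" where
  "gate_step A c W m =
     fetch (A 1) W m 1 @ chad c 1 @ fetch (A 1) W m 1 @
     fetch (A 2) W m 1 @ [TGate 1] @ fetch (A 2) W m 1 @
     fetch (A 3) W m 1 @ fetch (A 4) W m 2 @ [CNOT 1 2] @ fetch (A 4) W m 2 @ fetch (A 3) W m 1 @
     fetch (A 5) W m 1 @ fetch (A 6) W m 2 @ fetch (A 7) W m 3 @ [Toffoli 1 2 3] @
     fetch (A 7) W m 3 @ fetch (A 6) W m 2 @ fetch (A 5) W m 1"

text \<open>The case \<open>None\<close> covers the rounds in which the description is used up: all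
  addresses are empty and the step is the identity.\<close>

lemma gate_step:
  assumes A: "\<And>r q. r \<in> {1..7} \<Longrightarrow> q < m \<Longrightarrow> 3 < A r q \<and> A r q < W \<and> f (A r q) = (operand go r = Some q)"
    and c: "3 < c" "c < W" "f c = (operand go 1 \<noteq> None)"
    and f: "\<not> f 1" "\<not> f 2" "\<not> f 3" and go: "\<And>g. go = Some g \<Longrightarrow> wf_gate m g"
  shows "fold gate_apply (gate_step A c W m) (ketf W m f \<Phi>) =
    ketf W m f (case go of None \<Rightarrow> \<Phi> | Some g \<Rightarrow> gate_apply g \<Phi>)"
proof -
  define S where "S = {..<W} - {1, 2, 3}"
  define \<psi> where "\<psi> = ketf W m f \<Phi>"
  have sup: "\<psi> \<in> supp (W + m) S f" unfolding \<psi>_def by (rule supp_ketf) (auto simp: S_def)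
  have k: "\<psi> \<in> kets (W + m)" using sup by (rule supp_kets)
  have F: "operand go r = None \<Longrightarrow> fold gate_apply (fetch (A r) W m w) \<phi> = \<phi>"
    "operand go r = Some q \<Longrightarrow> q < m \<Longrightarrow> fold gate_apply (fetch (A r) W m w) \<phi> = swapket (W + q) w \<phi>"
    if "\<phi> \<in> supp (W + m) S f" "r \<in> {1..7}" "w \<in> {1, 2, 3}" for \<phi> r w q
  proof -
    have *: "\<And>q. q < m \<Longrightarrow> A r q \<in> S" "\<And>q. W + q \<notin> S" "w \<notin> S" "w < W" "W + m \<le> W + m" "S \<subseteq> {..<W + m}"
      subgoal for q using A[OF that(2), of q] by (auto simp: S_def)
      using that(3) c by (auto simp: S_def)
    show "operand go r = None \<Longrightarrow> fold gate_apply (fetch (A r) W m w) \<phi> = \<phi>"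
      using A[OF that(2)] by (intro fetch_ket(1)[OF that(1) *]) auto
    show "operand go r = Some q \<Longrightarrow> q < m \<Longrightarrow> fold gate_apply (fetch (A r) W m w) \<phi> = swapket (W + q) w \<phi>"
      using A[OF that(2)] by (intro fetch_ket(2)[OF that(1) *]) auto
  qed
  have sw: "swapket (W + q) w \<phi> \<in> supp (W + m) S f" if "\<phi> \<in> supp (W + m) S f" "w \<in> {1, 2, 3}" for \<phi> w q
    using that by (intro supp_swapket) (auto simp: S_def)
  have sg: "gate_apply g \<phi> \<in> supp (W + m) S f" if "\<phi> \<in> supp (W + m) S f" "tgt g \<in> {1, 2, 3}" for \<phi> g
    using that by (intro supp_gate) (auto simp: S_def)
  have CH: "fold gate_apply (chad c 1) \<phi> = (if operand go 1 \<noteq> None then gate_apply (Had 1) \<phi> else \<phi>)"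
    if "\<phi> \<in> supp (W + m) S f" for \<phi>
    using chad_ket[OF that, of c 1] c by (auto simp: S_def)
  have triv: "gate_apply (TGate 1) (ketf W m f \<Phi>') = ketf W m f \<Phi>'" "gate_apply (CNOT 1 2) (ketf W m f \<Phi>') = ketf W m f \<Phi>'"
    "gate_apply (Toffoli 1 2 3) (ketf W m f \<Phi>') = ketf W m f \<Phi>'" for \<Phi>'
  proof -
    show "gate_apply (TGate 1) (ketf W m f \<Phi>') = ketf W m f \<Phi>'"
      using f c by (auto simp: gate_apply.simps ketf_def fun_eq_iff)
    show "gate_apply (CNOT 1 2) (ketf W m f \<Phi>') = ketf W m f \<Phi>'" "gate_apply (Toffoli 1 2 3) (ketf W m f \<Phi>') = ketf W m f \<Phi>'"
      using f c by (simp_all add: cg_ketf fun_upd_idem)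
  qed
  have sk: "ketf W m f \<Phi>' \<in> supp (W + m) S f" for \<Phi>' by (rule supp_ketf) (auto simp: S_def)
  have kk: "ketf W m f \<Phi>' \<in> kets (W + m)" for \<Phi>' by simp
  have conj: "swapket (W + q) w (gate_apply g (swapket (W + q) w \<phi>)) = gate_apply (ren (swp (W + q) w) g) \<phi>"
    if "\<phi> \<in> supp (W + m) S f" "q < m" "w \<in> {1, 2, 3}" "wf_gate (W + m) g" for \<phi> q w g
    using that c by (intro swapket_conj) (auto intro: supp_kets)
  have lift: "gate_apply (ren ((+) W) g) (ketf W m f \<Phi>) = ketf W m f (gate_apply g \<Phi>)" if "go = Some g" for g
    using ren_ketf go[OF that] by blast
  \<comment> \<open>As the addresses are classical, each fetch is a definite swap or nothing. The
    step becomes a word in the \<open>X r w\<close> and four gates, of which at most one acts on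
    data.\<close>
  define X where "X r w \<phi> = (case operand go r of None \<Rightarrow> \<phi> | Some q \<Rightarrow> swapket (W + q) w \<phi>)" for r w \<phi>
  define Sup where "Sup = supp (W + m) S f"
  have lt: "q < m" if "operand go r = Some q" for r q
  proof (cases go)
    case (Some g) then show ?thesis using go[OF Some] that by (cases g) (auto split: if_splits)
  qed (use that in simp)
  have X: "fold gate_apply (fetch (A r) W m w) \<phi> = X r w \<phi> \<and> X r w \<phi> \<in> Sup"
    if "\<phi> \<in> Sup" "r \<in> {1..7}" "w \<in> {1, 2, 3}" for \<phi> r w
    using F[OF that(1)[unfolded Sup_def] that(2,3)] sw that lt
    by (cases "operand go r") (auto simp: X_def Sup_def)
  have X1: "fold gate_apply (fetch (A r) W m w) \<phi> = X r w \<phi>" "X r w \<phi> \<in> Sup"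
    if "\<phi> \<in> Sup" "(r, w) \<in> {(1, 1), (2, 1), (3, 1), (4, 2), (5, 1), (6, 2), (7, 3)}" for \<phi> r w
    using X[OF that(1), of r w] that(2) by auto
  define H where "H \<phi> = (if operand go 1 \<noteq> None then gate_apply (Had 1) \<phi> else \<phi>)" for \<phi>
  have H: "fold gate_apply (chad c 1) \<phi> = H \<phi>" "H \<phi> \<in> Sup" if "\<phi> \<in> Sup" for \<phi>
    using CH[OF that[unfolded Sup_def]] sg[OF that[unfolded Sup_def]] that by (auto simp: H_def Sup_def)
  have G: "gate_apply (TGate 1) \<phi> \<in> Sup" "gate_apply (CNOT 1 2) \<phi> \<in> Sup" "gate_apply (Toffoli 1 2 3) \<phi> \<in> Sup"
    if "\<phi> \<in> Sup" for \<phi>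
    using sg[OF that[unfolded Sup_def]] by (auto simp: Sup_def)
  have id1: "fold gate_apply [g] \<phi> = gate_apply g \<phi>" for g \<phi> by simp
  have sS: "\<psi> \<in> Sup" using sup by (simp add: Sup_def)
  have "fold gate_apply (gate_step A c W m) \<psi> =
    X 5 1 (X 6 2 (X 7 3 (gate_apply (Toffoli 1 2 3) (X 7 3 (X 6 2 (X 5 1
     (X 3 1 (X 4 2 (gate_apply (CNOT 1 2) (X 4 2 (X 3 1
      (X 2 1 (gate_apply (TGate 1) (X 2 1 (X 1 1 (H (X 1 1 \<psi>)))))))))))))))))"
    unfolding gate_step_def fold_append o_apply
    by (simp add: X1 G H id1 sS del: One_nat_def fold.simps)
  also have "\<dots> = ketf W m f (case go of None \<Rightarrow> \<Phi> | Some g \<Rightarrow> gate_apply g \<Phi>)"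
  proof (cases go)
    case None
    then show ?thesis using triv by (simp add: X_def H_def \<psi>_def)
  next
    case (Some g)
    note wf = go[OF Some]
    show ?thesis
    proof (cases g)
      case (Had q)
      have "swp (W + q) 1 1 = W + q" using c by (simp add: swp_def)
      then have "swapket (W + q) 1 (gate_apply (Had 1) (swapket (W + q) 1 (ketf W m f \<Phi>))) = ketf W m f (gate_apply g \<Phi>)"
        using conj[OF sk, of q 1 "Had 1"] c wf Had lift[OF Some] by simp
      then show ?thesis using Some Had triv by (simp add: X_def H_def \<psi>_def)
    next
      case (TGate q)
      have "swp (W + q) 1 1 = W + q" using c by (simp add: swp_def)
      then have "swapket (W + q) 1 (gate_apply (TGate 1) (swapket (W + q) 1 (ketf W m f \<Phi>))) = ketf W m f (gate_apply g \<Phi>)"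
        using conj[OF sk, of q 1 "TGate 1"] c wf TGate lift[OF Some] by simp
      then show ?thesis using Some TGate triv by (simp add: X_def H_def \<psi>_def)
    next
      case (CNOT a q)
      \<comment> \<open>The conjugations are resolved from the inside: the inner swap moves the
        target to its data qubit, the outer one the control.\<close>
      have "swp (W + a) 1 1 = W + a" "swp (W + a) 1 (W + q) = W + q" "swp (W + q) 2 1 = 1" "swp (W + q) 2 2 = W + q"
        using c CNOT wf by (auto simp: swp_def)
      then have "swapket (W + a) 1 (swapket (W + q) 2 (gate_apply (CNOT 1 2) (swapket (W + q) 2 (swapket (W + a) 1 (ketf W m f \<Phi>)))))
          = ketf W m f (gate_apply g \<Phi>)"
        using conj[where \<phi> = "swapket (W + a) 1 (ketf W m f \<Phi>)" and q = q and w = 2 and g = "CNOT 1 2"] sw[OF sk, of 1 a] conj[OF sk, of a 1 "CNOT 1 (W + q)"] c wf CNOT lift[OF Some] by simp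
      then show ?thesis using Some CNOT triv by (simp add: X_def H_def \<psi>_def)
    next
      case (Toffoli a b q)
      have "swp (W + a) 1 1 = W + a" "swp (W + a) 1 (W + q) = W + q" "swp (W + a) 1 (W + b) = W + b" 
        "swp (W + b) 2 1 = 1" "swp (W + b) 2 2 = W + b" "swp (W + b) 2 (W + q) = W + q" 
        "swp (W + q) 3 1 = 1" "swp (W + q) 3 2 = 2" "swp (W + q) 3 3 = W + q"
        using c Toffoli wf by (auto simp: swp_def)
      then have "swapket (W + a) 1 (swapket (W + b) 2 (swapket (W + q) 3 (gate_apply (Toffoli 1 2 3) 
          (swapket (W + q) 3 (swapket (W + b) 2 (swapket (W + a) 1 (ketf W m f \<Phi>)))))))
          = ketf W m f (gate_apply g \<Phi>)"
        using conj[where \<phi> = "swapket (W + b) 2 (swapket (W + a) 1 (ketf W m f \<Phi>))" and q = q and w = 3 and g = "Toffoli 1 2 3"]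
          conj[where \<phi> = "swapket (W + a) 1 (ketf W m f \<Phi>)" and q = b and w = 2 and g = "Toffoli 1 2 (W + q)"]
          sw[OF sk, of 1 a] sw[OF sw[OF sk], of 1 2 b a]
          conj[OF sk, of a 1 "Toffoli 1 (W + b) (W + q)"] c wf Toffoli lift[OF Some] by simp
      then show ?thesis using Some Toffoli triv by (simp add: X_def H_def \<psi>_def)
    qed
  qed
  finally show ?thesis by (simp add: \<psi>_def)
qed

subsection \<open>Decoding circuit descriptions\<close>

definition runs :: "program \<Rightarrow> store \<Rightarrow> store \<Rightarrow> nat \<Rightarrow> bool" where
  "runs P s s' b \<longleftrightarrow> (\<exists>k\<le>b. exec P s k s')"

lemma runs_basic:
  "runs Skip s s 1" "runs (Push r b) s (s(r := b # s r)) 1" "runs (Pop r) s (s(r := tl (s r))) 1"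
  by (auto simp: runs_def intro!: exI[of _ 1] exec.intros exec.Push[simplified] exec.Pop[simplified])

lemma runs_Seq: "runs P s s1 a \<Longrightarrow> runs Q s1 s2 b \<Longrightarrow> runs (Seq P Q) s s2 (a + b)"
  unfolding runs_def by (meson add_mono exec.Seq)

lemma runs_weaken: "runs P s s' a \<Longrightarrow> a \<le> b \<Longrightarrow> s' = s'' \<Longrightarrow> runs P s s'' b"
  unfolding runs_def by (meson le_trans)

lemma runs_Cond: 
  "holds t s \<Longrightarrow> runs P s s' a \<Longrightarrow> runs (Cond t P Q) s s' (a + 1)"
  "\<not> holds t s \<Longrightarrow> runs Q s s' a \<Longrightarrow> runs (Cond t P Q) s s' (a + 1)"
  unfolding runs_def by (meson add_le_mono1 exec.Cond_True exec.Cond_False)+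

lemma runs_Loop: 
  "holds t s \<Longrightarrow> runs P s s1 a \<Longrightarrow> runs (Loop t P) s1 s2 b \<Longrightarrow> runs (Loop t P) s s2 (a + b + 1)"
  "\<not> holds t s \<Longrightarrow> runs (Loop t P) s s 1"
  unfolding runs_def by (meson add_le_mono add_le_mono1 exec.Loop_True, meson exec.Loop_False order_refl)

definition clear_reg :: "nat \<Rightarrow> program" where "clear_reg r = Loop (Nonempty r) (Pop r)"

lemma runs_clear_reg: "runs (clear_reg r) s (s(r := [])) (2 * length (s r) + 1)"
  unfolding clear_reg_def
proof (induction "s r" arbitrary: s)
  case Nil
  then show ?case using runs_Loop(2)[of "Nonempty r" s "Pop r"] by (simp add: fun_upd_idem)
next
  case (Cons a x)
  from Cons(2)[symmetric] have "runs (Loop (Nonempty r) (Pop r)) (s(r := x)) (s(r := [])) (2 * length x + 1)"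
    using Cons(1)[of "s(r := x)"] by simp
  moreover have "runs (Pop r) s (s(r := x)) 1" using runs_basic(3)[of r s] by (simp flip: Cons(2))
  moreover have "holds (Nonempty r) s" by (simp flip: Cons(2))
  ultimately have "runs (Loop (Nonempty r) (Pop r)) s (s(r := [])) (1 + (2 * length x + 1) + 1)"
    by (blast intro: runs_Loop(1))
  then show ?case by (simp flip: Cons(2))
qed

text \<open>The \<open>True\<close> is pushed first and so ends up below the \<open>q\<close> zeros.
  If register \<open>r\<close> was empty, its content lane is then set at cell \<open>q\<close> and
  nowhere else: a one-hot address.\<close>

definition read_nat :: "nat \<Rightarrow> program" where
  "read_nat r = Seq (Push r True) (Seq (Loop (Head_True 0) (Seq (Pop 0) (Push r False))) (Pop 0))"

lemma runs_transfer:
  assumes "r \<noteq> 0" "s 0 = replicate q True @ False # rest"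
  shows "runs (Loop (Head_True 0) (Seq (Pop 0) (Push r b))) s (s(0 := False # rest, r := replicate q b @ s r)) (3 * q + 1)"
  using assms(2)
proof (induction q arbitrary: s)
  case 0
  then show ?case by (intro runs_weaken[OF runs_Loop(2)]) (auto simp: fun_eq_iff)
next
  case (Suc q)
  let ?s = "s(0 := replicate q True @ False # rest, r := b # s r)"
  have 1: "runs (Seq (Pop 0) (Push r b)) s ?s 2"
    using runs_Seq[OF runs_basic(3)[of 0 s] runs_basic(2)[of r b]] Suc.prems assms(1) by (simp add: numeral_2_eq_2)
  have 2: "runs (Loop (Head_True 0) (Seq (Pop 0) (Push r b))) ?s (?s(0 := False # rest, r := replicate q b @ ?s r)) (3 * q + 1)"
    using assms(1) by (intro Suc.IH) simp
  have "holds (Head_True 0) s" using Suc.prems by simp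
  from runs_Loop(1)[OF this 1 2] show ?case
    using assms(1) by (elim runs_weaken) (auto simp: fun_eq_iff replicate_append_same[symmetric])
qed

lemma runs_read_nat:
  assumes "r \<noteq> 0" "s 0 = enc_nat q @ rest"
  shows "runs (read_nat r) s (s(0 := rest, r := replicate q False @ True # s r)) (3 * q + 3)"
proof -
  have 1: "(s(r := True # s r)) 0 = replicate q True @ False # rest" using assms by (simp add: enc_nat_def)
  show ?thesis unfolding read_nat_def
    by (rule runs_weaken[OF runs_Seq[OF runs_basic(2) runs_Seq[OF runs_transfer[where s = "s(r := True # s r)", OF assms(1) 1] runs_basic(3)]]])
      (use assms(1) in auto)
qed

definition read_header :: program where "read_header = Seq (Loop (Head_True 0) (Seq (Pop 0) (Push 1 True))) (Pop 0)"

lemma runs_read_header: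
  assumes "s 0 = enc_nat q @ rest"
  shows "runs read_header s (s(0 := rest, 1 := replicate q True @ s 1)) (3 * q + 2)"
proof -
  have 1: "s 0 = replicate q True @ False # rest" using assms by (simp add: enc_nat_def)
  show ?thesis unfolding read_header_def
    by (rule runs_weaken[OF runs_Seq[OF runs_transfer[where s = s, OF _ 1] runs_basic(3)]]) auto
qed

definition branch_operands :: program where
  "branch_operands = Cond (Nonempty 0)
    (Cond (Head_True 0)
      (Seq (Pop 0) (Cond (Head_True 0) (Seq (Pop 0) (Seq (read_nat 5) (Seq (read_nat 6) (read_nat 7)))) (Seq (Pop 0) (Seq (read_nat 3) (read_nat 4)))))
      (Seq (Pop 0) (Cond (Head_True 0) (Seq (Pop 0) (read_nat 2)) (Seq (Pop 0) (read_nat 1)))))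
    Skip"

text \<open>The operand registers are emptied first, so that no address of an earlier gate survives.
  If the input is used up they stay empty, which encodes \<open>None\<close>.\<close>

definition decode_gate :: program where
  "decode_gate = Seq (clear_reg 1) (Seq (clear_reg 2) (Seq (clear_reg 3) (Seq (clear_reg 4) (Seq (clear_reg 5) (Seq (clear_reg 6) (Seq (clear_reg 7)
    branch_operands))))))"

definition dstate :: "store \<Rightarrow> gate option \<Rightarrow> bool list \<Rightarrow> store" where
  "dstate s go rest r = (if r = 0 then rest else if r \<le> 7 then
     (case operand go r of None \<Rightarrow> [] | Some q \<Rightarrow> replicate q False @ [True]) else s r)"

lemma dstate_eqI:
  assumes "s' 0 = rest" "\<And>r. r \<in> {1,2,3,4,5,6,7} \<Longrightarrow> s' r = (case operand go r of None \<Rightarrow> [] | Some q \<Rightarrow> replicate q False @ [True])"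
    "\<And>r. r > 7 \<Longrightarrow> s' r = s r"
  shows "s' = dstate s go rest"
proof
  fix r :: nat
  consider "r = 0" | "r \<in> {1,2,3,4,5,6,7}" | "r > 7" by force
  then show "s' r = dstate s go rest r" by cases (auto simp: dstate_def assms)
qed

lemma runs_clears:
  assumes "\<And>r. length (s r) \<le> M" 
    "runs P (\<lambda>r. if 1 \<le> r \<and> r \<le> 7 then [] else s r) s' b"
  shows "runs (Seq (clear_reg 1) (Seq (clear_reg 2) (Seq (clear_reg 3) (Seq (clear_reg 4) (Seq (clear_reg 5) (Seq (clear_reg 6) (Seq (clear_reg 7) P))))))) s s' (14 * M + 7 + b)"
proof -
  have c: "runs (clear_reg r) s (s(r := [])) (2 * M + 1)" if "\<And>r. length (s r) \<le> M" for s r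
    using that[of r] by (intro runs_weaken[OF runs_clear_reg]) auto
  have eq: "s(1 := [], 2 := [], 3 := [], 4 := [], 5 := [], 6 := [], 7 := []) = (\<lambda>r. if 1 \<le> r \<and> r \<le> 7 then [] else s r)"
    by (auto simp: fun_eq_iff)
  show ?thesis
    by (rule runs_weaken, (rule runs_Seq, rule c, (simp add: assms(1); fail))+, subst eq, rule assms(2)) auto
qed

lemma runs_decode_gate_None:
  assumes "\<And>r. length (s r) \<le> M" "s 0 = []"
  shows "runs decode_gate s (dstate s None []) (25 * M + 25)"
proof -
  let ?s = "\<lambda>r. if 1 \<le> r \<and> r \<le> 7 then [] else s r"
  have "?s = dstate s None []" using assms by (intro dstate_eqI) auto
  moreover have "\<not> holds (Nonempty 0) ?s" using assms by simp
  ultimately show ?thesis unfolding decode_gate_def branch_operands_def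
    by (intro runs_weaken[OF runs_clears[OF assms(1) runs_Cond(2)[OF _ runs_basic(1)]]]) auto
qed

text \<open>The bound is generous: clearing costs \<open>14 * M + 7\<close>, reading about three
  steps per bit of the code, and the tests and pops for the kind of gate add a constant.\<close>

lemma runs_decode_gate_Some:
  assumes "\<And>r. length (s r) \<le> M" "s 0 = enc_gate g @ rest"
  shows "runs decode_gate s (dstate s (Some g) rest) (25 * M + 25)"
proof -
  let ?s = "\<lambda>r. if 1 \<le> r \<and> r \<le> 7 then [] else s r"
  have M: "length (enc_gate g) \<le> M" using assms(1)[of 0] assms(2) by simp
  have len: "length (enc_nat q) = Suc q" for q by (simp add: enc_nat_def)
  show ?thesis
  proof (cases g)
    case (Had q)
    have s0: "?s 0 = [False, False] @ enc_nat q @ rest" using assms(2) Had by simp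
    have "runs (read_nat 1) (?s(0 := enc_nat q @ rest)) (dstate s (Some g) rest) (3 * q + 3)"
      by (rule runs_weaken[OF runs_read_nat[of 1 _ q rest]]) (auto simp: Had intro!: dstate_eqI)
    with s0 have "runs branch_operands ?s (dstate s (Some g) rest) (1 + (1 + (3 * q + 3) + 1) + 1 + 1)"
      unfolding branch_operands_def by (intro runs_Cond(1)[OF _ runs_Cond(2)[OF _ runs_Seq[OF runs_basic(3) runs_Cond(2)[OF _ runs_Seq[OF runs_basic(3)]]]]]) auto
    then show ?thesis unfolding decode_gate_def
      by (rule runs_weaken[OF runs_clears[OF assms(1)]]) (use M len Had in auto)
  next
    case (TGate q)
    have s0: "?s 0 = [False, True] @ enc_nat q @ rest" using assms(2) TGate by simp
    have "runs (read_nat 2) (?s(0 := enc_nat q @ rest)) (dstate s (Some g) rest) (3 * q + 3)"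
      by (rule runs_weaken[OF runs_read_nat[of 2 _ q rest]]) (auto simp: TGate intro!: dstate_eqI)
    with s0 have "runs branch_operands ?s (dstate s (Some g) rest) (1 + (1 + (3 * q + 3) + 1) + 1 + 1)"
      unfolding branch_operands_def by (intro runs_Cond(1)[OF _ runs_Cond(2)[OF _ runs_Seq[OF runs_basic(3) runs_Cond(1)[OF _ runs_Seq[OF runs_basic(3)]]]]]) auto
    then show ?thesis unfolding decode_gate_def
      by (rule runs_weaken[OF runs_clears[OF assms(1)]]) (use M len TGate in auto)
  next
    case (CNOT a q)
    have s0: "?s 0 = [True, False] @ enc_nat a @ enc_nat q @ rest" using assms(2) CNOT by simp
    have "runs (Seq (read_nat 3) (read_nat 4)) (?s(0 := enc_nat a @ enc_nat q @ rest)) (dstate s (Some g) rest) (3 * a + 3 + (3 * q + 3))"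
      by (rule runs_weaken[OF runs_Seq[OF runs_read_nat[of 3 _ a "enc_nat q @ rest"] runs_read_nat[of 4 _ q rest]]]) (auto simp: CNOT intro!: dstate_eqI)
    with s0 have "runs branch_operands ?s (dstate s (Some g) rest) (1 + (1 + (3 * a + 3 + (3 * q + 3)) + 1) + 1 + 1)"
      unfolding branch_operands_def by (intro runs_Cond(1)[OF _ runs_Cond(1)[OF _ runs_Seq[OF runs_basic(3) runs_Cond(2)[OF _ runs_Seq[OF runs_basic(3)]]]]]) auto
    then show ?thesis unfolding decode_gate_def
      by (rule runs_weaken[OF runs_clears[OF assms(1)]]) (use M len CNOT in auto)
  next
    case (Toffoli a b q)
    have s0: "?s 0 = [True, True] @ enc_nat a @ enc_nat b @ enc_nat q @ rest" using assms(2) Toffoli by simp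
    have "runs (Seq (read_nat 5) (Seq (read_nat 6) (read_nat 7))) (?s(0 := enc_nat a @ enc_nat b @ enc_nat q @ rest)) (dstate s (Some g) rest) (3 * a + 3 + (3 * b + 3 + (3 * q + 3)))"
      by (rule runs_weaken[OF runs_Seq[OF runs_read_nat[of 5 _ a "enc_nat b @ enc_nat q @ rest"] runs_Seq[OF runs_read_nat[of 6 _ b "enc_nat q @ rest"] runs_read_nat[of 7 _ q rest]]]]) (auto simp: Toffoli intro!: dstate_eqI)
    with s0 have "runs branch_operands ?s (dstate s (Some g) rest) (1 + (1 + (3 * a + 3 + (3 * b + 3 + (3 * q + 3))) + 1) + 1 + 1)"
      unfolding branch_operands_def by (intro runs_Cond(1)[OF _ runs_Cond(1)[OF _ runs_Seq[OF runs_basic(3) runs_Cond(1)[OF _ runs_Seq[OF runs_basic(3)]]]]]) auto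
    then show ?thesis unfolding decode_gate_def
      by (rule runs_weaken[OF runs_clears[OF assms(1)]]) (use M len Toffoli in auto)
  qed
qed

definition emits :: "tmpl list \<Rightarrow> gen" where
  "emits ts = foldr (\<lambda>t g. Emit t ;; g) ts Nop"

lemma emits [simp]: "em (emits ts) d \<rho> = map (inst \<rho>) ts" "fr (emits ts) d \<rho> = \<rho> 0"
  by (induction ts) (simp_all add: emits_def)

lemma cswap_wf: "x \<in> set (cswap c a b) \<Longrightarrow> c < w \<Longrightarrow> a < w \<Longrightarrow> b < w \<Longrightarrow> c \<noteq> a \<Longrightarrow> c \<noteq> b \<Longrightarrow> a \<noteq> b \<Longrightarrow> wf_gate w x"
  by (auto simp: cswap_def)

lemma gate_step_wf:
  assumes "\<And>r q. r \<in> {1..7} \<Longrightarrow> q < m \<Longrightarrow> 3 < A r q \<and> A r q < W" "3 < c" "c < W" "x \<in> set (gate_step A c W m)"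
  shows "wf_gate (W + m) x"
proof -
  have "wf_gate (W + m) x" if "x \<in> set (fetch (A r) W m w)" "r \<in> {1..7}" "w \<in> {1, 2, 3}" for r w
  proof -
    from that(1) obtain q where q: "q < m" "x \<in> set (cswap (A r q) (W + q) w)" by (auto simp: fetch_def)
    show ?thesis using q(2) by (rule cswap_wf) (use assms(1)[OF that(2) q(1)] q(1) that(3) in auto)
  qed
  then show ?thesis using assms(2-4) by (auto simp: gate_step_def chad_def)
qed

section \<open>The decoding loop as a generator\<close>

context layout
begin

text \<open>Variables 1 to 4 hold the key length, the bound \<open>T\<close>, the number
  \<open>m\<close> of data qubits and the width \<open>W\<close>; loop variables start at 5. So the
  sum of variables 4 and \<open>d\<close> addresses a data qubit, and its mark is in the content
  lane of register \<open>r\<close>.\<close>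

definition gfetch :: "nat \<Rightarrow> nat \<Rightarrow> nat \<Rightarrow> gen" where
  "gfetch d r w = For 3 (gcswap (cell (Suc (2 * r)) d) (AExp 0 [4, d]) (const w))"

definition gchad :: "aexp \<Rightarrow> aexp \<Rightarrow> tmpl list" where
  "gchad c w = replicate 6 (TT w) @ [THad w] @ replicate 7 (TT w) @ [TCNOT c w, TT w, THad w, TT w, TT w]"

text \<open>Wire \<open>C + 2\<close> is cell 0 of the length lane of register 1, which is set
  exactly if a Hadamard gate was decoded.\<close>

definition gstep :: "nat \<Rightarrow> gen" where
  "gstep d = gfetch d 1 1 ;; emits (gchad (const (C + 2)) (const 1)) ;; gfetch d 1 1 ;;
     gfetch d 2 1 ;; Emit (TT (const 1)) ;; gfetch d 2 1 ;;
     gfetch d 3 1 ;; gfetch d 4 2 ;; Emit (TCNOT (const 1) (const 2)) ;; gfetch d 4 2 ;; gfetch d 3 1 ;;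
     gfetch d 5 1 ;; gfetch d 6 2 ;; gfetch d 7 3 ;; Emit (TToffoli (const 1) (const 2) (const 3)) ;;
     gfetch d 7 3 ;; gfetch d 6 2 ;; gfetch d 5 1"

definition marks :: "nat \<Rightarrow> nat \<Rightarrow> nat" where
  "marks r q = C + Suc (2 * r) + K * q"

lemma gfetch:
  assumes "d > 4"
  shows "em (gfetch d r w) d \<rho> = fetch (marks r) (\<rho> 4) (\<rho> 3) w" "fr (gfetch d r w) d \<rho> = \<rho> 0"
  using assms by (simp_all add: gfetch_def forE_id forF_id fetch_def marks_def)

lemma gstep:
  assumes "d > 4"
  shows "em (gstep d) d \<rho> = gate_step marks (C + 2) (\<rho> 4) (\<rho> 3)" "fr (gstep d) d \<rho> = \<rho> 0"
  using gfetch[OF assms] by (simp_all add: gstep_def gate_step_def chad_def gchad_def)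

lemma marks_bounds:
  assumes "K \<ge> 16" "q \<le> T" "C + K * Suc T \<le> W" "r \<in> {1..7}"
  shows "3 < marks r q \<and> marks r q < W"
  using cell_less[of "Suc (2 * r)" q T] assms C by (auto simp: marks_def)

lemma regs_decode_gate: "r \<in> regs decode_gate \<Longrightarrow> r \<le> 7"
  by (auto simp: decode_gate_def branch_operands_def clear_reg_def read_nat_def)

lemma dstate_length:
  assumes "\<And>r. length (s r) \<le> M" "s 0 = enc_gate g @ rest"
  shows "length (dstate s (Some g) rest r) \<le> M"
proof -
  have "length (enc_nat q) = Suc q" for q by (simp add: enc_nat_def)
  then show ?thesis using assms(1)[of 0] assms(1)[of r] assms(2)
    by (cases g) (auto simp: dstate_def split: if_splits)
qed

lemma gate_step_dstate:
  assumes "ok T F (lanes (dstate s go rest)) f" "\<not> f 1" "\<not> f 2" "\<not> f 3" "K \<ge> 16" "m \<le> T"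
    "C + K * Suc T \<le> W" "\<And>g. go = Some g \<Longrightarrow> wf_gate m g"
  shows "fold gate_apply (gate_step marks (C + 2) W m) (ketf W m f \<Phi>) =
    ketf W m f (case go of None \<Rightarrow> \<Phi> | Some g \<Rightarrow> gate_apply g \<Phi>)"
proof (rule gate_step)
  have lane: "f (C + j + K * i) = lanes (dstate s go rest) j i" if "j < 16" "i \<le> T" for j i
    using assms(1,5) that by (auto simp: ok_def)
  fix r q :: nat assume rq: "r \<in> {1..7}" "q < m"
  have "f (marks r q) = lanes (dstate s go rest) (Suc (2 * r)) q"
    unfolding marks_def using rq assms(6) by (intro lane) auto
  also have "\<dots> = (operand go r = Some q)"
    using rq(1) by (auto simp: lanes_def dstate_def nth_append split: option.splits)
  finally show "3 < marks r q \<and> marks r q < W \<and> f (marks r q) = (operand go r = Some q)"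
    using marks_bounds[OF assms(5) _ assms(7) rq(1), of q] rq(2) assms(6) by simp
next
  have "f (C + 2 + K * 0) = lanes (dstate s go rest) 2 0"
    using assms(1,5) unfolding ok_def by (metis le0 less_le_trans numeral_less_iff semiring_norm(76,78,79))
  then show "f (C + 2) = (operand go 1 \<noteq> None)"
    by (auto simp: lanes_def dstate_def split: option.splits)
  have "C + K \<le> W" using assms(7) by simp
  then show "C + 2 < W" using assms(5) by simp
qed (use C assms in auto)

text \<open>Surplus rounds decode \<open>None\<close>. Garbage wires are still being allocated while
  gates already act on data qubits, so the final allocation, not only the current one, has to stay
  below \<open>W\<close>. The bound \<open>M\<close> persists because decoding only moves bits from
  the description to the operand registers.\<close>

lemma decode_loop:
  assumes K16: "K \<ge> 16" and fl: "5 + flags decode_gate \<le> C" and m: "m \<le> T" and MT: "M + (25 * M + 25) \<le> T"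
    and d: "d > 4" and \<rho>: "\<rho> 2 = T" "\<rho> 3 = m" "\<rho> 4 = W"
  defines "g \<equiv> comp (Suc d) 4 5 decode_gate ;; gstep (Suc d)"
  defines "h \<equiv> \<lambda>i F. fr g (Suc d) (\<rho>(0 := F, d := i))" and "e \<equiv> \<lambda>i F. em g (Suc d) (\<rho>(0 := F, d := i))"
  shows "\<lbrakk>length gs \<le> c; C + K * Suc T \<le> F; ok T F (lanes s) f; f 4; \<not> f 1; \<not> f 2; \<not> f 3; s 0 = concat (map enc_gate gs);
    \<forall>g\<in>set gs. wf_gate m g; \<And>r. length (s r) \<le> M; forF h c i F \<le> W\<rbrakk> \<Longrightarrow>
    F \<le> forF h c i F \<and> (\<forall>x\<in>set (forE h e c i F). wf_gate (W + m) x) \<and>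
    (\<exists>f'. fold gate_apply (forE h e c i F) (ketf W m f \<Phi>) = ketf W m f' (fold gate_apply gs \<Phi>) \<and>
       (\<forall>w. C + K * Suc T \<le> w \<and> w < F \<longrightarrow> f' w = f w))"
proof (induction c arbitrary: i F s f gs \<Phi>)
  case 0
  then show ?case by auto
next
  case (Suc c)
  \<comment> \<open>The default is \<open>None\<close> once the description is empty, and
    \<open>tl\<close> then keeps the rest empty.\<close>
  define go where "go = (case gs of [] \<Rightarrow> None | g # _ \<Rightarrow> Some g)"
  define rest where "rest = concat (map enc_gate (tl gs))"
  define s' where "s' = dstate s go rest"
  define \<rho>' where "\<rho>' = \<rho>(0 := F, d := i)"
  have \<rho>': "\<rho>' 0 = F" "\<rho>' 2 = T" "\<rho>' 3 = m" "\<rho>' 4 = W" using \<rho> d by (auto simp: \<rho>'_def)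
  have "runs decode_gate s s' (25 * M + 25)"
    using runs_decode_gate_None[of s M] runs_decode_gate_Some[of s M "hd gs" rest] Suc.prems
    by (cases gs) (auto simp: go_def rest_def s'_def)
  then obtain k where k: "k \<le> 25 * M + 25" "exec decode_gate s k s'" by (auto simp: runs_def)
  have len: "length (s' r) \<le> M" for r
  proof (cases gs)
    case Nil
    then show ?thesis using Suc.prems(10)[of r] by (simp add: s'_def go_def rest_def dstate_def)
  next
    case (Cons g gs')
    then show ?thesis using dstate_length[of s M g rest r] Suc.prems by (simp add: s'_def go_def rest_def)
  qed
  have go: "wf_gate m g" if "go = Some g" for g using that Suc.prems(9) by (auto simp: go_def split: list.splits)
  have "length (s r) + k \<le> T" for r using Suc.prems(10)[of r] k(1) MT by simp
  moreover have "\<forall>r\<in>regs decode_gate. Suc (2 * r) < K" using regs_decode_gate K16 by fastforce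
  ultimately have tr: "trans T 5 F f (em (comp (Suc d) 4 5 decode_gate) (Suc d) \<rho>') (fr (comp (Suc d) 4 5 decode_gate) (Suc d) \<rho>') (lanes s')"
    using comp_active[of decode_gate "Suc d" \<rho>' T 4 5 s f k s'] Suc.prems \<rho>' k fl d by simp
  define F1 where "F1 = fr (comp (Suc d) 4 5 decode_gate) (Suc d) \<rho>'"
  define f1 where "f1 = cl (em (comp (Suc d) 4 5 decode_gate) (Suc d) \<rho>') f"
  have h: "h i F = F1" using \<rho>' d by (simp add: h_def g_def gstep \<rho>'_def F1_def)
  have e: "e i F = em (comp (Suc d) 4 5 decode_gate) (Suc d) \<rho>' @ gate_step marks (C + 2) W m"
    using \<rho> d by (simp add: e_def g_def gstep \<rho>'_def)
  note td = transD[OF tr, folded F1_def f1_def]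
  have f1: "f1 4" "\<not> f1 1" "\<not> f1 2" "\<not> f1 3" using td(3)[of 1] td(3)[of 2] td(3)[of 3] td(3)[of 4] Suc.prems by auto
  have fW: "forF h c (Suc i) F1 \<le> W" using Suc.prems h by simp
  have "length (tl gs) \<le> c" using Suc.prems(1) by simp
  from Suc.IH[of "tl gs" F1 s' f1 "Suc i" "case go of None \<Rightarrow> \<Phi> | Some g \<Rightarrow> gate_apply g \<Phi>", OF this _ td(2) f1 _ _ len fW]
  have IH: "F1 \<le> forF h c (Suc i) F1" "\<forall>x\<in>set (forE h e c (Suc i) F1). wf_gate (W + m) x"
    "\<exists>f'. fold gate_apply (forE h e c (Suc i) F1) (ketf W m f1 (case go of None \<Rightarrow> \<Phi> | Some g \<Rightarrow> gate_apply g \<Phi>)) =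
       ketf W m f' (fold gate_apply (tl gs) (case go of None \<Rightarrow> \<Phi> | Some g \<Rightarrow> gate_apply g \<Phi>)) \<and>
       (\<forall>w. C + K * Suc T \<le> w \<and> w < F1 \<longrightarrow> f' w = f1 w)"
    using Suc.prems(2,9) td(1) list.set_sel(2)[of gs] by (cases gs; fastforce simp: s'_def dstate_def rest_def)+
  have FW: "C + K * Suc T \<le> W" using Suc.prems(2) td(1) IH(1) fW by linarith
  have wf1: "\<forall>x\<in>set (em (comp (Suc d) 4 5 decode_gate) (Suc d) \<rho>'). cgate x \<and> wf_gate W x"
    using tr IH(1) fW unfolding trans_def F1_def[symmetric] by (meson le_trans wf_gate_mono)
  have "fold gate_apply (e i F) (ketf W m f \<Phi>) = ketf W m f1 (case go of None \<Rightarrow> \<Phi> | Some g \<Rightarrow> gate_apply g \<Phi>)"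
    unfolding e fold_append o_apply cl_ketf[OF wf1] f1_def[symmetric]
    using td(2) f1 K16 m FW go unfolding s'_def by (intro gate_step_dstate) auto
  then have 1: "fold gate_apply (forE h e (Suc c) i F) (ketf W m f \<Phi>) =
      fold gate_apply (forE h e c (Suc i) F1) (ketf W m f1 (case go of None \<Rightarrow> \<Phi> | Some g \<Rightarrow> gate_apply g \<Phi>))"
    by (simp add: h)
  have 2: "fold gate_apply (tl gs) (case go of None \<Rightarrow> \<Phi> | Some g \<Rightarrow> gate_apply g \<Phi>) = fold gate_apply gs \<Phi>"
    by (cases gs) (auto simp: go_def)
  have 3: "f1 w = f w" if "C + K * Suc T \<le> w" "w < F" for w using that tr by (auto simp: trans_def frame_def f1_def)
  have 4: "\<forall>x\<in>set (e i F). wf_gate (W + m) x"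
  proof -
    have "C + 2 < W" using FW K16 by simp
    then have "wf_gate (W + m) x" if "x \<in> set (gate_step marks (C + 2) W m)" for x
      using gate_step_wf[OF _ _ _ that] marks_bounds[OF K16 _ FW] m C by auto
    then show ?thesis using wf1 wf_gate_mono[of W _ "W + m"] by (auto simp: e)
  qed
  obtain f' where f': "fold gate_apply (forE h e c (Suc i) F1) (ketf W m f1 (case go of None \<Rightarrow> \<Phi> | Some g \<Rightarrow> gate_apply g \<Phi>)) =
       ketf W m f' (fold gate_apply gs \<Phi>)" "\<And>w. C + K * Suc T \<le> w \<Longrightarrow> w < F1 \<Longrightarrow> f' w = f1 w"
    using IH(3) unfolding 2 by blast
  show ?case
  proof (intro conjI exI[of _ f'])
    show "F \<le> forF h (Suc c) i F" using td(1) IH(1) by (simp add: h)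
    show "\<forall>x\<in>set (forE h e (Suc c) i F). wf_gate (W + m) x" using 4 IH(2) by (auto simp: h)
    show "fold gate_apply (forE h e (Suc c) i F) (ketf W m f \<Phi>) = ketf W m f' (fold gate_apply gs \<Phi>)"
      using 1 f'(1) by simp
    show "\<forall>w. C + K * Suc T \<le> w \<and> w < F \<longrightarrow> f' w = f w" using f'(2) 3 td(1) by simp
  qed
qed

end

lemma length_enc_nat: "length (enc_nat q) = Suc q"
  by (simp add: enc_nat_def)

lemma length_enc_circuit: "width U + length (gates U) \<le> length (enc_circuit U)"
proof -
  have "length gs \<le> length (concat (map enc_gate gs))" for gs
  proof (induction gs)
    case (Cons g gs)
    then show ?case by (cases g) (auto simp: length_enc_nat)
  qed simp
  from this[of "gates U"] show ?thesis by (simp add: enc_circuit_def length_enc_nat)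
qed

section \<open>Coherent evaluation of the keyed circuit\<close>

context layout
begin

definition key :: "nat \<Rightarrow> aexp" where "key v = AExp (C + K) (replicate K 2 @ [v])"

lemma aval_key [simp]: "aval \<rho> (key v) = C + K * Suc (\<rho> 2) + \<rho> v"
  by (simp add: key_def sum_list_replicate)

text \<open>Wire 4 is constantly true. It controls the top-level programs, and here it supplies the
  ones of the length lane. The key is copied, not moved, so that the original stays untouched in
  \<open>R\<close>.\<close>

definition gcopy :: gen where
  "gcopy = For 1 (Emit (TCNOT (key 5) (cell 1 5)) ;; Emit (TCNOT (const 4) (cell 0 5)))"

definition gdecode :: gen where
  "gdecode = For 2 (comp 6 4 5 decode_gate ;; gstep 6)"

text \<open>A description starts with the width, which must be out of the way before gates can be
  decoded. It goes to register 1, where the first decoding step clears it.\<close>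

definition grun :: "program \<Rightarrow> gen" where
  "grun P = gcopy ;; comp 5 4 5 P ;; comp 5 4 5 read_header ;; gdecode"

definition init :: "nat \<Rightarrow> bool list \<Rightarrow> nat \<Rightarrow> bool" where
  "init T k w \<longleftrightarrow> w = 4 \<or> C + K * Suc T \<le> w \<and> w < C + K * Suc T + length k \<and> k ! (w - (C + K * Suc T))"

lemma em_gcopy:
  assumes "\<rho> 2 = T" "\<rho> 1 = n"
  shows "em gcopy 5 \<rho> = concat (map (\<lambda>i. [CNOT (C + K * Suc T + i) (C + 1 + K * i), CNOT 4 (C + 0 + K * i)]) [0..<n])"
    "fr gcopy 5 \<rho> = \<rho> 0"
  using assms by (simp_all add: gcopy_def forE_id forF_id)

lemma trans_gcopy:
  assumes "\<rho> 2 = T" "\<rho> 1 = n" "\<rho> 0 = C + K * Suc T + n" "n \<le> T" "K > 1" "length k = n"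
  shows "trans T 5 (\<rho> 0) (init T k) (em gcopy 5 \<rho>) (fr gcopy 5 \<rho>) (lanes ((\<lambda>r. [])(0 := k)))"
proof -
  define f' where "f' j = cl (concat (map (\<lambda>i. [CNOT (C + K * Suc T + i) (C + 1 + K * i), CNOT 4 (C + 0 + K * i)]) [0..<j])) (init T k)" for j
  have f0: "init T k 4" "\<And>w. w < C + K * Suc T \<Longrightarrow> init T k w = (w = 4)" "\<And>i. i < n \<Longrightarrow> init T k (C + K * Suc T + i) = k ! i"
    using C assms(6) by (auto simp: init_def)
  have small: "C + j + K * i < C + K * Suc T" if "j < K" "i \<le> T" for i j using cell_less that by blast
  have f': "(\<forall>i<j. f' j (C + 1 + K * i) = k ! i \<and> f' j (C + 0 + K * i)) \<and>
     (\<forall>w. (\<forall>i<j. w \<noteq> C + 1 + K * i \<and> w \<noteq> C + 0 + K * i) \<longrightarrow> f' j w = init T k w)" if "j \<le> n" for j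
    using that
  proof (induction j)
    case 0 then show ?case by (simp add: f'_def)
  next
    case (Suc j)
    then have IH: "\<And>i. i < j \<Longrightarrow> f' j (C + 1 + K * i) = k ! i \<and> f' j (C + 0 + K * i)"
      "\<And>w. (\<And>i. i < j \<Longrightarrow> w \<noteq> C + 1 + K * i \<and> w \<noteq> C + 0 + K * i) \<Longrightarrow> f' j w = init T k w" by auto
    have inj: "C + 1 + K * i = C + 1 + K * i' \<longleftrightarrow> i = i'" "C + 0 + K * i = C + 0 + K * i' \<longleftrightarrow> i = i'"
      "C + 0 + K * i \<noteq> C + 1 + K * i'" "C + 1 + K * i \<noteq> C + 0 + K * i'" for i i'
      using cell_inj[of 1 1 i i'] cell_inj[of 0 0 i i'] cell_inj[of 0 1 i i'] cell_inj[of 1 0 i i'] \<open>K > 1\<close> by auto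
    have j: "j \<le> T" using Suc.prems assms by simp
    have v1: "f' j (C + 1 + K * j) = False" using inj small[of 1 j] j \<open>K > 1\<close> C by (subst IH(2)) (auto simp: f0)
    have v0: "f' j (C + 0 + K * j) = False" using inj small[of 0 j] j \<open>K > 1\<close> C by (subst IH(2)) (auto simp: f0)
    have v4: "f' j 4 = True" using C by (subst IH(2)) (auto simp: f0)
    have "C + K * Suc T + j \<noteq> C + 1 + K * i \<and> C + K * Suc T + j \<noteq> C + 0 + K * i" if "i < j" for i
      using small[of 1 i] small[of 0 i] that j \<open>K > 1\<close> by simp
    then have "f' j (C + K * Suc T + j) = init T k (C + K * Suc T + j)" by (intro IH(2))
    then have vk: "f' j (C + K * Suc T + j) = k ! j" using f0(3)[of j] Suc.prems by simp
    have ne: "4 \<noteq> C + 1 + K * j" using C by simp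
    have step: "f' (Suc j) = (f' j)(C + 1 + K * j := k ! j, C + 0 + K * j := True)"
      using v1 v0 v4 vk ne inj(3)[of j j] by (simp add: f'_def fun_upd_def)
    show ?case unfolding step using IH inj by (auto simp: less_Suc_eq)
  qed
  note f'n = f'[of n, simplified]
  have oth: "f' n w = init T k w" if "\<And>i. i < n \<Longrightarrow> w \<noteq> C + 1 + K * i \<and> w \<noteq> C + 0 + K * i" for w using f'n that by auto
  have big: "f' n w = init T k w" if "w < C \<or> C + K * Suc T \<le> w" for w
  proof (rule oth)
    fix i assume "i < n"
    then show "w \<noteq> C + 1 + K * i \<and> w \<noteq> C + 0 + K * i"
      using small[of 1 i] small[of 0 i] that \<open>K > 1\<close> assms(4) by auto
  qed
  have "f' n (C + j + K * i) = lanes ((\<lambda>r. [])(0 := k)) j i" if "j < K" "i \<le> T" for j i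
  proof (cases "j \<le> 1 \<and> i < n")
    case True
    then have "j = 0 \<or> j = 1" by auto
    then show ?thesis using f'n True assms(6) by (auto simp: lanes_def)
  next
    case False
    have "\<not> lanes ((\<lambda>r. [])(0 := k)) j i" using False assms(6) by (auto simp: lanes_def)
    moreover have "f' n (C + j + K * i) = init T k (C + j + K * i)"
    proof (rule oth)
      fix i' assume "i' < n"
      then show "C + j + K * i \<noteq> C + 1 + K * i' \<and> C + j + K * i \<noteq> C + 0 + K * i'"
        using cell_inj[of j 1 i i'] cell_inj[of j 0 i i'] False that \<open>K > 1\<close> by auto
    qed
    moreover have "\<not> init T k (C + j + K * i)" using small[OF that] C by (simp add: f0)
    ultimately show ?thesis by simp
  qed
  moreover have "\<not> f' n 0" "\<And>i. i \<ge> \<rho> 0 \<Longrightarrow> \<not> f' n i"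
    using big C assms by (auto simp: init_def)
  moreover have "frame T 5 (\<rho> 0) (init T k) (f' n)" using big C by (auto simp: frame_def)
  moreover have "cgate x \<and> wf_gate (\<rho> 0) x" if x: "x \<in> set (em gcopy 5 \<rho>)" for x
  proof -
    from x obtain i where i: "i < n" "x = CNOT (C + K * Suc T + i) (C + 1 + K * i) \<or> x = CNOT 4 (C + 0 + K * i)"
      unfolding em_gcopy(1)[OF assms(1,2)] by auto
    then show ?thesis using small[of 1 i] small[of 0 i] \<open>K > 1\<close> assms C by auto
  qed
  moreover have eq: "cl (em gcopy 5 \<rho>) (init T k) = f' n"
    unfolding em_gcopy(1)[OF assms(1,2)] f'_def ..
  ultimately show ?thesis unfolding trans_def em_gcopy(2)[OF assms(1,2)] eq ok_def
    by blast
qed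

lemma grun:
  assumes K16: "K \<ge> 16" and fl: "5 + flags decode_gate \<le> C" "5 + flags read_header \<le> C" "5 + flags P \<le> C"
    and regs: "\<forall>r\<in>regs P. Suc (2 * r) < K"
    and T: "52 * M + 25 \<le> T" and \<rho>: "\<rho> 0 = C + K * Suc T + n" "\<rho> 1 = n" "\<rho> 2 = T" "\<rho> 3 = m" "\<rho> 4 = W"
    and W: "fr (grun P) 5 \<rho> \<le> W"
    and k: "length k = n" and P: "exec P ((\<lambda>r. [])(0 := k)) t s" "s 0 = enc_circuit U" "n + t \<le> M"
    and U: "wf_circuit U" "width U = m"
  shows "(\<forall>x\<in>set (em (grun P) 5 \<rho>). wf_gate (W + m) x) \<and> C + K * Suc T + n \<le> W \<and>
    (\<exists>f'. fold gate_apply (em (grun P) 5 \<rho>) (ketf W m (init T k) \<Phi>) = ketf W m f' (fold gate_apply (gates U) \<Phi>) \<and>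
       (\<forall>i<n. f' (C + K * Suc T + i) = k ! i))"
proof -
  let ?s0 = "(\<lambda>r :: nat. [])(0 := k)"
  have len0: "length (?s0 r) \<le> n" for r using k by simp
  have len: "length (s r) \<le> M" for r using exec_length[OF P(1), of r] len0[of r] P(3) by simp
  have mM: "m + length (gates U) \<le> M" using length_enc_circuit[of U] len[of 0] P(2) U by simp
  define rest where "rest = concat (map enc_gate (gates U))"
  define s2 where "s2 = s(0 := rest, 1 := replicate m True @ s 1)"
  have s0: "s 0 = enc_nat m @ rest" using P(2) U by (simp add: enc_circuit_def rest_def)
  obtain t2 where t2: "t2 \<le> 3 * m + 2" "exec read_header s t2 s2" using runs_read_header[where s = s, OF s0] by (auto simp: runs_def s2_def)
  \<comment> \<open>Register 1 may already hold data of the program below the header, hence the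
    factor 2.\<close>
  have len2: "length (s2 r) \<le> 2 * M" for r using len[of r] mM len[of 0] s0 by (auto simp: s2_def)
  define \<rho>1 where "\<rho>1 = \<rho>(0 := fr gcopy 5 \<rho>)"
  define \<rho>2 where "\<rho>2 = \<rho>1(0 := fr (comp 5 4 5 P) 5 \<rho>1)"
  define \<rho>3 where "\<rho>3 = \<rho>2(0 := fr (comp 5 4 5 read_header) 5 \<rho>2)"
  have fr_eq: "fr (grun P) 5 \<rho> = fr gdecode 5 \<rho>3"
    and em_eq: "em (grun P) 5 \<rho> = em gcopy 5 \<rho> @ em (comp 5 4 5 P) 5 \<rho>1 @ em (comp 5 4 5 read_header) 5 \<rho>2 @ em gdecode 5 \<rho>3"
    by (simp_all add: grun_def \<rho>1_def \<rho>2_def \<rho>3_def)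
  have \<rho>v: "\<rho>1 2 = T" "\<rho>2 2 = T" "\<rho>3 2 = T" "\<rho>3 3 = m" "\<rho>3 4 = W" using \<rho> by (simp_all add: \<rho>1_def \<rho>2_def \<rho>3_def)
  have tr1: "trans T 5 (\<rho> 0) (init T k) (em gcopy 5 \<rho>) (\<rho>1 0) (lanes ?s0)"
    using trans_gcopy[of \<rho> T n k] \<rho> T P(3) K16 k by (simp add: \<rho>1_def)
  define f1 where "f1 = cl (em gcopy 5 \<rho>) (init T k)"
  note td1 = transD[OF tr1, folded f1_def]
  have i4: "init T k 4" "\<not> init T k 1" "\<not> init T k 2" "\<not> init T k 3" using C by (auto simp: init_def)
  have tr2: "trans T 5 (\<rho>1 0) f1 (em (comp 5 4 5 P) 5 \<rho>1) (\<rho>2 0) (lanes s)"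
    using comp_active[of P 5 \<rho>1 T 4 5 ?s0 f1 t s] regs \<rho>v \<rho>(1) td1 td1(3)[of 4] i4 fl P len0 T
    by (simp add: \<rho>2_def k)
  define f2 where "f2 = cl (em (comp 5 4 5 P) 5 \<rho>1) f1"
  note td2 = transD[OF tr2, folded f2_def]
  have "length (s r) + t2 \<le> T" for r using len[of r] t2(1) mM T by simp
  moreover have "\<forall>r\<in>regs read_header. Suc (2 * r) < K" using K16 by (simp add: read_header_def)
  ultimately have tr3: "trans T 5 (\<rho>2 0) f2 (em (comp 5 4 5 read_header) 5 \<rho>2) (\<rho>3 0) (lanes s2)"
    using comp_active[of read_header 5 \<rho>2 T 4 5 s f2 t2 s2] t2 \<rho>v \<rho>(1) td1 td2 td1(3)[of 4] td2(3)[of 4] i4 fl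
    by (simp add: \<rho>3_def)
  define f3 where "f3 = cl (em (comp 5 4 5 read_header) 5 \<rho>2) f2"
  note td3 = transD[OF tr3, folded f3_def]
  define h where "h = (\<lambda>i F. fr (comp 6 4 5 decode_gate ;; gstep 6) 6 (\<rho>3(0 := F, 5 := i)))"
  define e where "e = (\<lambda>i F. em (comp 6 4 5 decode_gate ;; gstep 6) 6 (\<rho>3(0 := F, 5 := i)))"
  have dec_eq: "fr gdecode 5 \<rho>3 = forF h T 0 (\<rho>3 0)" "em gdecode 5 \<rho>3 = forE h e T 0 (\<rho>3 0)"
    using \<rho>v by (simp_all add: gdecode_def h_def e_def)
  have f3: "f3 4" "\<not> f3 1" "\<not> f3 2" "\<not> f3 3"
    using i4 td1(3)[of 1] td1(3)[of 2] td1(3)[of 3] td1(3)[of 4] td2(3)[of 1] td2(3)[of 2] td2(3)[of 3] td2(3)[of 4]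
      td3(3)[of 1] td3(3)[of 2] td3(3)[of 3] td3(3)[of 4] by auto
  have W3: "forF h T 0 (\<rho>3 0) \<le> W" using W fr_eq dec_eq by simp
  have le: "C + K * Suc T \<le> \<rho>3 0" "\<rho> 0 \<le> \<rho>3 0" using td1 td2 td3 \<rho>(1) by auto
  have g: "length (gates U) \<le> T" "m \<le> T" using mM T by auto
  \<comment> \<open>The origin of the constant 52: the decoding loop starts with registers of length
    up to \<open>2 * M\<close>.\<close>
  have MT: "2 * M + (25 * (2 * M) + 25) \<le> T" using T by simp
  have d5: "(5::nat) > 4" by simp
  have s2: "s2 0 = concat (map enc_gate (gates U))" by (simp add: s2_def rest_def)
  have wfU: "\<forall>g\<in>set (gates U). wf_gate m g" using U by (simp add: wf_circuit_def)
  have s56: "Suc 5 = 6" by simp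
  note D = decode_loop[OF K16 fl(1) g(2) MT d5 \<rho>v(3-5), unfolded s56, folded h_def e_def,
      OF g(1) le(1) td3(2) f3 s2 wfU len2 W3, of \<Phi>]
  from D obtain f' where f': "fold gate_apply (em gdecode 5 \<rho>3) (ketf W m f3 \<Phi>) = ketf W m f' (fold gate_apply (gates U) \<Phi>)"
     "\<And>w. C + K * Suc T \<le> w \<Longrightarrow> w < \<rho>3 0 \<Longrightarrow> f' w = f3 w" unfolding dec_eq by blast
  have \<rho>W: "\<rho>1 0 \<le> W" "\<rho>2 0 \<le> W" "\<rho>3 0 \<le> W" using D W3 td1 td2 td3 by auto
  have cl: "\<forall>x\<in>set (em gcopy 5 \<rho> @ em (comp 5 4 5 P) 5 \<rho>1 @ em (comp 5 4 5 read_header) 5 \<rho>2). cgate x \<and> wf_gate W x"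
    using tr1 tr2 tr3 \<rho>W unfolding trans_def by (auto intro: wf_gate_mono)
  have "cl (em gcopy 5 \<rho> @ em (comp 5 4 5 P) 5 \<rho>1 @ em (comp 5 4 5 read_header) 5 \<rho>2) (init T k) = f3"
    by (simp add: f1_def f2_def f3_def)
  with cl_ketf[OF cl, of m "init T k" \<Phi>] f'(1)
  have fin: "fold gate_apply (em (grun P) 5 \<rho>) (ketf W m (init T k) \<Phi>) = ketf W m f' (fold gate_apply (gates U) \<Phi>)"
    by (simp add: em_eq)
  \<comment> \<open>The key lies directly behind the cells and below the first fresh wire, so every
    stage frames it.\<close>
  have "f' (C + K * Suc T + i) = k ! i" if "i < n" for i
  proof -
    have "f' (C + K * Suc T + i) = f3 (C + K * Suc T + i)" using le \<rho>(1) that by (intro f'(2)) auto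
    also have "\<dots> = init T k (C + K * Suc T + i)"
      using tr1 tr2 tr3 td1(1) td2(1) td3(1) \<rho>(1) that
      unfolding trans_def frame_def f1_def[symmetric] f2_def[symmetric] f3_def[symmetric] by auto
    finally show ?thesis using that k C by (simp add: init_def)
  qed
  moreover have "\<forall>x\<in>set (em (grun P) 5 \<rho>). wf_gate (W + m) x"
    using cl D wf_gate_mono[of W _ "W + m"] unfolding em_eq dec_eq by auto
  moreover have "C + K * Suc T + n \<le> W" using le \<rho> \<rho>W by simp
  ultimately show ?thesis using fin by blast
qed

end

subsection \<open>The committed states\<close>

lemma finite_bits [simp]: "finite (bits n)"
  unfolding bits_def using finite_lists_length_eq[of "UNIV :: bool set" n] by simp

lemma bits_0: "bits 0 = {[]}"
  by (auto simp: bits_def)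

lemma sum_bits_snoc: "(\<Sum>x\<in>bits (Suc n). g x) = (\<Sum>x\<in>bits n. g (x @ [False]) + g (x @ [True]))"
proof -
  have eq: "bits (Suc n) = (\<lambda>x. x @ [False]) ` bits n \<union> (\<lambda>x. x @ [True]) ` bits n"
  proof -
    have "x \<in> (\<lambda>x. x @ [False]) ` bits n \<union> (\<lambda>x. x @ [True]) ` bits n" if "length x = Suc n" for x :: "bool list"
      using that by (cases x rule: rev_cases) (auto simp: bits_def image_iff)
    then show ?thesis by (auto simp: bits_def)
  qed
  have "(\<Sum>x\<in>bits (Suc n). g x) = (\<Sum>x\<in>(\<lambda>x. x @ [False]) ` bits n. g x) + (\<Sum>x\<in>(\<lambda>x. x @ [True]) ` bits n. g x)"
    unfolding eq by (intro sum.union_disjoint) auto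
  also have "\<dots> = (\<Sum>x\<in>bits n. g (x @ [False])) + (\<Sum>x\<in>bits n. g (x @ [True]))"
    by (simp add: sum.reindex inj_on_def)
  finally show ?thesis by (simp add: sum.distrib)
qed

lemma gate_apply_sum: "gate_apply g (\<lambda>z. c * (\<Sum>k\<in>A. \<psi> k z)) = (\<lambda>z. c * (\<Sum>k\<in>A. gate_apply g (\<psi> k) z))"
proof -
  have "a * (b * (\<Sum>k\<in>A. h k)) = b * (\<Sum>k\<in>A. a * h k)" for a b :: complex and h
    by (simp add: sum_distrib_left mult_ac)
  then show ?thesis
    by (cases g) (auto simp: gate_apply.simps fun_eq_iff sum.distrib sum_subtractf sum_divide_distrib[symmetric]
        sum_negf ring_distribs add_divide_distrib diff_divide_distrib)
qed

lemma gates_apply_sum: "fold gate_apply gs (\<lambda>z. c * (\<Sum>k\<in>A. \<psi> k z)) = (\<lambda>z. c * (\<Sum>k\<in>A. fold gate_apply gs (\<psi> k) z))"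
  by (induction gs arbitrary: \<psi>) (auto simp: gate_apply_sum)

lemma ketf_update:
  assumes "q < W" "length z = W + m"
  shows "ketf W m f \<Phi> (z[q := b]) = (if b = f q then ketf W m (f(q := z ! q)) \<Phi> z else 0)"
proof -
  have "(\<forall>i<W. z[q := b] ! i = f i) \<longleftrightarrow> b = f q \<and> (\<forall>i<W. z ! i = (f(q := z ! q)) i)"
    using assms by (auto simp: nth_list_update)
  moreover have "drop W (z[q := b]) = drop W z" using assms(1) by simp
  ultimately show ?thesis unfolding ketf_def length_list_update by (simp only: if_distrib simp_thms) auto
qed

lemma ketf_upd_other: "q < W \<Longrightarrow> z ! q \<noteq> b \<Longrightarrow> ketf W m (f(q := b)) \<Phi> z = 0"
  by (auto simp: ketf_def)

lemma Had_ketf: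
  assumes "q < W" "\<not> f q"
  shows "gate_apply (Had q) (ketf W m f \<Phi>) = (\<lambda>z. 1 / complex_of_real (sqrt 2) * (\<Sum>b\<in>UNIV. ketf W m (f(q := b)) \<Phi> z))"
proof (rule kets_eqI[where N = "W + m"])
  show "(\<lambda>z. 1 / complex_of_real (sqrt 2) * (\<Sum>b\<in>UNIV. ketf W m (f(q := b)) \<Phi> z)) \<in> kets (W + m)"
    by (auto simp: kets_def ketf_def)
  fix z :: "bool list" assume "length z = W + m"
  then show "gate_apply (Had q) (ketf W m f \<Phi>) z = 1 / complex_of_real (sqrt 2) * (\<Sum>b\<in>UNIV. ketf W m (f(q := b)) \<Phi> z)"
    using assms ketf_upd_other[of q W z "\<not> z ! q" m f \<Phi>]
    by (cases "z ! q") (auto simp: gate_apply.simps ketf_update UNIV_bool)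
qed auto

text \<open>\<open>X = H Z H\<close> with \<open>Z = T^4\<close>. A CNOT cannot produce the first
  set bit, as all wires start at zero.\<close>

lemma X_ketf:
  assumes "q < W"
  shows "fold gate_apply [Had q, TGate q, TGate q, TGate q, TGate q, Had q] (ketf W m f \<Phi>) = ketf W m (f(q := \<not> f q)) \<Phi>"
proof (rule kets_eqI[where N = "W + m"])
  fix z :: "bool list" assume z: "length z = W + m"
  define r where "r = complex_of_real (sqrt 2)"
  have r: "r * r = 2" "r \<noteq> 0" by (simp_all add: r_def flip: of_real_mult)
  obtain a b where ab: "branch q z (ketf W m f \<Phi>) = (a, b)" by force
  have q: "q < length z" using assms z by simp
  have u4: "\<omega> * (\<omega> * (\<omega> * (\<omega> * x))) = - x" for x
  proof -
    have u2: "\<omega> * (\<omega> * x) = \<i> * x" for x using u_powers(1) by (simp add: power2_eq_square mult.assoc[symmetric])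
    show ?thesis unfolding u2 by simp
  qed
  have "branch q z (ketf W m (f(q := \<not> f q)) \<Phi>) = (b, a)"
    using ab assms z by (auto simp: branch_def ketf_update)
  moreover have "branch q z (fold gate_apply [Had q, TGate q, TGate q, TGate q, TGate q, Had q] (ketf W m f \<Phi>)) =
    (((a + b) / r - (a - b) / r) / r, ((a + b) / r + (a - b) / r) / r)"
    by (simp add: branch_gate[OF q] ab u4 r_def) (simp add: divide_inverse algebra_simps)
  moreover have "((a + b) / r - (a - b) / r) / r = b" "((a + b) / r + (a - b) / r) / r = a"
    using r by (simp_all add: field_simps)
  ultimately show "fold gate_apply [Had q, TGate q, TGate q, TGate q, TGate q, Had q] (ketf W m f \<Phi>) z = ketf W m (f(q := \<not> f q)) \<Phi> z"
    by (intro branch_eqI[OF q]) (simp only:)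
qed (rule kets_gates kets_ketf)+

lemma zero_ket_ketf: "zero_ket (W + m) = ketf W m (\<lambda>_. False) (zero_ket m)"
proof
  fix z :: "bool list"
  have "z = replicate (W + m) False \<longleftrightarrow> length z = W + m \<and> (\<forall>i<W. z ! i = False) \<and> drop W z = replicate m False"
  proof
    assume r: "length z = W + m \<and> (\<forall>i<W. z ! i = False) \<and> drop W z = replicate m False"
    then have "take W z = replicate W False" by (intro nth_equalityI) auto
    then show "z = replicate (W + m) False" using r by (metis append_take_drop_id replicate_add)
  qed auto
  then show "zero_ket (W + m) z = ketf W m (\<lambda>_. False) (zero_ket m) z"
    by (auto simp: zero_ket_def basis_ket_def ketf_def)
qed

section \<open>The state that commits to 0\<close>

context layout
begin

text \<open>The constant one on wire 4 comes from a NOT and the superposition of all keys from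
  Hadamard gates; all other wires of \<open>R\<close> still are zero.\<close>

definition gload :: gen where
  "gload = emits [THad (const 4), TT (const 4), TT (const 4), TT (const 4), TT (const 4), THad (const 4)] ;;
    For 1 (Emit (THad (key 5)))"

definition gmain :: "program \<Rightarrow> gen" where
  "gmain P = gload ;; grun P"

lemma em_gload:
  "em gload 5 \<rho> = [Had 4, TGate 4, TGate 4, TGate 4, TGate 4, Had 4] @ map (\<lambda>i. Had (C + K * Suc (\<rho> 2) + i)) [0..<\<rho> 1]"
  "fr gload 5 \<rho> = \<rho> 0"
  by (simp_all add: gload_def forE_id forF_id)

lemma init_snoc: "init T (k @ [b]) = (init T k)(C + K * Suc T + length k := b)"
  using C by (auto simp: init_def fun_eq_iff nth_append)

lemma gload_state:
  assumes "C + K * Suc T + n \<le> W" "\<rho> 2 = T" "\<rho> 1 = n"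
  shows "fold gate_apply (em gload 5 \<rho>) (zero_ket (W + m)) =
    (\<lambda>z. (1 / complex_of_real (sqrt 2)) ^ n * (\<Sum>k\<in>bits n. ketf W m (init T k) (zero_ket m) z))"
proof -
  define r where "r = 1 / complex_of_real (sqrt 2)"
  have "(\<lambda>_. False)(4 := True) = init T []" by (auto simp: init_def fun_eq_iff)
  moreover have "4 < W" using assms C by simp
  ultimately have X: "fold gate_apply [Had 4, TGate 4, TGate 4, TGate 4, TGate 4, Had 4] (zero_ket (W + m)) = ketf W m (init T []) (zero_ket m)"
    unfolding zero_ket_ketf by (subst X_ketf) auto
  have "fold gate_apply (map (\<lambda>i. Had (C + K * Suc T + i)) [0..<j]) (ketf W m (init T []) (zero_ket m)) =
    (\<lambda>z. r ^ j * (\<Sum>k\<in>bits j. ketf W m (init T k) (zero_ket m) z))" if "j \<le> n" for j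
    using that
  proof (induction j)
    case 0
    then show ?case by (simp add: bits_0)
  next
    case (Suc j)
    have "gate_apply (Had (C + K * Suc T + j)) (ketf W m (init T k) (zero_ket m)) =
      (\<lambda>z. r * (ketf W m (init T (k @ [False])) (zero_ket m) z + ketf W m (init T (k @ [True])) (zero_ket m) z))"
      if "k \<in> bits j" for k
      using that Suc.prems assms C
      by (subst Had_ketf) (auto simp: bits_def init_snoc r_def UNIV_bool init_def)
    then have *: "gate_apply (Had (C + K * Suc T + j)) (\<lambda>z. r ^ j * (\<Sum>k\<in>bits j. ketf W m (init T k) (zero_ket m) z)) =
      (\<lambda>z. r ^ Suc j * (\<Sum>k\<in>bits (Suc j). ketf W m (init T k) (zero_ket m) z))"
      unfolding gate_apply_sum sum_bits_snoc by (simp add: mult_ac flip: sum_distrib_left)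
    have "fold gate_apply (map (\<lambda>i. Had (C + K * Suc T + i)) [0..<Suc j]) (ketf W m (init T []) (zero_ket m)) =
      gate_apply (Had (C + K * Suc T + j)) (fold gate_apply (map (\<lambda>i. Had (C + K * Suc T + i)) [0..<j]) (ketf W m (init T []) (zero_ket m)))"
      by simp
    also have "\<dots> = gate_apply (Had (C + K * Suc T + j)) (\<lambda>z. r ^ j * (\<Sum>k\<in>bits j. ketf W m (init T k) (zero_ket m) z))"
      using Suc by (subst Suc.IH) auto
    finally show ?case unfolding * .
  qed
  with X assms show ?thesis by (simp add: em_gload r_def)
qed

text \<open>By linearity it suffices to follow one key. The garbage may depend on the key in any
  way: \<open>\<xi> k\<close> contains \<open>k\<close> itself at fixed positions, hence
  injectivity.\<close>

theorem gmain_state: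
  assumes K16: "K \<ge> 16" and fl: "5 + flags decode_gate \<le> C" "5 + flags read_header \<le> C" "5 + flags P \<le> C"
    and regs: "\<forall>r\<in>regs P. Suc (2 * r) < K"
    and T: "52 * M + 25 \<le> T" and \<rho>: "\<rho> 0 = C + K * Suc T + n" "\<rho> 1 = n" "\<rho> 2 = T" "\<rho> 3 = m" "\<rho> 4 = W"
    and W: "fr (gmain P) 5 \<rho> \<le> W"
    and P: "\<And>k. k \<in> bits n \<Longrightarrow> \<exists>t s. exec P ((\<lambda>r. [])(0 := k)) t s \<and> s 0 = enc_circuit (U k) \<and> n + t \<le> M"
    and U: "\<And>k. k \<in> bits n \<Longrightarrow> wf_circuit (U k) \<and> width (U k) = m"
  defines "G \<equiv> Circuit (W + m) (em (gmain P) 5 \<rho>)"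
  shows "wf_circuit G" "C + K * Suc T + n \<le> W"
    "\<exists>\<xi>. inj_on \<xi> (bits n) \<and> \<xi> ` bits n \<subseteq> bits W \<and> circuit_state G =
       (\<lambda>z. (1 / complex_of_real (sqrt 2)) ^ n * (\<Sum>k\<in>bits n. if length z = W + m \<and> take W z = \<xi> k then circuit_state (U k) (drop W z) else 0))"
proof -
  have eq: "em (gmain P) 5 \<rho> = em gload 5 \<rho> @ em (grun P) 5 \<rho>" "fr (gmain P) 5 \<rho> = fr (grun P) 5 \<rho>"
    by (simp_all add: gmain_def em_gload)
  have main: "(\<forall>x\<in>set (em (grun P) 5 \<rho>). wf_gate (W + m) x) \<and> C + K * Suc T + n \<le> W \<and>
    (\<exists>f'. fold gate_apply (em (grun P) 5 \<rho>) (ketf W m (init T k) (zero_ket m)) = ketf W m f' (circuit_state (U k)) \<and>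
       (\<forall>i<n. f' (C + K * Suc T + i) = k ! i))" if k: "k \<in> bits n" for k
  proof -
    from P[OF k] obtain t s where ts: "exec P ((\<lambda>r. [])(0 := k)) t s" "s 0 = enc_circuit (U k)" "n + t \<le> M" by blast
    have "length k = n" using k by (simp add: bits_def)
    from grun[OF K16 fl regs T \<rho> W[unfolded eq(2)] this ts] U[OF k]
    show ?thesis by (simp add: circuit_state_def circuit_apply_def)
  qed
  have "replicate n False \<in> bits n" by (simp add: bits_def)
  from main[OF this] have wf: "\<forall>x\<in>set (em (grun P) 5 \<rho>). wf_gate (W + m) x" and W': "C + K * Suc T + n \<le> W" by auto
  from W' show "C + K * Suc T + n \<le> W" .
  show "wf_circuit G" using wf W' C \<rho> by (auto simp: wf_circuit_def G_def eq em_gload)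
  obtain f' where f': "\<And>k. k \<in> bits n \<Longrightarrow> fold gate_apply (em (grun P) 5 \<rho>) (ketf W m (init T k) (zero_ket m)) = ketf W m (f' k) (circuit_state (U k))"
    "\<And>k i. k \<in> bits n \<Longrightarrow> i < n \<Longrightarrow> f' k (C + K * Suc T + i) = k ! i"
    using main by metis
  have "inj_on (\<lambda>k. map (f' k) [0..<W]) (bits n)"
  proof
    fix k k' assume k: "k \<in> bits n" "k' \<in> bits n" and eq: "map (f' k) [0..<W] = map (f' k') [0..<W]"
    have "k ! i = k' ! i" if "i < n" for i
    proof -
      have "C + K * Suc T + i < W" using W' that by simp
      then have "f' k (C + K * Suc T + i) = f' k' (C + K * Suc T + i)" using eq by simp
      then show ?thesis using f'(2) k that by simp
    qed
    then show "k = k'" using k by (intro nth_equalityI) (auto simp: bits_def)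
  qed
  moreover have "ketf W m (f' k) \<Phi> z = (if length z = W + m \<and> take W z = map (f' k) [0..<W] then \<Phi> (drop W z) else 0)" for k \<Phi> z
    by (auto simp: ketf_def list_eq_iff_nth_eq)
  then have "circuit_state G = (\<lambda>z. (1 / complex_of_real (sqrt 2)) ^ n * (\<Sum>k\<in>bits n. if length z = W + m \<and> take W z = map (f' k) [0..<W] then circuit_state (U k) (drop W z) else 0))"
    unfolding circuit_state_def circuit_apply_def G_def circuit.sel eq fold_append o_apply gload_state[OF W' \<rho>(3,2)] gates_apply_sum
    using f'(1) by (simp add: circuit_state_def circuit_apply_def cong: if_cong)
  moreover have "(\<lambda>k. map (f' k) [0..<W]) ` bits n \<subseteq> bits W" by (auto simp: bits_def)
  ultimately show "\<exists>\<xi>. inj_on \<xi> (bits n) \<and> \<xi> ` bits n \<subseteq> bits W \<and> circuit_state G =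
       (\<lambda>z. (1 / complex_of_real (sqrt 2)) ^ n * (\<Sum>k\<in>bits n. if length z = W + m \<and> take W z = \<xi> k then circuit_state (U k) (drop W z) else 0))"
    by blast
qed

end

section \<open>The maximally entangled state, which commits to 1\<close>

definition gbell :: gen where
  "gbell = For 3 (Emit (THad (AExp 0 [5])) ;; Emit (TCNOT (AExp 0 [5]) (AExp 0 [4, 5])))"

lemma CNOT_ketf_data:
  assumes "a < W" "j < m" "length y = m"
  shows "gate_apply (CNOT a (W + j)) (ketf W m f (basis_ket y)) = ketf W m f (basis_ket (y[j := (y ! j \<noteq> f a)]))"
proof (rule kets_eqI[where N = "W + m"])
  fix z :: "bool list" assume z: "length z = W + m"
  have d: "drop W (z[W + j := b]) = (drop W z)[j := b]" for b by (simp add: drop_update_swap)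
  have "(drop W z)[j := (drop W z ! j \<noteq> f a)] = y \<longleftrightarrow> drop W z = y[j := (y ! j \<noteq> f a)]"
    using assms z by (auto simp: list_eq_iff_nth_eq nth_list_update)
  then show "gate_apply (CNOT a (W + j)) (ketf W m f (basis_ket y)) z = ketf W m f (basis_ket (y[j := (y ! j \<noteq> f a)])) z"
    using assms z by (auto simp: gate_apply.simps ketf_def d basis_ket_def)
qed auto

text \<open>A Hadamard gate on wire \<open>i\<close> and a CNOT to its partner make an EPR pair. The
  condition \<open>m \<le> W\<close> gives each data qubit a partner in \<open>R\<close>; the
  remaining wires of \<open>R\<close> stay zero.\<close>

theorem gbell_state:
  assumes "m \<le> W" "\<rho> 3 = m" "\<rho> 4 = W"
  defines "G \<equiv> Circuit (W + m) (em gbell 5 \<rho>)"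
  shows "wf_circuit G" "\<exists>\<xi>. inj_on \<xi> (bits m) \<and> \<xi> ` bits m \<subseteq> bits W \<and> circuit_state G =
       (\<lambda>z. (1 / complex_of_real (sqrt 2)) ^ m * (\<Sum>y\<in>bits m. if length z = W + m \<and> take W z = \<xi> y then basis_ket y (drop W z) else 0))"
proof -
  define r where "r = 1 / complex_of_real (sqrt 2)"
  have em: "em gbell 5 \<rho> = concat (map (\<lambda>i. [Had i, CNOT i (W + i)]) [0..<m])"
    using assms by (simp add: gbell_def forE_id)
  then show "wf_circuit G" using assms by (auto simp: wf_circuit_def G_def)
  define f where "f y w = (w < length y \<and> y ! w)" for y and w :: nat
  have "fold gate_apply (concat (map (\<lambda>i. [Had i, CNOT i (W + i)]) [0..<j])) (zero_ket (W + m)) =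
    (\<lambda>z. r ^ j * (\<Sum>y\<in>bits j. ketf W m (f y) (basis_ket (y @ replicate (m - j) False)) z))" if "j \<le> m" for j
    using that
  proof (induction j)
    case 0
    then show ?case unfolding zero_ket_ketf by (simp add: bits_0 f_def zero_ket_def)
  next
    case (Suc j)
    have fs: "(f y)(j := b) = f (y @ [b])" if "y \<in> bits j" for y b
      using that by (auto simp: f_def bits_def fun_eq_iff nth_append)
    have rep: "replicate (m - j) False = False # replicate (m - Suc j) False" using Suc.prems
      by (metis Suc_diff_Suc Suc_le_lessD replicate_Suc)
    have C: "gate_apply (CNOT j (W + j)) (ketf W m (f (y @ [b])) (basis_ket (y @ replicate (m - j) False))) =
        ketf W m (f (y @ [b])) (basis_ket ((y @ [b]) @ replicate (m - Suc j) False))" if "y \<in> bits j" for y b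
      using that Suc.prems assms(1) by (subst CNOT_ketf_data) (auto simp: bits_def f_def rep list_update_append nth_append)
    have "gate_apply (CNOT j (W + j)) (gate_apply (Had j) (ketf W m (f y) (basis_ket (y @ replicate (m - j) False)))) =
      (\<lambda>z. r * (ketf W m (f (y @ [False])) (basis_ket ((y @ [False]) @ replicate (m - Suc j) False)) z + 
        ketf W m (f (y @ [True])) (basis_ket ((y @ [True]) @ replicate (m - Suc j) False)) z))" if y: "y \<in> bits j" for y
    proof -
      have "gate_apply (Had j) (ketf W m (f y) (basis_ket (y @ replicate (m - j) False))) =
        (\<lambda>z. r * (\<Sum>b\<in>UNIV. ketf W m (f (y @ [b])) (basis_ket (y @ replicate (m - j) False)) z))"
        using y Suc.prems assms(1) by (subst Had_ketf) (auto simp: fs r_def f_def bits_def)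
      then show ?thesis unfolding \<open>gate_apply (Had j) _ = _\<close> gate_apply_sum C[OF y] by (simp add: UNIV_bool)
    qed
    then have *: "gate_apply (CNOT j (W + j)) (gate_apply (Had j) (\<lambda>z. r ^ j * (\<Sum>y\<in>bits j. ketf W m (f y) (basis_ket (y @ replicate (m - j) False)) z))) =
      (\<lambda>z. r ^ Suc j * (\<Sum>y\<in>bits (Suc j). ketf W m (f y) (basis_ket (y @ replicate (m - Suc j) False)) z))"
      unfolding gate_apply_sum sum_bits_snoc by (simp add: mult_ac flip: sum_distrib_left)
    have "fold gate_apply (concat (map (\<lambda>i. [Had i, CNOT i (W + i)]) [0..<Suc j])) (zero_ket (W + m)) =
      gate_apply (CNOT j (W + j)) (gate_apply (Had j) (fold gate_apply (concat (map (\<lambda>i. [Had i, CNOT i (W + i)]) [0..<j])) (zero_ket (W + m))))"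
      by simp
    also have "\<dots> = gate_apply (CNOT j (W + j)) (gate_apply (Had j) (\<lambda>z. r ^ j * (\<Sum>y\<in>bits j. ketf W m (f y) (basis_ket (y @ replicate (m - j) False)) z)))"
      using Suc by (subst Suc.IH) auto
    finally show ?case unfolding * .
  qed
  from this[of m] have "circuit_state G = (\<lambda>z. r ^ m * (\<Sum>y\<in>bits m. ketf W m (f y) (basis_ket y) z))"
    by (simp add: circuit_state_def circuit_apply_def G_def em)
  moreover have "ketf W m g \<Phi> z = (if length z = W + m \<and> take W z = map g [0..<W] then \<Phi> (drop W z) else 0)" for g \<Phi> z
    by (auto simp: ketf_def list_eq_iff_nth_eq)
  moreover have "inj_on (\<lambda>y. map (f y) [0..<W]) (bits m)"
  proof
    fix k k' assume k: "k \<in> bits m" "k' \<in> bits m" and eq: "map (f k) [0..<W] = map (f k') [0..<W]"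
    have "k ! i = k' ! i" if "i < m" for i
    proof -
      have "f k i = f k' i" using eq that assms(1) by simp
      then show ?thesis using k that by (simp add: f_def bits_def)
    qed
    then show "k = k'" using k by (intro nth_equalityI) (auto simp: bits_def)
  qed
  moreover have "(\<lambda>y. map (f y) [0..<W]) ` bits m \<subseteq> bits W" by (auto simp: bits_def)
  ultimately show "\<exists>\<xi>. inj_on \<xi> (bits m) \<and> \<xi> ` bits m \<subseteq> bits W \<and> circuit_state G =
       (\<lambda>z. (1 / complex_of_real (sqrt 2)) ^ m * (\<Sum>y\<in>bits m. if length z = W + m \<and> take W z = \<xi> y then basis_ket y (drop W z) else 0))"
    by (intro exI[of _ "\<lambda>y. map (f y) [0..<W]"]) (simp add: r_def)
qed

subsection \<open>Generators as programs\<close>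

lemma poly_mono_nat: "x \<le> y \<Longrightarrow> poly p x \<le> poly p y" for p :: "nat poly"
proof (induction p)
  case (pCons a p)
  then have "x * poly p x \<le> y * poly p y" by (intro mult_mono) auto
  then show ?case by simp
qed simp

text \<open>Variable 0 grows while a loop runs. A loop bounded by it could double it in every round
  of an outer loop, so such bounds are excluded to keep the output polynomial.\<close>

primrec gwf :: "gen \<Rightarrow> bool" where
  "gwf Nop = True"
| "gwf (Emit t) = True"
| "gwf Fresh = True"
| "gwf (g ;; h) = (gwf g \<and> gwf h)"
| "gwf (For b g) = (b \<noteq> 0 \<and> gwf g)"

lemma forF_bound:
  assumes "\<And>i F. i < N \<Longrightarrow> h i F \<le> F + (a :: nat)"
  shows "i + c \<le> N \<Longrightarrow> forF h c i F \<le> F + c * a"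
proof (induction c arbitrary: i F)
  case (Suc c)
  have "forF h (Suc c) i F \<le> h i F + c * a" using Suc by simp
  also have "h i F \<le> F + a" using Suc.prems by (intro assms) simp
  finally show ?case by simp
qed simp

text \<open>The growth must not depend on variable 0 itself: an additive bound sums up over the
  rounds of a loop, whereas a factor would be raised to a power.\<close>

lemma fr_bound:
  assumes "gwf g"
  shows "\<exists>q :: nat poly. \<forall>d \<rho> N. 0 < d \<longrightarrow> (\<forall>v. v \<noteq> 0 \<longrightarrow> \<rho> v \<le> N) \<longrightarrow> fr g d \<rho> \<le> \<rho> 0 + poly q N"
  using assms
proof (induction g)
  case Fresh
  show ?case by (rule exI[of _ "[:1:]"]) simp
next
  case (Then g h)
  then have "gwf g" "gwf h" by auto
  from Then.IH(1)[OF this(1)] Then.IH(2)[OF this(2)] obtain p q :: "nat poly" where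
    p: "\<forall>d \<rho> N. 0 < d \<longrightarrow> (\<forall>v. v \<noteq> 0 \<longrightarrow> \<rho> v \<le> N) \<longrightarrow> fr g d \<rho> \<le> \<rho> 0 + poly p N" and
    q: "\<forall>d \<rho> N. 0 < d \<longrightarrow> (\<forall>v. v \<noteq> 0 \<longrightarrow> \<rho> v \<le> N) \<longrightarrow> fr h d \<rho> \<le> \<rho> 0 + poly q N" by blast
  have "fr (g ;; h) d \<rho> \<le> \<rho> 0 + poly (p + q) N" if "0 < d" "\<forall>v. v \<noteq> 0 \<longrightarrow> \<rho> v \<le> N" for d \<rho> N
  proof -
    have "fr h d (\<rho>(0 := fr g d \<rho>)) \<le> fr g d \<rho> + poly q N" using q[rule_format, of d "\<rho>(0 := fr g d \<rho>)" N] that by simp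
    also have "fr g d \<rho> \<le> \<rho> 0 + poly p N" using p that by simp
    finally show ?thesis by simp
  qed
  then show ?case by blast
next
  case (For b g)
  then have b: "b \<noteq> 0" and g: "gwf g" by auto
  from For.IH[OF g] obtain q :: "nat poly" where
    q: "\<forall>d \<rho> N. 0 < d \<longrightarrow> (\<forall>v. v \<noteq> 0 \<longrightarrow> \<rho> v \<le> N) \<longrightarrow> fr g d \<rho> \<le> \<rho> 0 + poly q N" by blast
  have "fr (For b g) d \<rho> \<le> \<rho> 0 + poly (pCons 0 q) N" if "0 < d" "\<forall>v. v \<noteq> 0 \<longrightarrow> \<rho> v \<le> N" for d \<rho> N
  proof -
    have "fr (For b g) d \<rho> \<le> \<rho> 0 + \<rho> b * poly q N"
      unfolding fr.simps
    proof (rule forF_bound[where N = "\<rho> b"])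
      fix i F assume "i < \<rho> b"
      then have "i \<le> N" using that(2) b by (meson less_imp_le less_le_trans)
      then show "fr g (Suc d) (\<rho>(0 := F, d := i)) \<le> F + poly q N"
        using q[rule_format, of "Suc d" "\<rho>(0 := F, d := i)" N] that by simp
    qed simp
    also have "\<rho> b * poly q N \<le> N * poly q N" using that(2) b by simp
    finally show ?thesis by simp
  qed
  then show ?case by blast
qed (auto intro: exI[of _ 0])

section \<open>Programs that print a generated circuit\<close>

definition copy :: "nat \<Rightarrow> nat \<Rightarrow> nat \<Rightarrow> program" where
  "copy t v r = Seq (Loop (Nonempty v) (Seq (Pop v) (Seq (Push t True) (Push r True))))
                    (Loop (Nonempty t) (Seq (Pop t) (Push v True)))"

lemma runs_move:
  assumes "v \<noteq> r" "s v = replicate a True"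
  shows "runs (Loop (Nonempty v) (Seq (Pop v) (Push r True))) s (s(v := [], r := replicate a True @ s r)) (3 * a + 1)"
  using assms(2)
proof (induction a arbitrary: s)
  case 0
  then show ?case by (intro runs_weaken[OF runs_Loop(2)]) (auto simp: fun_eq_iff)
next
  case (Suc a)
  let ?s = "s(v := replicate a True, r := True # s r)"
  have 1: "runs (Seq (Pop v) (Push r True)) s ?s (1 + 1)"
    using Suc.prems assms(1) by (intro runs_weaken[OF runs_Seq[OF runs_basic(3) runs_basic(2)]]) (auto simp: fun_eq_iff)
  have 2: "runs (Loop (Nonempty v) (Seq (Pop v) (Push r True))) ?s (?s(v := [], r := replicate a True @ ?s r)) (3 * a + 1)"
    using assms(1) by (intro Suc.IH) simp
  have "holds (Nonempty v) s" using Suc.prems by simp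
  from runs_Loop(1)[OF this 1 2] show ?case
    using assms(1) by (elim runs_weaken) (auto simp: fun_eq_iff replicate_app_Cons_same)
qed

lemma runs_move2:
  assumes "v \<noteq> r" "v \<noteq> t" "r \<noteq> t" "s v = replicate a True"
  shows "runs (Loop (Nonempty v) (Seq (Pop v) (Seq (Push t True) (Push r True)))) s
    (s(v := [], t := replicate a True @ s t, r := replicate a True @ s r)) (4 * a + 1)"
  using assms(4)
proof (induction a arbitrary: s)
  case 0
  then show ?case by (intro runs_weaken[OF runs_Loop(2)]) (auto simp: fun_eq_iff)
next
  case (Suc a)
  let ?s = "s(v := replicate a True, t := True # s t, r := True # s r)"
  have 1: "runs (Seq (Pop v) (Seq (Push t True) (Push r True))) s ?s (1 + (1 + 1))"
    using Suc.prems assms(1-3) by (intro runs_weaken[OF runs_Seq[OF runs_basic(3) runs_Seq[OF runs_basic(2) runs_basic(2)]]]) (auto simp: fun_eq_iff)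
  have 2: "runs (Loop (Nonempty v) (Seq (Pop v) (Seq (Push t True) (Push r True)))) ?s
      (?s(v := [], t := replicate a True @ ?s t, r := replicate a True @ ?s r)) (4 * a + 1)"
    using assms(1-3) by (intro Suc.IH) simp
  have "holds (Nonempty v) s" using Suc.prems by simp
  from runs_Loop(1)[OF this 1 2] show ?case
    using assms(1-3) by (elim runs_weaken) (auto simp: fun_eq_iff replicate_app_Cons_same)
qed

text \<open>Reading a register consumes it, so the value is moved to the target and to a scratch
  register at once and then moved back.\<close>

lemma runs_copy:
  assumes "v \<noteq> r" "v \<noteq> t" "r \<noteq> t" "s v = replicate a True" "s t = []"
  shows "runs (copy t v r) s (s(r := replicate a True @ s r)) (7 * a + 2)"
proof -
  let ?s = "s(v := [], t := replicate a True @ s t, r := replicate a True @ s r)"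
  have "runs (Loop (Nonempty t) (Seq (Pop t) (Push v True))) ?s (?s(t := [], v := replicate a True @ ?s v)) (3 * a + 1)"
    using assms by (intro runs_move) auto
  from runs_Seq[OF runs_move2[where s = s, OF assms(1-4)] this] show ?thesis unfolding copy_def
    using assms by (elim runs_weaken) (auto simp: fun_eq_iff)
qed

primrec pushes :: "nat \<Rightarrow> bool list \<Rightarrow> program" where
  "pushes r [] = Skip"
| "pushes r (b # bs) = Seq (Push r b) (pushes r bs)"

lemma runs_pushes: "runs (pushes r bs) s (s(r := rev bs @ s r)) (length bs + 1)"
proof (induction bs arbitrary: s)
  case Nil
  show ?case by (simp add: runs_weaken[OF runs_basic(1)] fun_upd_idem)
next
  case (Cons b bs)
  show ?case unfolding pushes.simps
    by (rule runs_weaken[OF runs_Seq[OF runs_basic(2) Cons.IH]]) (auto simp: fun_eq_iff)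
qed

text \<open>Register \<open>B\<close> holds the reversed output; each variable has a register for its value and one for counting the rounds of its loop.\<close>

locale registers =
  fixes B :: nat
begin

definition out where "out = B"
definition tmp where "tmp = B + 1"
definition reg where "reg v = B + 2 + 2 * v" for v :: nat
definition cnt where "cnt v = B + 3 + 2 * v" for v :: nat

lemma distinct_regs [simp]:
  "out \<noteq> tmp" "tmp \<noteq> out" "out \<noteq> reg v" "reg v \<noteq> out" "out \<noteq> cnt v" "cnt v \<noteq> out" 
  "tmp \<noteq> reg v" "reg v \<noteq> tmp" "tmp \<noteq> cnt v" "cnt v \<noteq> tmp" "reg v \<noteq> cnt w" "cnt w \<noteq> reg v"
  "reg v = reg v' \<longleftrightarrow> v = v'" "cnt v = cnt v' \<longleftrightarrow> v = v'"
  unfolding out_def tmp_def reg_def cnt_def by presburger+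

primrec put_nat :: "aexp \<Rightarrow> program" where
  "put_nat (AExp c vs) = Seq (pushes out (replicate c True)) (foldr (\<lambda>v P. Seq (copy tmp (reg v) out) P) vs (Push out False))"

primrec put :: "tmpl \<Rightarrow> program" where
  "put (THad a) = Seq (pushes out [False, False]) (put_nat a)"
| "put (TT a) = Seq (pushes out [False, True]) (put_nat a)"
| "put (TCNOT a b) = Seq (pushes out [True, False]) (Seq (put_nat a) (put_nat b))"
| "put (TToffoli a b c) = Seq (pushes out [True, True]) (Seq (put_nat a) (Seq (put_nat b) (put_nat c)))"

text \<open>A loop counts down a copy of its bound in \<open>cnt d\<close>, as the body may read the
  bound itself, and counts up in \<open>reg d\<close>, as the body reads the number of the
  round.\<close>

primrec gprog :: "nat \<Rightarrow> gen \<Rightarrow> program" where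
  "gprog d Nop = Skip"
| "gprog d (Emit t) = put t"
| "gprog d Fresh = Push (reg 0) True"
| "gprog d (g ;; h) = Seq (gprog d g) (gprog d h)"
| "gprog d (For b g) = Seq (copy tmp (reg b) (cnt d))
     (Seq (Loop (Nonempty (cnt d)) (Seq (gprog (Suc d) g) (Seq (Pop (cnt d)) (Push (reg d) True)))) (clear_reg (reg d)))"

text \<open>Variables from \<open>d\<close> on are zero, so a loop at depth \<open>d\<close> finds
  its variable initialised and only has to increment it.\<close>

definition repr :: "nat \<Rightarrow> env \<Rightarrow> store \<Rightarrow> bool" where
  "repr d \<rho> s \<longleftrightarrow> s tmp = [] \<and> (\<forall>v. s (reg v) = replicate (\<rho> v) True) \<and> (\<forall>v\<ge>d. s (cnt v) = [] \<and> \<rho> v = 0)"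

definition after :: "store \<Rightarrow> nat \<Rightarrow> gate list \<Rightarrow> store" where
  "after s F gs = s(reg 0 := replicate F True, out := rev (concat (map enc_gate gs)) @ s out)"

primrec asize :: "aexp \<Rightarrow> nat" where
  "asize (AExp c vs) = c + length vs + 2"

primrec tsize :: "tmpl \<Rightarrow> nat" where
  "tsize (THad a) = asize a + 3"
| "tsize (TT a) = asize a + 3"
| "tsize (TCNOT a b) = asize a + asize b + 3"
| "tsize (TToffoli a b c) = asize a + asize b + asize c + 3"

lemma rev_enc_nat: "rev (enc_nat q) = False # replicate q True"
  by (simp add: enc_nat_def)

lemma repr_out: "repr d \<rho> (s(out := x)) = repr d \<rho> s"
  by (simp add: repr_def)

lemma runs_put_nat:
  assumes "repr d \<rho> s" "\<And>v. \<rho> v \<le> N"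
  shows "runs (put_nat a) s (s(out := rev (enc_nat (aval \<rho> a)) @ s out)) (asize a * (7 * N + 3))"
proof (cases a)
  case (AExp c vs)
  have "runs (foldr (\<lambda>v P. Seq (copy tmp (reg v) out) P) vs (Push out False)) s
    (s(out := False # replicate (\<Sum>v\<leftarrow>vs. \<rho> v) True @ s out)) (length vs * (7 * N + 3) + 1)"
    if "repr d \<rho> s" for s
    using that
  proof (induction vs arbitrary: s)
    case Nil
    show ?case unfolding foldr.simps id_apply by (rule runs_weaken[OF runs_basic(2)]) auto
  next
    case (Cons v vs)
    let ?s = "s(out := replicate (\<rho> v) True @ s out)"
    have "runs (copy tmp (reg v) out) s ?s (7 * \<rho> v + 2)"
      using Cons.prems by (intro runs_copy) (auto simp: repr_def)
    moreover have "runs (foldr (\<lambda>v P. Seq (copy tmp (reg v) out) P) vs (Push out False)) ?s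
      (?s(out := False # replicate (\<Sum>v\<leftarrow>vs. \<rho> v) True @ ?s out)) (length vs * (7 * N + 3) + 1)"
      using Cons.prems by (intro Cons.IH) (simp only: repr_out)
    ultimately show ?case unfolding foldr.simps o_apply
      using assms(2)[of v] by (intro runs_weaken[OF runs_Seq]) (auto simp: fun_eq_iff replicate_add[symmetric] append_assoc[symmetric] add.commute simp del: append_assoc)
  qed
  from runs_Seq[OF runs_pushes[of out "replicate c True" s] this, unfolded repr_out, OF assms(1)]
  show ?thesis unfolding AExp put_nat.simps
    by (elim runs_weaken) (auto simp: rev_enc_nat replicate_add[symmetric] append_assoc[symmetric] add.commute simp del: append_assoc, simp add: algebra_simps)
qed

lemma runs_put:
  assumes "repr d \<rho> s" "\<And>v. \<rho> v \<le> N"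
  shows "runs (put t) s (s(out := rev (enc_gate (inst \<rho> t)) @ s out)) (tsize t * (7 * N + 3))"
proof -
  have p: "runs (put_nat a) (s(out := x)) (s(out := rev (enc_nat (aval \<rho> a)) @ x)) (asize a * (7 * N + 3))" for a x
    using runs_put_nat[of d \<rho> "s(out := x)" N a] assms by (simp add: repr_out)
  have b: "runs (pushes out [b, b']) s (s(out := b' # b # s out)) 3" for b b'
    using runs_pushes[of out "[b, b']" s] by (simp add: eval_nat_numeral)
  show ?thesis
  proof (cases t)
    case (THad a)
    show ?thesis unfolding THad put.simps by (rule runs_weaken[OF runs_Seq[OF b p]]) (auto simp: algebra_simps)
  next
    case (TT a)
    show ?thesis unfolding TT put.simps by (rule runs_weaken[OF runs_Seq[OF b p]]) (auto simp: algebra_simps)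
  next
    case (TCNOT a b')
    show ?thesis unfolding TCNOT put.simps by (rule runs_weaken[OF runs_Seq[OF b runs_Seq[OF p p]]]) (auto simp: algebra_simps)
  next
    case (TToffoli a b' c)
    show ?thesis unfolding TToffoli put.simps by (rule runs_weaken[OF runs_Seq[OF b runs_Seq[OF p runs_Seq[OF p p]]]]) (auto simp: algebra_simps)
  qed
qed

lemma repr_after: "repr d \<rho> s \<Longrightarrow> 0 < d \<Longrightarrow> repr d (\<rho>(0 := F)) (after s F gs)"
  by (auto simp: repr_def after_def)

lemma after_after: "after (after s F gs) F' hs = after s F' (gs @ hs)"
  by (simp add: after_def fun_upd_twist fun_eq_iff)

text \<open>The polynomial depends on the generator alone. The second part of a sequence starts with
  a larger variable 0, whose growth \<open>fr_bound\<close> controls; this explains the composition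
  of polynomials.\<close>

theorem runs_gprog:
  assumes "gwf g"
  shows "\<exists>q :: nat poly. \<forall>d \<rho> s N. 0 < d \<longrightarrow> repr d \<rho> s \<longrightarrow> (\<forall>v. \<rho> v \<le> N) \<longrightarrow>
    runs (gprog d g) s (after s (fr g d \<rho>) (em g d \<rho>)) (poly q N)"
  using assms
proof (induction g)
  case Nop
  have "runs Skip s (after s (\<rho> 0) []) (poly [:1:] N)" if "repr d \<rho> s" for d \<rho> s N
    using that by (intro runs_weaken[OF runs_basic(1)]) (auto simp: after_def repr_def fun_eq_iff)
  then show ?case unfolding gprog.simps fr.simps em.simps by blast
next
  case (Emit t)
  have "runs (put t) s (after s (\<rho> 0) [inst \<rho> t]) (poly [:3 * tsize t, 7 * tsize t:] N)"
    if "repr d \<rho> s" "\<forall>v. \<rho> v \<le> N" for d \<rho> s N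
    using that by (intro runs_weaken[OF runs_put]) (auto simp: after_def repr_def fun_eq_iff algebra_simps)
  then show ?case unfolding gprog.simps fr.simps em.simps by blast
next
  case Fresh
  have "runs (Push (reg 0) True) s (after s (Suc (\<rho> 0)) []) (poly [:1:] N)" if "repr d \<rho> s" for d \<rho> s N
    using that by (intro runs_weaken[OF runs_basic(2)]) (auto simp: after_def repr_def fun_eq_iff)
  then show ?case unfolding gprog.simps fr.simps em.simps by blast
next
  case (Then g h)
  then have gh: "gwf g" "gwf h" by auto
  from Then.IH(1)[OF gh(1)] obtain p :: "nat poly" where 
    p: "\<And>d \<rho> s N. 0 < d \<Longrightarrow> repr d \<rho> s \<Longrightarrow> \<forall>v. \<rho> v \<le> N \<Longrightarrow> runs (gprog d g) s (after s (fr g d \<rho>) (em g d \<rho>)) (poly p N)" by blast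
  from Then.IH(2)[OF gh(2)] obtain q :: "nat poly" where 
    q: "\<And>d \<rho> s N. 0 < d \<Longrightarrow> repr d \<rho> s \<Longrightarrow> \<forall>v. \<rho> v \<le> N \<Longrightarrow> runs (gprog d h) s (after s (fr h d \<rho>) (em h d \<rho>)) (poly q N)" by blast
  obtain e :: "nat poly" where e: "\<And>d \<rho> N. 0 < d \<Longrightarrow> \<forall>v. v \<noteq> 0 \<longrightarrow> \<rho> v \<le> N \<Longrightarrow> fr g d \<rho> \<le> \<rho> 0 + poly e N"
    using fr_bound[OF gh(1)] by blast
  have "runs (gprog d (g ;; h)) s (after s (fr (g ;; h) d \<rho>) (em (g ;; h) d \<rho>)) (poly (p + q \<circ>\<^sub>p ([:0, 1:] + e)) N)"
    if "0 < d" "repr d \<rho> s" "\<forall>v. \<rho> v \<le> N" for d \<rho> s N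
  proof -
    let ?\<rho> = "\<rho>(0 := fr g d \<rho>)" and ?s = "after s (fr g d \<rho>) (em g d \<rho>)"
    have "fr g d \<rho> \<le> \<rho> 0 + poly e N" using e that by simp
    then have "fr g d \<rho> \<le> N + poly e N" using that(3) by (meson add_le_mono1 le_trans)
    then have "\<forall>v. ?\<rho> v \<le> N + poly e N" using that(3) by (auto intro: trans_le_add1)
    then have "runs (gprog d h) ?s (after ?s (fr h d ?\<rho>) (em h d ?\<rho>)) (poly q (N + poly e N))"
      using q that repr_after by blast
    from runs_Seq[OF p[OF that] this] show ?thesis by (simp add: after_after poly_pcompose)
  qed
  then show ?case by blast
next
  case (For b g)
  then have b: "b \<noteq> 0" and g: "gwf g" by auto
  from For.IH[OF g] obtain p :: "nat poly" where 
    p: "\<And>d \<rho> s N. 0 < d \<Longrightarrow> repr d \<rho> s \<Longrightarrow> \<forall>v. \<rho> v \<le> N \<Longrightarrow> runs (gprog d g) s (after s (fr g d \<rho>) (em g d \<rho>)) (poly p N)" by blast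
  obtain e :: "nat poly" where e: "\<And>d \<rho> N. 0 < d \<Longrightarrow> \<forall>v. v \<noteq> 0 \<longrightarrow> \<rho> v \<le> N \<Longrightarrow> fr g d \<rho> \<le> \<rho> 0 + poly e N"
    using fr_bound[OF g] by blast
  \<comment> \<open>The summands are the times for copying the bound, for at most \<open>N\<close>
    rounds of the body with three extra steps each, for the last test and for clearing the loop
    variable. Variable 0 stays below \<open>N\<close> plus \<open>N\<close> times the growth of one
    round.\<close>
  define r where "r = [:0, 7:] + [:2:] + [:0, 1:] * (p \<circ>\<^sub>p ([:0, 1:] + [:0, 1:] * e) + [:3:]) + [:1:] + [:1, 2:]"
  have "runs (gprog d (For b g)) s (after s (fr (For b g) d \<rho>) (em (For b g) d \<rho>)) (poly r N)"
    if d: "0 < d" and s: "repr d \<rho> s" and N: "\<forall>v. \<rho> v \<le> N" for d \<rho> s N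
  proof -
    define h where "h = (\<lambda>i F. fr g (Suc d) (\<rho>(0 := F, d := i)))"
    define e' where "e' = (\<lambda>i F. em g (Suc d) (\<rho>(0 := F, d := i)))"
    define N' where "N' = N + N * poly e N"
    let ?P = "Loop (Nonempty (cnt d)) (Seq (gprog (Suc d) g) (Seq (Pop (cnt d)) (Push (reg d) True)))"
    have h: "h i F \<le> F + poly e N" if "i < N" for i F
      using e[of "Suc d" "\<rho>(0 := F, d := i)" N] that N d by (simp add: h_def)
    have loop: "runs ?P s' ((after s' (forF h c i F) (forE h e' c i F))(cnt d := [], reg d := replicate (i + c) True)) (c * (poly p N' + 3) + 1)"
      if "repr (Suc d) (\<rho>(0 := F, d := i)) (s'(cnt d := []))" "s' (cnt d) = replicate c True" "i + c \<le> N" "F \<le> N + i * poly e N" for s' c i F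
      using that
    proof (induction c arbitrary: s' i F)
      case 0
      have "s' (reg 0) = replicate F True" "s' (reg d) = replicate i True"
        using 0(1) d unfolding repr_def by (metis distinct_regs(12) fun_upd_apply less_numeral_extra(3))+
      then show ?case using 0 d
        by (intro runs_weaken[OF runs_Loop(2)]) (auto simp: after_def fun_eq_iff)
    next
      case (Suc c)
      let ?\<rho> = "\<rho>(0 := F, d := i)"
      let ?s1 = "after s' (h i F) (e' i F)"
      let ?s2 = "?s1(cnt d := replicate c True, reg d := replicate (Suc i) True)"
      have rs: "repr (Suc d) ?\<rho> s'" using Suc.prems(1) unfolding repr_def by auto
      have read_nat: "s' (reg d) = replicate i True" using rs by (auto simp: repr_def)
      have "i * poly e N \<le> N * poly e N" using Suc.prems by (intro mult_right_mono) auto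
      then have "F \<le> N + N * poly e N" using Suc.prems(4) by linarith
      then have "\<forall>v. ?\<rho> v \<le> N'" using Suc.prems N by (auto simp: N'_def intro: trans_le_add1)
      then have 1: "runs (gprog (Suc d) g) s' ?s1 (poly p N')"
        using p[of "Suc d" ?\<rho> s' N'] rs by (simp add: h_def e'_def)
      have 2: "runs (Seq (gprog (Suc d) g) (Seq (Pop (cnt d)) (Push (reg d) True))) s' ?s2 (poly p N' + (1 + 1))"
        using Suc.prems(2) read_nat d
        by (intro runs_weaken[OF runs_Seq[OF 1 runs_Seq[OF runs_basic(3) runs_basic(2)]]]) (auto simp: after_def fun_eq_iff)
      have "h i F \<le> F + poly e N" using Suc.prems by (intro h) simp
      then have hF: "h i F \<le> N + Suc i * poly e N" using Suc.prems by simp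
      have "repr (Suc d) (\<rho>(0 := h i F, d := Suc i)) (?s2(cnt d := []))"
        using rs Suc.prems(1) d by (auto simp: repr_def after_def)
      then have "runs ?P ?s2 ((after ?s2 (forF h c (Suc i) (h i F)) (forE h e' c (Suc i) (h i F)))(cnt d := [], reg d := replicate (Suc i + c) True)) (c * (poly p N' + 3) + 1)"
        by (rule Suc.IH) (use Suc.prems hF in \<open>simp_all only: fun_upd_apply\<close>, use Suc.prems in \<open>simp_all\<close>)
      moreover have "holds (Nonempty (cnt d)) s'" using Suc.prems by simp
      ultimately have "runs ?P s' ((after ?s2 (forF h c (Suc i) (h i F)) (forE h e' c (Suc i) (h i F)))(cnt d := [], reg d := replicate (Suc i + c) True)) (poly p N' + (1 + 1) + (c * (poly p N' + 3) + 1) + 1)"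
        using 2 runs_Loop(1) by blast
      then show ?case using d
        by (elim runs_weaken) (auto simp: after_def fun_eq_iff)
    qed
    let ?s1 = "s(cnt d := replicate (\<rho> b) True)"
    have c1: "runs (copy tmp (reg b) (cnt d)) s ?s1 (7 * \<rho> b + 2)"
      using s runs_copy[of "reg b" "cnt d" tmp s "\<rho> b"] by (simp add: repr_def)
    have "repr (Suc d) (\<rho>(0 := \<rho> 0, d := 0)) (?s1(cnt d := []))"
      using s by (auto simp: repr_def)
    then have c2: "runs ?P ?s1 ((after ?s1 (forF h (\<rho> b) 0 (\<rho> 0)) (forE h e' (\<rho> b) 0 (\<rho> 0)))(cnt d := [], reg d := replicate (0 + \<rho> b) True)) (\<rho> b * (poly p N' + 3) + 1)"
      using N by (intro loop) auto
    have le: "\<rho> b * (12 + poly p N') \<le> N * (12 + poly p N')" using N by (intro mult_right_mono) auto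
    have e1: "fr (For b g) d \<rho> = forF h (\<rho> b) 0 (\<rho> 0)" "em (For b g) d \<rho> = forE h e' (\<rho> b) 0 (\<rho> 0)"
      by (simp_all add: h_def e'_def)
    show ?thesis unfolding gprog.simps e1
    proof (rule runs_weaken[OF runs_Seq[OF c1 runs_Seq[OF c2 runs_clear_reg]]])
      show "7 * \<rho> b + 2 + (\<rho> b * (poly p N' + 3) + 1 + (2 * length (((after ?s1 (forF h (\<rho> b) 0 (\<rho> 0)) (forE h e' (\<rho> b) 0 (\<rho> 0)))(cnt d := [], reg d := replicate (0 + \<rho> b) True)) (reg d)) + 1)) \<le> poly r N"
        using le by (simp add: r_def poly_pcompose N'_def algebra_simps)
      show "((after ?s1 (forF h (\<rho> b) 0 (\<rho> 0)) (forE h e' (\<rho> b) 0 (\<rho> 0)))(cnt d := [], reg d := replicate (0 + \<rho> b) True))(reg d := []) =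
        after s (forF h (\<rho> b) 0 (\<rho> 0)) (forE h e' (\<rho> b) 0 (\<rho> 0))"
        using s d by (auto simp: after_def fun_eq_iff repr_def)
    qed
  qed
  then show ?case by blast
qed

end

text \<open>Lets the program for the keyed circuit run beside the registers of the printing program,
  which are numbered from \<open>B\<close> on.\<close>

lemma exec_frame:
  assumes "exec P s k s'" "regs P \<subseteq> {..<B}"
  shows "exec P (\<lambda>r. if r < B then s r else g r) k (\<lambda>r. if r < B then s' r else g r)"
proof -
  have h: "holds t (\<lambda>r. if r < B then s r else g r) = holds t s"
    if "(case t of Nonempty r \<Rightarrow> r | Head_True r \<Rightarrow> r) < B" for t s
    using that by (cases t) auto
  from assms show ?thesis
  proof (induction rule: exec.induct)
    case (Push r b s)
    have "(\<lambda>x. if x < B then s x else g x)(r := b # (if r < B then s r else g r)) = (\<lambda>x. if x < B then (s(r := b # s r)) x else g x)"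
      using Push by (auto simp: fun_eq_iff)
    then show ?case using exec.Push[of r b "\<lambda>x. if x < B then s x else g x"] by simp
  next
    case (Pop r s)
    have "(\<lambda>x. if x < B then s x else g x)(r := tl (if r < B then s r else g r)) = (\<lambda>x. if x < B then (s(r := tl (s r))) x else g x)"
      using Pop by (auto simp: fun_eq_iff)
    then show ?case using exec.Pop[of r "\<lambda>x. if x < B then s x else g x"] by simp
  qed (auto intro: exec.intros[simplified] simp: h)
qed

section \<open>Store transitions in polynomial time\<close>

lemma poly_bounded_const: "poly_bounded (\<lambda>n. c)"
  unfolding poly_bounded_def by (rule exI[of _ "[:c:]"]) simp

lemma poly_bounded_id: "poly_bounded (\<lambda>n. n)"
  unfolding poly_bounded_def by (rule exI[of _ "[:0, 1:]"]) simp

lemma poly_bounded_add: "poly_bounded f \<Longrightarrow> poly_bounded g \<Longrightarrow> poly_bounded (\<lambda>n. f n + g n)"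
  unfolding poly_bounded_def by (metis add_mono poly_add)

lemma poly_bounded_mult: "poly_bounded f \<Longrightarrow> poly_bounded g \<Longrightarrow> poly_bounded (\<lambda>n. f n * g n)"
  unfolding poly_bounded_def by (metis mult_le_mono poly_mult)

lemma poly_bounded_poly: "poly_bounded f \<Longrightarrow> poly_bounded (\<lambda>n. poly q (f n))"
  unfolding poly_bounded_def by (metis poly_mono_nat poly_pcompose)

lemma poly_bounded_mono: "poly_bounded g \<Longrightarrow> (\<And>n. f n \<le> g n) \<Longrightarrow> poly_bounded f"
  unfolding poly_bounded_def by (meson le_trans)

definition ptrans :: "program \<Rightarrow> (nat \<Rightarrow> store) \<Rightarrow> (nat \<Rightarrow> store) \<Rightarrow> bool" where
  "ptrans P s s' \<longleftrightarrow> (\<exists>h. poly_bounded h \<and> (\<forall>n. runs P (s n) (s' n) (h n)))"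

lemma ptransI: "(\<And>n. runs P (s n) (s' n) (h n)) \<Longrightarrow> poly_bounded h \<Longrightarrow> ptrans P s s'"
  by (auto simp: ptrans_def)

lemma ptrans_Seq:
  assumes "ptrans P s s1" "ptrans Q s1 s2"
  shows "ptrans (Seq P Q) s s2"
proof -
  from assms obtain h h' where "poly_bounded h" "\<And>n. runs P (s n) (s1 n) (h n)" "poly_bounded h'" "\<And>n. runs Q (s1 n) (s2 n) (h' n)"
    unfolding ptrans_def by blast
  then show ?thesis by (intro ptransI[where h = "\<lambda>n. h n + h' n"] poly_bounded_add runs_Seq)
qed

lemma poly_time_familyI:
  assumes "ptrans P (\<lambda>n. (\<lambda>r. [])(0 := replicate n True)) s" "\<And>n. s n 0 = g n"
  shows "poly_time_family g"
proof -
  from assms(1) obtain h p where h: "\<And>n. runs P ((\<lambda>r. [])(0 := replicate n True)) (s n) (h n)" "\<And>n. h n \<le> poly p n"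
    unfolding ptrans_def poly_bounded_def by blast
  have "\<exists>k s. exec P ((\<lambda>r. [])(0 := replicate n True)) k s \<and> s 0 = g n \<and> k \<le> poly p n" for n
    using h[of n] assms(2)[of n] unfolding runs_def by (meson le_trans)
  then show ?thesis unfolding poly_time_family_def poly_time_on_def
    by (intro exI[of _ P] exI[of _ p]) auto
qed

primrec nfresh :: "nat \<Rightarrow> gen" where
  "nfresh 0 = Nop"
| "nfresh (Suc a) = Fresh ;; nfresh a"

lemma nfresh [simp]: "fr (nfresh a) d \<rho> = \<rho> 0 + a" "em (nfresh a) d \<rho> = []" "gwf (nfresh a)"
  by (induction a arbitrary: \<rho>) auto

lemma forF_add: "(\<And>i F. h i F = F + a) \<Longrightarrow> forF h c i F = F + c * (a :: nat)"
  by (induction c arbitrary: i F) auto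

lemma forE_Nil: "(\<And>i F. e i F = []) \<Longrightarrow> forE h e c i F = []"
  by (induction c arbitrary: i F) auto

text \<open>Horner's rule with \<open>Fresh\<close> as an increment: no gate is emitted, and the
  value of a polynomial at variable 1 is added to variable 0.\<close>

primrec gpoly :: "nat list \<Rightarrow> gen" where
  "gpoly [] = Nop"
| "gpoly (a # cs) = nfresh a ;; For 1 (gpoly cs)"

lemma gpoly: "gwf (gpoly cs)" "em (gpoly cs) d \<rho> = []" "1 < d \<Longrightarrow> fr (gpoly cs) d \<rho> = \<rho> 0 + poly (Poly cs) (\<rho> 1)"
proof -
  show "gwf (gpoly cs)" by (induction cs) auto
  show "em (gpoly cs) d \<rho> = []" by (induction cs arbitrary: d \<rho>) (auto simp: forE_Nil)
  show "1 < d \<Longrightarrow> fr (gpoly cs) d \<rho> = \<rho> 0 + poly (Poly cs) (\<rho> 1)"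
  proof (induction cs arbitrary: d \<rho>)
    case (Cons a cs)
    have "fr (For 1 (gpoly cs)) d \<rho>' = \<rho>' 0 + \<rho>' 1 * poly (Poly cs) (\<rho>' 1)" for \<rho>'
      unfolding fr.simps by (rule forF_add) (use Cons in simp)
    from this[of "\<rho>(0 := \<rho> 0 + a)"] show ?case by simp
  qed simp
qed

primrec bounds :: "gen \<Rightarrow> nat set" where
  "bounds Nop = {}"
| "bounds (Emit t) = {}"
| "bounds Fresh = {}"
| "bounds (g ;; h) = bounds g \<union> bounds h"
| "bounds (For b g) = insert b (bounds g)"

lemma gwf_bounds: "gwf g \<longleftrightarrow> 0 \<notin> bounds g"
  by (induction g) auto

text \<open>Applied to variable 4, the width: the amount of allocation does not depend on it, so the
  width can be found by a dry run.\<close>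

lemma fr_upd:
  assumes "v \<notin> bounds g" "v < d" "v \<noteq> 0"
  shows "fr g d (\<rho>(v := x)) = fr g d \<rho>"
  using assms
proof (induction g arbitrary: d \<rho>)
  case (Then g h)
  have "(\<rho>(v := x))(0 := y) = (\<rho>(0 := y))(v := x)" for y using Then.prems by (simp add: fun_upd_twist)
  then show ?case using Then by (simp del: fun_upd_apply)
next
  case (For b g)
  have "fr g (Suc d) (\<rho>(v := x, 0 := F, d := i)) = fr g (Suc d) (\<rho>(0 := F, d := i))" for i F
  proof -
    have "\<rho>(v := x, 0 := F, d := i) = (\<rho>(0 := F, d := i))(v := x)" using For.prems by (auto simp: fun_eq_iff)
    then show ?thesis using For.IH[of "Suc d" "\<rho>(0 := F, d := i)"] For.prems by (simp del: fun_upd_apply)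
  qed
  moreover have "(\<rho>(v := x)) b = \<rho> b" "(\<rho>(v := x)) 0 = \<rho> 0" using For.prems by auto
  ultimately show ?case unfolding fr.simps by (simp only:)
qed auto

lemma bounds_emits [simp]: "bounds (emits ts) = {}"
  by (induction ts) (auto simp: emits_def)

context layout
begin

lemma bounds_lanes [simp]: "bounds (gcswap x y z) = {}" "bounds (lane_push d fl j b) = {2}" "bounds (lane_pop d fl j) = {2}"
  "bounds (set_flag fl t nx) = {}" "bounds (clear_wire w) = {}" "bounds (gfetch d r w) = {3}"
  by (auto simp: gcswap_def lane_push_def lane_pop_def set_flag_def clear_wire_def gfetch_def)

lemma bounds_comp: "bounds (comp d fl nx P) \<subseteq> {2}"
  by (induction P arbitrary: d fl nx) auto

lemma bounds_gmain: "bounds (gmain P) \<subseteq> {1, 2, 3}"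
  using bounds_comp by (fastforce simp: gmain_def gload_def grun_def gcopy_def gdecode_def gstep_def)

text \<open>Computes the first fresh wire, which comes after the work wires and flags, the
  \<open>T + 1\<close> rows of cells and the key.\<close>

definition gbase :: gen where
  "gbase = nfresh (C + K) ;; For 2 (nfresh K) ;; For 1 Fresh"

lemma gbase: "gwf gbase" "em gbase 5 \<rho> = []" "fr gbase 5 \<rho> = \<rho> 0 + C + K * Suc (\<rho> 2) + \<rho> 1"
  by (simp_all add: gbase_def forE_Nil forF_add[where a = K] forF_add[where a = 1] mult.commute)

end

context registers
begin

lemma ptrans_gprog:
  assumes "gwf g" "\<And>n. repr d (\<rho> n) (s n)" "\<And>n v. \<rho> n v \<le> N n" "poly_bounded N" "0 < d"
  shows "ptrans (gprog d g) s (\<lambda>n. after (s n) (fr g d (\<rho> n)) (em g d (\<rho> n)))" "poly_bounded (\<lambda>n. fr g d (\<rho> n))"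
proof -
  from runs_gprog[OF assms(1)] obtain q :: "nat poly" where
    "\<And>d \<rho> s N. 0 < d \<Longrightarrow> repr d \<rho> s \<Longrightarrow> \<forall>v. \<rho> v \<le> N \<Longrightarrow> runs (gprog d g) s (after s (fr g d \<rho>) (em g d \<rho>)) (poly q N)"
    by blast
  then show "ptrans (gprog d g) s (\<lambda>n. after (s n) (fr g d (\<rho> n)) (em g d (\<rho> n)))"
    using assms by (intro ptransI[where h = "\<lambda>n. poly q (N n)"] poly_bounded_poly) auto
  from fr_bound[OF assms(1)] obtain q :: "nat poly" where
    "\<And>d \<rho> N. 0 < d \<Longrightarrow> \<forall>v. v \<noteq> 0 \<longrightarrow> \<rho> v \<le> N \<Longrightarrow> fr g d \<rho> \<le> \<rho> 0 + poly q N" by blast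
  then have "fr g d (\<rho> n) \<le> N n + poly q (N n)" for n
    using assms(3)[of n] \<open>0 < d\<close> by (meson add_le_mono1 le_trans)
  then show "poly_bounded (\<lambda>n. fr g d (\<rho> n))"
    by (rule poly_bounded_mono[OF poly_bounded_add[OF assms(4) poly_bounded_poly[OF assms(4)]]])
qed

end

definition move_rev :: "nat \<Rightarrow> nat \<Rightarrow> program" where
  "move_rev v r = Loop (Nonempty v) (Cond (Head_True v) (Seq (Pop v) (Push r True)) (Seq (Pop v) (Push r False)))"

lemma runs_move_rev:
  assumes "v \<noteq> r"
  shows "runs (move_rev v r) s (s(v := [], r := rev (s v) @ s r)) (4 * length (s v) + 1)"
  unfolding move_rev_def
proof (induction "s v" arbitrary: s)
  case Nil
  then show ?case by (intro runs_weaken[OF runs_Loop(2)]) (auto simp: fun_eq_iff)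
next
  case (Cons b x)
  note sv = Cons(2)[symmetric]
  let ?P = "Cond (Head_True v) (Seq (Pop v) (Push r True)) (Seq (Pop v) (Push r False))"
  let ?s = "s(v := x, r := b # s r)"
  have "runs (Seq (Pop v) (Push r b)) s ?s (1 + 1)"
    using assms sv by (intro runs_weaken[OF runs_Seq[OF runs_basic(3) runs_basic(2)]]) (auto simp: fun_eq_iff)
  then have 1: "runs ?P s ?s (1 + 1 + 1)"
    using runs_Cond[of "Head_True v" s] sv by (cases b) fastforce+
  have "runs (Loop (Nonempty v) ?P) ?s (?s(v := [], r := rev (?s v) @ ?s r)) (4 * length (?s v) + 1)"
    using assms by (intro Cons(1)) simp
  moreover have "holds (Nonempty v) s" using sv by simp
  ultimately have "runs (Loop (Nonempty v) ?P) s (?s(v := [], r := rev (?s v) @ ?s r)) (1 + 1 + 1 + (4 * length (?s v) + 1) + 1)"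
    using runs_Loop(1)[OF _ 1] by blast
  then show ?case using assms by (elim runs_weaken) (auto simp: fun_eq_iff sv)
qed

lemma ptrans_length:
  assumes "ptrans P s s'" "poly_bounded (\<lambda>n. length (s n r))"
  shows "poly_bounded (\<lambda>n. length (s' n r))"
proof -
  from assms(1) obtain h where h: "poly_bounded h" "\<And>n. runs P (s n) (s' n) (h n)" unfolding ptrans_def by blast
  have "length (s' n r) \<le> length (s n r) + h n" for n
    using h(2)[of n] exec_length unfolding runs_def by (meson add_le_mono le_trans order_refl)
  then show ?thesis by (rule poly_bounded_mono[OF poly_bounded_add[OF assms(2) h(1)]])
qed

lemma ptrans_clear_reg: "poly_bounded (\<lambda>n. length (s n r)) \<Longrightarrow> ptrans (clear_reg r) s (\<lambda>n. (s n)(r := []))"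
  by (rule ptransI[OF runs_clear_reg poly_bounded_add[OF poly_bounded_mult[OF poly_bounded_const] poly_bounded_const]])

lemma ptrans_Push: "ptrans (Push r b) s (\<lambda>n. (s n)(r := b # s n r))"
  by (rule ptransI[OF runs_basic(2) poly_bounded_const])

lemma ptrans_copy:
  assumes "v \<noteq> r" "v \<noteq> t" "r \<noteq> t" "\<And>n. s n v = replicate (a n) True" "\<And>n. s n t = []" "poly_bounded a"
  shows "ptrans (copy t v r) s (\<lambda>n. (s n)(r := replicate (a n) True @ s n r))"
  by (rule ptransI[OF runs_copy poly_bounded_add[OF poly_bounded_mult[OF poly_bounded_const[of 7] assms(6)] poly_bounded_const[of 2]]])
    (use assms in auto)

lemma ptrans_move:
  assumes "v \<noteq> r" "\<And>n. s n v = replicate (a n) True" "poly_bounded a"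
  shows "ptrans (Loop (Nonempty v) (Seq (Pop v) (Push r True))) s (\<lambda>n. (s n)(v := [], r := replicate (a n) True @ s n r))"
  by (rule ptransI[OF runs_move poly_bounded_add[OF poly_bounded_mult[OF poly_bounded_const[of 3] assms(3)] poly_bounded_const[of 1]]])
    (use assms in auto)

lemma ptrans_move_rev:
  assumes "v \<noteq> r" "poly_bounded (\<lambda>n. length (s n v))"
  shows "ptrans (move_rev v r) s (\<lambda>n. (s n)(v := [], r := rev (s n v) @ s n r))"
  by (rule ptransI[where h = "\<lambda>n. 4 * length (s n v) + 1"])
    (rule runs_move_rev[OF assms(1)], rule poly_bounded_add[OF poly_bounded_mult[OF poly_bounded_const[of 4] assms(2)] poly_bounded_const[of 1]])

text \<open>The common form of both committed states: a uniform superposition of distinct basis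
  states of \<open>R\<close>, each paired with a state on \<open>C\<close>. The sum is indexed by
  \<open>a\<close> bits, the key length for 0 and the size of \<open>C\<close> for 1.\<close>

definition purified :: "(nat \<Rightarrow> ket) \<Rightarrow> (nat \<Rightarrow> nat) \<Rightarrow> (nat \<Rightarrow> nat) \<Rightarrow> (nat \<Rightarrow> nat) \<Rightarrow> (nat \<Rightarrow> bool list \<Rightarrow> ket) \<Rightarrow> bool" where
  "purified \<psi> W m a \<phi> \<longleftrightarrow> (\<forall>l. \<exists>\<xi>. inj_on \<xi> (bits (a l)) \<and> \<xi> ` bits (a l) \<subseteq> bits (W l) \<and> \<psi> l =
     (\<lambda>z. (1 / complex_of_real (sqrt 2)) ^ a l *
       (\<Sum>k\<in>bits (a l). if length z = W l + m l \<and> take (W l) z = \<xi> k then \<phi> l k (drop (W l) z) else 0)))"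

section \<open>The scheme and its uniformity\<close>

lemma finite_regs: "finite (regs P)"
  by (induction P) auto

text \<open>The printing program computes \<open>m\<close> and the time bound \<open>T\<close>,
  finds the width by a dry run of the generator and only then prints. The committed bit enters
  solely in the choice of the last generator.\<close>

theorem exists_scheme:
  assumes "state_gen m U"
  shows "\<exists>S. commitment_scheme S \<and> reg_C S = m \<and>
    purified (commit_state S False) (reg_R S) m (\<lambda>l. l) (\<lambda>l k. circuit_state (U k)) \<and>
    purified (commit_state S True) (reg_R S) m m (\<lambda>l. basis_ket)"
proof -
  from assms have U: "wf_circuit (U k)" "width (U k) = m (length k)" for k by (auto simp: state_gen_def)
  from assms obtain P p where Pp: "\<And>x. \<exists>k s. exec P ((\<lambda>r. [])(0 := x)) k s \<and> s 0 = enc_circuit (U x) \<and> k \<le> poly p (length x)"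
    unfolding state_gen_def poly_time_on_def by blast
  obtain B where B: "8 \<le> B" "regs P \<subseteq> {..<B}"
  proof -
    obtain B where "\<forall>r\<in>regs P. r < B" using finite_regs[of P] finite_nat_set_iff_bounded by blast
    then show ?thesis by (intro that[of "B + 8"]) auto
  qed
  \<comment> \<open>Two lanes per register; \<open>B\<close> is at least 8 because decoding uses
    registers 0 to 7.\<close>
  define K where "K = 2 * B"
  define C where "C = 5 + flags decode_gate + flags read_header + flags P"
  interpret L: layout C K by unfold_locales (use B in \<open>auto simp: C_def K_def\<close>)
  interpret R: registers B .
  have K16: "K \<ge> 16" and fl: "5 + flags decode_gate \<le> C" "5 + flags read_header \<le> C" "5 + flags P \<le> C"
    and rg: "\<forall>r\<in>regs P. Suc (2 * r) < K" using B by (auto simp: K_def C_def)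
  \<comment> \<open>\<open>M\<close> bounds input length plus running time, and so the length of
    every register of \<open>P\<close>; \<open>T\<close> is what coherent decoding then
    requires.\<close>
  define pM where "pM = [:0, 1:] + p"
  define pT where "pT = smult 52 pM + [:25:]"
  define M where "M n = poly pM n" for n
  define T where "T n = poly pT n" for n
  have MT: "52 * M n + 25 = T n" for n by (simp add: T_def M_def pT_def)
  have P: "\<exists>t s. exec P ((\<lambda>r. [])(0 := k)) t s \<and> s 0 = enc_circuit (U k) \<and> n + t \<le> M n" if "k \<in> bits n" for n k
    using Pp[of k] that unfolding bits_def M_def pM_def by force
  have pbT: "poly_bounded T" unfolding T_def by (rule poly_bounded_poly[OF poly_bounded_id])
  have pbM: "poly_bounded M" unfolding M_def by (rule poly_bounded_poly[OF poly_bounded_id])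
  \<comment> \<open>A sample key that equals the unary input. The width of its circuit is
    \<open>m n\<close>, which makes \<open>m\<close> computable.\<close>
  define key where "key n = replicate n True" for n :: nat
  have key: "key n \<in> bits n" for n by (simp add: key_def bits_def)
  have "\<exists>t s. exec P ((\<lambda>r. [])(0 := key n)) t s \<and> s 0 = enc_circuit (U (key n)) \<and> n + t \<le> M n" for n
    using P key by blast
  then obtain tP sP where tP: "\<And>n. exec P ((\<lambda>r. [])(0 := key n)) (tP n) (sP n)" "\<And>n. sP n 0 = enc_circuit (U (key n))"
    "\<And>n. n + tP n \<le> M n" by metis
  define rest where "rest n = concat (map enc_gate (gates (U (key n))))" for n
  have wkey: "width (U (key n)) = m n" for n by (simp add: U key_def)
  have sP0: "sP n 0 = replicate (m n) True @ False # rest n" for n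
    by (simp add: tP enc_circuit_def wkey enc_nat_def rest_def)
  have lenP: "length (sP n 0) \<le> M n" for n
    using exec_length[OF tP(1)[of n], of 0] tP(3)[of n] by (simp add: key_def)
  have mM: "m n \<le> M n" "length (rest n) \<le> M n" for n using lenP[of n] by (auto simp: sP0)
  have mT: "m n \<le> T n" for n using mM(1)[of n] MT[of n] by linarith
  have pbm: "poly_bounded m" by (rule poly_bounded_mono[OF pbM mM(1)])
  have nB [simp]: "\<not> R.reg v < B" "\<not> R.cnt v < B" "\<not> R.out < B" "\<not> R.tmp < B" "R.reg v \<noteq> 0" "R.out \<noteq> 0" "R.tmp \<noteq> 0" "R.cnt v \<noteq> 0"
     "0 \<noteq> R.reg v" "0 \<noteq> R.out" "0 \<noteq> R.tmp" "0 \<noteq> R.cnt v" for v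
    using B by (auto simp: R.reg_def R.cnt_def R.out_def R.tmp_def)

  define F0 where "F0 n = C + K * Suc (T n) + n" for n
  define env :: "nat \<Rightarrow> nat \<Rightarrow> nat \<Rightarrow> env" where
    "env n w F = (\<lambda>_. 0)(1 := n, 2 := T n, 3 := m n, 4 := w, 0 := F)" for n w F
  have env: "env n w F 0 = F" "env n w F 1 = n" "env n w F 2 = T n" "env n w F 3 = m n" "env n w F 4 = w"
    "\<And>v. v \<ge> 5 \<Longrightarrow> env n w F v = 0" "\<And>F'. (env n w F)(0 := F') = env n w F'" for n w F
    by (auto simp: env_def)
  have env_le: "env n w F v \<le> n + T n + m n + w + F" for n w F v by (simp add: env_def)
  \<comment> \<open>The dry run: the value 0 of variable 4 is a placeholder for the width.\<close>
  define W where "W n = fr (L.gmain P) 5 (env n 0 (F0 n))" for n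
  have gw: "gwf (L.gmain P)" using L.bounds_gmain[of P] by (auto simp: gwf_bounds)
  have b4: "4 \<notin> bounds (L.gmain P)" using L.bounds_gmain[of P] by auto
  have frW: "fr (L.gmain P) 5 (env n w (F0 n)) = W n" for n w
  proof -
    have "env n w (F0 n) = (env n 0 (F0 n))(4 := w)" by (auto simp: env_def fun_eq_iff)
    then show ?thesis using fr_upd[OF b4, of 5] by (simp add: W_def)
  qed
  define ga where "ga n = em (L.gmain P) 5 (env n (W n) (F0 n))" for n
  define gb where "gb n = em gbell 5 (env n (W n) (F0 n))" for n
  define S where "S = \<lparr>reg_R = W, reg_C = m, prep = (\<lambda>b n. Circuit (W n + m n) (if b then gb n else ga n))\<rparr>"

  have "W n \<ge> F0 n \<and> wf_circuit (Circuit (W n + m n) (ga n)) \<and>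
    (\<exists>\<xi>. inj_on \<xi> (bits n) \<and> \<xi> ` bits n \<subseteq> bits (W n) \<and> circuit_state (Circuit (W n + m n) (ga n)) =
       (\<lambda>z. (1 / complex_of_real (sqrt 2)) ^ n * (\<Sum>k\<in>bits n. if length z = W n + m n \<and> take (W n) z = \<xi> k then circuit_state (U k) (drop (W n) z) else 0)))" for n
  proof -
    have 1: "52 * M n + 25 \<le> T n" using MT by simp
    have 2: "env n (W n) (F0 n) 0 = C + K * Suc (T n) + n" by (simp add: env F0_def)
    have 3: "fr (L.gmain P) 5 (env n (W n) (F0 n)) \<le> W n" by (simp add: frW)
    have 4: "wf_circuit (U k) \<and> width (U k) = m n" if "k \<in> bits n" for k using U[of k] that by (simp add: bits_def)
    note G = L.gmain_state[OF K16 fl rg 1 2 env(2-5) 3 P 4]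
    show ?thesis using G unfolding ga_def F0_def by blast
  qed
  then have FW: "F0 n \<le> W n" and wfa: "wf_circuit (Circuit (W n + m n) (ga n))" and sa: "\<exists>\<xi>. inj_on \<xi> (bits n) \<and> \<xi> ` bits n \<subseteq> bits (W n) \<and> circuit_state (Circuit (W n + m n) (ga n)) =
       (\<lambda>z. (1 / complex_of_real (sqrt 2)) ^ n * (\<Sum>k\<in>bits n. if length z = W n + m n \<and> take (W n) z = \<xi> k then circuit_state (U k) (drop (W n) z) else 0))" for n
    by auto
  have mW: "m n \<le> W n" for n
  proof -
    have "T n \<le> K * Suc (T n)" using K16 by (simp add: trans_le_add2)
    then show ?thesis using FW[of n] mT[of n] by (simp add: F0_def)
  qed
  have bell: "wf_circuit (Circuit (W n + m n) (gb n))" "\<exists>\<xi>. inj_on \<xi> (bits (m n)) \<and> \<xi> ` bits (m n) \<subseteq> bits (W n) \<and> circuit_state (Circuit (W n + m n) (gb n)) =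
       (\<lambda>z. (1 / complex_of_real (sqrt 2)) ^ m n * (\<Sum>y\<in>bits (m n). if length z = W n + m n \<and> take (W n) z = \<xi> y then basis_ket y (drop (W n) z) else 0))" for n
    using gbell_state[of "m n" "W n" "env n (W n) (F0 n)"] mW by (simp_all add: env gb_def)
  have st: "commit_state S b n = circuit_state (Circuit (W n + m n) (if b then gb n else ga n))" for b n
    by (simp add: commit_state_def S_def)
  have rS: "reg_R S = W" by (simp add: S_def)
  have pur: "purified (commit_state S False) (reg_R S) m (\<lambda>l. l) (\<lambda>l k. circuit_state (U k))"
    "purified (commit_state S True) (reg_R S) m m (\<lambda>l. basis_ket)"
    unfolding purified_def st rS using sa bell(2) by simp_all

  \<comment> \<open>The stages of the printing program: \<open>st3\<close> has \<open>m\<close> from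
    the header, \<open>st6\<close> the bound \<open>T\<close>; \<open>st8\<close> is the dry run,
    whose output \<open>st9\<close> discards while \<open>st10\<close> keeps its final allocation as
    the width.\<close>
  define st0 where "st0 n = (\<lambda>r :: nat. [])(0 := key n)" for n
  define st1 where "st1 n = (st0 n)(R.reg 1 := replicate n True)" for n
  define st2 where "st2 n r = (if r < B then sP n r else st1 n r)" for n r
  define st3 where "st3 n = (st2 n)(0 := False # rest n, R.reg 3 := replicate (m n) True)" for n
  define st4 where "st4 n = (st3 n)(0 := [])" for n
  define st5 where "st5 n = (st4 n)(R.reg 0 := replicate (T n) True)" for n
  define st6 where "st6 n = (st5 n)(R.reg 0 := [], R.reg 2 := replicate (T n) True)" for n
  define st7 where "st7 n = R.after (st6 n) (F0 n) []" for n
  define st8 where "st8 n = R.after (st7 n) (W n) (em (L.gmain P) 5 (env n 0 (F0 n)))" for n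
  define st9 where "st9 n = (st8 n)(R.out := [])" for n
  define st10 where "st10 n = (st9 n)(R.reg 0 := [], R.reg 4 := replicate (W n) True)" for n
  define st11 where "st11 n = R.after (st10 n) (F0 n) []" for n
  define st12 where "st12 b n = (if b then R.after (st11 n) (F0 n) (gb n) else R.after (st11 n) (W n) (ga n))" for b n
  define st13 where "st13 b n = (st12 b n)(R.out := [], 0 := rev (st12 b n R.out) @ st12 b n 0)" for b n

  have p1: "ptrans (copy R.tmp 0 (R.reg 1)) st0 st1"
    using ptrans_copy[of 0 "R.reg 1" R.tmp st0 "\<lambda>n. n"] poly_bounded_id by (simp add: st0_def st1_def[abs_def] key_def)
  have p2: "ptrans P st1 st2"
  proof (rule ptransI[OF _ pbM])
    fix n
    have "exec P (\<lambda>r. if r < B then st0 n r else st1 n r) (tP n) (\<lambda>r. if r < B then sP n r else st1 n r)"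
      using exec_frame[OF tP(1) B(2)] unfolding st0_def .
    moreover have "(\<lambda>r. if r < B then st0 n r else st1 n r) = st1 n" by (auto simp: fun_eq_iff st1_def)
    ultimately have "exec P (st1 n) (tP n) (st2 n)" by (simp add: st2_def[abs_def])
    then show "runs P (st1 n) (st2 n) (M n)" using tP(3)[of n] unfolding runs_def by (intro exI[of _ "tP n"]) simp
  qed
  have p3: "ptrans (Loop (Head_True 0) (Seq (Pop 0) (Push (R.reg 3) True))) st2 st3"
  proof (rule ptransI[OF _ poly_bounded_add[OF poly_bounded_mult[OF poly_bounded_const[of 3] pbm] poly_bounded_const[of 1]]])
    fix n
    have "st2 n 0 = replicate (m n) True @ False # rest n" using B by (simp add: st2_def sP0)
    then show "runs (Loop (Head_True 0) (Seq (Pop 0) (Push (R.reg 3) True))) (st2 n) (st3 n) (3 * m n + 1)"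
      by (intro runs_weaken[OF runs_transfer]) (auto simp: st3_def st2_def st1_def st0_def fun_eq_iff)
  qed
  have p4: "ptrans (clear_reg 0) st3 st4"
    unfolding st4_def[abs_def]
    by (rule ptrans_clear_reg, rule poly_bounded_mono[OF poly_bounded_add[OF pbM poly_bounded_const[of 1]]]) (use mM in \<open>auto simp: st3_def\<close>)
  have r4: "R.repr 5 ((\<lambda>_. 0)(1 := n, 3 := m n)) (st4 n)" for n
    by (auto simp: R.repr_def st4_def st3_def st2_def st1_def st0_def)
  have after_Nil: "R.after s F [] = s(R.reg 0 := replicate F True)" for s F by (auto simp: R.after_def fun_eq_iff)
  have p5: "ptrans (R.gprog 5 (gpoly (coeffs pT))) st4 st5"
    using R.ptrans_gprog(1)[where N = "\<lambda>n. n + m n" and \<rho> = "\<lambda>n. (\<lambda>_. 0)(1 := n, 3 := m n)" and s = st4 and d = 5, OF gpoly(1)[of "coeffs pT"] r4] poly_bounded_add[OF poly_bounded_id pbm]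
    by (simp add: gpoly after_Nil st5_def[abs_def] T_def)
  have p6: "ptrans (Loop (Nonempty (R.reg 0)) (Seq (Pop (R.reg 0)) (Push (R.reg 2) True))) st5 st6"
    using ptrans_move[of "R.reg 0" "R.reg 2" st5 T] pbT
    by (simp add: st6_def[abs_def] st5_def st4_def st3_def st2_def st1_def st0_def)
  have r6: "R.repr 5 (env n 0 0) (st6 n)" for n
    by (auto simp: R.repr_def env_def st6_def st5_def st4_def st3_def st2_def st1_def st0_def)
  have N: "poly_bounded (\<lambda>n. n + T n + m n + w n + F n)" if "poly_bounded w" "poly_bounded F" for w F
    by (intro poly_bounded_add poly_bounded_id pbT pbm that)
  have frb: "fr L.gbase 5 (env n w 0) = F0 n" for n w by (simp add: L.gbase env_def F0_def)
  have p7: "ptrans (R.gprog 5 L.gbase) st6 st7" and pbF: "poly_bounded F0"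
    using R.ptrans_gprog[OF L.gbase(1) r6 env_le N[OF poly_bounded_const poly_bounded_const]]
    by (simp_all add: frb L.gbase(2) st7_def[abs_def])
  have r7: "R.repr 5 (env n 0 (F0 n)) (st7 n)" for n
    using R.repr_after[OF r6[of n], of "F0 n" "[]"] by (simp add: env st7_def)
  have p8: "ptrans (R.gprog 5 (L.gmain P)) st7 st8" and pbW: "poly_bounded W"
    using R.ptrans_gprog[OF gw r7 env_le N[OF poly_bounded_const pbF]]
    by (simp_all add: W_def[symmetric] st8_def[abs_def])
  note p08 = ptrans_Seq[OF p1 ptrans_Seq[OF p2 ptrans_Seq[OF p3 ptrans_Seq[OF p4 ptrans_Seq[OF p5 ptrans_Seq[OF p6 ptrans_Seq[OF p7 p8]]]]]]]
  have p9: "ptrans (clear_reg R.out) st8 st9"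
    unfolding st9_def[abs_def]
    by (rule ptrans_clear_reg, rule ptrans_length[OF p08]) (simp add: st0_def poly_bounded_const)
  have p10: "ptrans (Loop (Nonempty (R.reg 0)) (Seq (Pop (R.reg 0)) (Push (R.reg 4) True))) st9 st10"
    using ptrans_move[of "R.reg 0" "R.reg 4" st9 W] pbW r7
    by (simp add: st10_def[abs_def] st9_def st8_def R.after_def R.repr_def env)
  have r10: "R.repr 5 (env n (W n) 0) (st10 n)" for n
    using r7[of n] by (auto simp: R.repr_def env_def st10_def st9_def st8_def R.after_def)
  have p11: "ptrans (R.gprog 5 L.gbase) st10 st11"
    using R.ptrans_gprog(1)[OF L.gbase(1) r10 env_le N[OF pbW poly_bounded_const]]
    by (simp add: frb L.gbase(2) st11_def[abs_def])
  have r11: "R.repr 5 (env n (W n) (F0 n)) (st11 n)" for n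
    using R.repr_after[OF r10[of n], of "F0 n" "[]"] by (simp add: env st11_def)
  have gbw: "gwf gbell" "fr gbell 5 \<rho> = \<rho> 0" for \<rho> by (simp_all add: gbell_def forF_id)
  have p12: "ptrans (R.gprog 5 (if b then gbell else L.gmain P)) st11 (st12 b)" for b
    using R.ptrans_gprog(1)[OF gw r11 env_le N[OF pbW pbF]] R.ptrans_gprog(1)[OF gbw(1) r11 env_le N[OF pbW pbF]]
    by (cases b) (simp_all add: frW gbw(2) env st12_def[abs_def] ga_def gb_def)
  note p812 = ptrans_Seq[OF p08 ptrans_Seq[OF p9 ptrans_Seq[OF p10 ptrans_Seq[OF p11 p12]]]]
  have p13: "ptrans (move_rev R.out 0) (st12 b) (st13 b)" for b
    unfolding st13_def[abs_def]
    by (rule ptrans_move_rev, simp, rule ptrans_length[OF p812]) (simp add: st0_def poly_bounded_const)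
  have r12: "R.repr 5 (env n (W n) (if b then F0 n else W n)) (st12 b n)" for b n
    using R.repr_after[OF r11[of n]] by (auto simp: env st12_def)
  have r13: "R.repr 5 (env n (W n) (if b then F0 n else W n)) (st13 b n)" for b n
    using r12[of n b] by (simp add: R.repr_def st13_def)
  have zero: "st11 n 0 = []" "st11 n R.out = []" for n
    using B by (simp_all add: st11_def st10_def st9_def st8_def st7_def st6_def st5_def st4_def R.after_def)
  have z13: "st13 b n 0 = concat (map enc_gate (if b then gb n else ga n))" for b n
    by (simp add: st13_def st12_def R.after_def zero)
  \<comment> \<open>The prefix is pushed back to front: a terminator, \<open>m\<close> and
    \<open>W\<close> ones for the width \<open>W + m\<close>, another terminator, and
    \<open>W\<close> ones for the size of \<open>R\<close>.\<close>
  define st14 where "st14 b n = (st13 b n)(0 := False # st13 b n 0)" for b n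
  define st15 where "st15 b n = (st14 b n)(0 := replicate (m n) True @ st14 b n 0)" for b n
  define st16 where "st16 b n = (st15 b n)(0 := replicate (W n) True @ st15 b n 0)" for b n
  define st17 where "st17 b n = (st16 b n)(0 := False # st16 b n 0)" for b n
  define st18 where "st18 b n = (st17 b n)(0 := replicate (W n) True @ st17 b n 0)" for b n
  have rr: "st13 b n (R.reg 3) = replicate (m n) True" "st13 b n (R.reg 4) = replicate (W n) True" "st13 b n R.tmp = []" for b n
    using r13[of n b] by (simp_all add: R.repr_def env)
  have p14: "ptrans (Push 0 False) (st13 b) (st14 b)" for b unfolding st14_def[abs_def] by (rule ptrans_Push)
  have p15: "ptrans (copy R.tmp (R.reg 3) 0) (st14 b) (st15 b)" for b unfolding st15_def[abs_def]
    by (rule ptrans_copy) (simp_all add: st14_def rr pbm)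
  have p16: "ptrans (copy R.tmp (R.reg 4) 0) (st15 b) (st16 b)" for b unfolding st16_def[abs_def]
    by (rule ptrans_copy) (simp_all add: st15_def st14_def rr pbW)
  have p17: "ptrans (Push 0 False) (st16 b) (st17 b)" for b unfolding st17_def[abs_def] by (rule ptrans_Push)
  have p18: "ptrans (copy R.tmp (R.reg 4) 0) (st17 b) (st18 b)" for b unfolding st18_def[abs_def]
    by (rule ptrans_copy) (simp_all add: st17_def st16_def st15_def st14_def rr pbW)
  have fam: "poly_time_family (\<lambda>n. enc_nat (W n) @ enc_circuit (Circuit (W n + m n) (if b then gb n else ga n)))" for b
  proof (rule poly_time_familyI[OF ptrans_Seq[OF p812 ptrans_Seq[OF p13 ptrans_Seq[OF p14 ptrans_Seq[OF p15 ptrans_Seq[OF p16 ptrans_Seq[OF p17 p18]]]]], unfolded st0_def key_def]])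
    show "st18 b n 0 = enc_nat (W n) @ enc_circuit (Circuit (W n + m n) (if b then gb n else ga n))" for n
      by (simp add: st18_def st17_def st16_def st15_def st14_def z13 enc_circuit_def enc_nat_def replicate_add)
  qed
  have "commitment_scheme S"
    unfolding commitment_scheme_def S_def using fam wfa bell(1) by simp
  then show ?thesis using pur by (intro exI[of _ S]) (simp add: S_def)
qed

subsection \<open>Inner products and norms\<close>

lemma card_bits: "card (bits n) = 2 ^ n"
  using card_lists_length_eq[of "UNIV :: bool set" n] by (simp add: bits_def)

lemma sum_bits_append: "(\<Sum>x\<in>bits (a + b). f x) = (\<Sum>x\<in>bits a. \<Sum>y\<in>bits b. f (x @ y))"
proof -
  have "(\<Sum>x\<in>bits (a + b). f x) = (\<Sum>(x, y)\<in>bits a \<times> bits b. f (x @ y))"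
    by (rule sum.reindex_bij_witness[of _ "\<lambda>(x, y). x @ y" "\<lambda>x. (take a x, drop a x)"]) (auto simp: bits_def)
  then show ?thesis by (simp add: sum.cartesian_product)
qed

definition ip :: "'i set \<Rightarrow> ('i \<Rightarrow> complex) \<Rightarrow> ('i \<Rightarrow> complex) \<Rightarrow> complex" where
  "ip I f g = (\<Sum>x\<in>I. cnj (f x) * g x)"

definition sqnorm :: "'i set \<Rightarrow> ('i \<Rightarrow> complex) \<Rightarrow> real" where
  "sqnorm I f = (\<Sum>x\<in>I. (cmod (f x))\<^sup>2)"

lemma sqnorm_nonneg [simp]: "0 \<le> sqnorm I f"
  by (simp add: sqnorm_def sum_nonneg)

lemma ip_self: "ip I f f = of_real (sqnorm I f)"
  by (simp add: ip_def sqnorm_def complex_norm_square[symmetric] mult.commute[of "cnj _"])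

lemma ip_Cauchy_Schwarz: "(cmod (ip I f g))\<^sup>2 \<le> sqnorm I f * sqnorm I g"
proof -
  have "cmod (ip I f g) \<le> (\<Sum>x\<in>I. cmod (f x) * cmod (g x))"
    unfolding ip_def by (rule order.trans[OF norm_sum]) (simp add: norm_mult)
  then have "(cmod (ip I f g))\<^sup>2 \<le> (\<Sum>x\<in>I. cmod (f x) * cmod (g x))\<^sup>2"
    by (intro power_mono) auto
  also have "\<dots> \<le> sqnorm I f * sqnorm I g"
    unfolding sqnorm_def by (rule Cauchy_Schwarz_ineq_sum)
  finally show ?thesis .
qed

lemma sqnorm_add: "sqnorm I (\<lambda>x. f x + g x) = sqnorm I f + sqnorm I g + 2 * Re (ip I f g)"
proof -
  have "(cmod (a + b))\<^sup>2 = (cmod a)\<^sup>2 + (cmod b)\<^sup>2 + 2 * Re (cnj a * b)" for a b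
    unfolding cmod_power2 by (simp add: power2_eq_square algebra_simps)
  then show ?thesis by (simp add: sqnorm_def ip_def sum.distrib sum_distrib_left)
qed

text \<open>This isometry transports a vector on \<open>C\<close> to the basis states of
  \<open>R\<close> that the maximally entangled state pairs with those of \<open>C\<close>.\<close>

lemma sqnorm_inj:
  assumes "finite X" "finite Y" "inj_on \<xi> Y" "\<xi> ` Y \<subseteq> X"
  shows "sqnorm X (\<lambda>x. \<Sum>y\<in>Y. if x = \<xi> y then c y else 0) = sqnorm Y c"
proof -
  let ?F = "\<lambda>x. \<Sum>y\<in>Y. if x = \<xi> y then c y else 0"
  have in_Y: "?F (\<xi> y) = c y" if "y \<in> Y" for y
  proof -
    have "?F (\<xi> y) = (\<Sum>y'\<in>Y. if y' = y then c y' else 0)"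
      using assms(3) that by (intro sum.cong) (auto dest: inj_onD)
    then show ?thesis using that assms(2) by simp
  qed
  have "sqnorm X ?F = sqnorm (\<xi> ` Y) ?F"
    unfolding sqnorm_def using assms(1,4) by (intro sum.mono_neutral_right) (auto intro!: sum.neutral)
  also have "\<dots> = sqnorm Y c"
    unfolding sqnorm_def using assms(3) in_Y by (simp add: sum.reindex)
  finally show ?thesis .
qed

definition adj_apply :: "nat \<Rightarrow> op \<Rightarrow> ket \<Rightarrow> ket" where
  "adj_apply n V h = (\<lambda>w'. \<Sum>w\<in>bits n. cnj (V w w') * h w)"

lemma ip_adj_apply:
  assumes "unitary_op n V"
  shows "ip (bits n) (adj_apply n V g) (adj_apply n V h) = ip (bits n) g h"
proof -
  have V: "(\<Sum>z\<in>bits n. V x z * cnj (V y z)) = (if x = y then 1 else 0)" if "x \<in> bits n" "y \<in> bits n" for x y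
    using assms that unfolding unitary_op_def op_mult_def adj_def id_op_def by blast
  have "ip (bits n) (adj_apply n V g) (adj_apply n V h) =
      (\<Sum>z\<in>bits n. \<Sum>x\<in>bits n. \<Sum>y\<in>bits n. cnj (g x) * h y * (V x z * cnj (V y z)))"
    unfolding ip_def adj_apply_def cnj_sum complex_cnj_mult complex_cnj_cnj sum_product
    by (simp add: mult_ac)
  also have "\<dots> = (\<Sum>x\<in>bits n. \<Sum>z\<in>bits n. \<Sum>y\<in>bits n. cnj (g x) * h y * (V x z * cnj (V y z)))"
    by (rule sum.swap)
  also have "\<dots> = (\<Sum>x\<in>bits n. \<Sum>y\<in>bits n. \<Sum>z\<in>bits n. cnj (g x) * h y * (V x z * cnj (V y z)))"
    by (intro sum.cong refl sum.swap)
  also have "\<dots> = (\<Sum>x\<in>bits n. \<Sum>y\<in>bits n. cnj (g x) * h y * (if x = y then 1 else 0))"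
    by (intro sum.cong refl) (simp add: V flip: sum_distrib_left)
  also have "\<dots> = ip (bits n) g h" by (simp add: ip_def if_distrib cong: if_cong)
  finally show ?thesis .
qed

lemma sqnorm_adj_apply:
  assumes "unitary_op n V"
  shows "sqnorm (bits n) (adj_apply n V h) = sqnorm (bits n) h"
  using ip_adj_apply[OF assms, of h h] by (simp add: ip_self)

lemma ip_adj_apply_left: "ip (bits n) (adj_apply n V h) \<psi> = ip (bits n) h (op_apply n V \<psi>)"
proof -
  have "ip (bits n) (adj_apply n V h) \<psi> = (\<Sum>w'\<in>bits n. \<Sum>w\<in>bits n. cnj (h w) * (V w w' * \<psi> w'))"
    unfolding ip_def adj_apply_def cnj_sum sum_distrib_right by (simp add: mult_ac)
  also have "\<dots> = (\<Sum>w\<in>bits n. \<Sum>w'\<in>bits n. cnj (h w) * (V w w' * \<psi> w'))" by (rule sum.swap)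
  finally show ?thesis by (simp add: ip_def op_apply_def sum_distrib_left)
qed

subsection \<open>Circuits preserve the norm\<close>

lemma sqnorm_perm:
  assumes "\<And>x. x \<in> bits n \<Longrightarrow> \<pi> x \<in> bits n \<and> \<pi> (\<pi> x) = x"
  shows "sqnorm (bits n) (\<lambda>x. \<psi> (\<pi> x)) = sqnorm (bits n) \<psi>"
  unfolding sqnorm_def by (rule sum.reindex_bij_witness[of _ \<pi> \<pi>]) (use assms in auto)

lemma sqnorm_flip:
  assumes "q < n" "\<And>x b. t (x[q := b]) = t x"
  shows "sqnorm (bits n) (\<lambda>x. \<psi> (x[q := (x ! q \<noteq> t x)])) = sqnorm (bits n) \<psi>"
proof (rule sqnorm_perm)
  fix x :: "bool list" assume x: "x \<in> bits n"
  have "((p \<noteq> b) \<noteq> b) = p" for p b :: bool by auto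
  then show "x[q := (x ! q \<noteq> t x)] \<in> bits n \<and> (x[q := (x ! q \<noteq> t x)])[q := ((x[q := (x ! q \<noteq> t x)]) ! q \<noteq> t (x[q := (x ! q \<noteq> t x)]))] = x"
    using assms x by (simp add: bits_def)
qed

text \<open>For the Hadamard gate each string is paired with the one that differs at
  \<open>q\<close>, and the claim is the parallelogram law. The other gates permute the amplitudes
  or multiply them by phases.\<close>

lemma sqnorm_gate:
  assumes "wf_gate n g"
  shows "sqnorm (bits n) (gate_apply g \<psi>) = sqnorm (bits n) \<psi>"
proof (cases g)
  case (Had q)
  define h where "h x = (cmod (gate_apply g \<psi> x))\<^sup>2" for x
  define fl where "fl x = x[q := \<not> x ! q]" for x :: "bool list"
  have q: "q < n" using assms Had by simp
  have fl: "fl x \<in> bits n \<and> fl (fl x) = x" if "x \<in> bits n" for x using that q by (auto simp: fl_def bits_def)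
  have swap: "(\<Sum>x\<in>bits n. k (fl x)) = (\<Sum>x\<in>bits n. k x)" for k :: "bool list \<Rightarrow> real"
    by (rule sum.reindex_bij_witness[of _ fl fl]) (use fl in auto)
  have s2: "cmod (complex_of_real (sqrt 2)) ^ 2 = 2" by simp
  have para: "(cmod ((a + b) / complex_of_real (sqrt 2)))\<^sup>2 + (cmod ((a - b) / complex_of_real (sqrt 2)))\<^sup>2 = (cmod a)\<^sup>2 + (cmod b)\<^sup>2" for a b
    unfolding norm_divide power_divide s2 cmod_power2 by (simp add: power2_eq_square field_simps)
  have "h x + h (fl x) = (cmod (\<psi> x))\<^sup>2 + (cmod (\<psi> (fl x)))\<^sup>2" if x: "x \<in> bits n" for x
  proof -
    have lx: "q < length x" using x q by (simp add: bits_def)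
    show ?thesis
    proof (cases "x ! q")
      case True
      then have "x[q := True] = x" "fl x = x[q := False]" using list_update_id[of x q] by (auto simp: fl_def)
      then show ?thesis using para[of "\<psi> (x[q := False])" "\<psi> x"] True lx by (simp add: h_def Had gate_apply.simps)
    next
      case False
      then have "x[q := False] = x" "fl x = x[q := True]" using list_update_id[of x q] by (auto simp: fl_def)
      then show ?thesis using para[of "\<psi> x" "\<psi> (x[q := True])"] False lx by (simp add: h_def Had gate_apply.simps)
    qed
  qed
  then have "(\<Sum>x\<in>bits n. h x + h (fl x)) = (\<Sum>x\<in>bits n. (cmod (\<psi> x))\<^sup>2 + (cmod (\<psi> (fl x)))\<^sup>2)" by simp
  then show ?thesis unfolding sum.distrib swap[of h] swap[of "\<lambda>x. (cmod (\<psi> x))\<^sup>2"] by (simp add: sqnorm_def h_def)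
next
  case (TGate q)
  moreover have "cmod (if b then \<omega> else 1) = 1" for b by simp
  ultimately show ?thesis by (simp only: sqnorm_def gate_apply.simps norm_mult mult_1_left)
next
  case (CNOT a q)
  show ?thesis unfolding CNOT gate_apply.simps
    by (rule sqnorm_flip) (use assms CNOT in auto)
next
  case (Toffoli a b q)
  show ?thesis unfolding Toffoli gate_apply.simps
    by (rule sqnorm_flip) (use assms Toffoli in auto)
qed

lemma sqnorm_circuit:
  assumes "wf_circuit U"
  shows "sqnorm (bits (width U)) (circuit_state U) = 1"
proof -
  have "sqnorm (bits w) (fold gate_apply gs \<psi>) = sqnorm (bits w) \<psi>" if "\<forall>g\<in>set gs. wf_gate w g" for gs w \<psi>
    using that by (induction gs arbitrary: \<psi>) (auto simp: sqnorm_gate)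
  moreover have "sqnorm (bits w) (basis_ket y) = 1" if "y \<in> bits w" for w y
  proof -
    have "sqnorm (bits w) (basis_ket y) = (\<Sum>x\<in>bits w. if x = y then 1 else 0)"
      unfolding sqnorm_def basis_ket_def by (intro sum.cong) auto
    then show ?thesis using that by simp
  qed
  moreover have "replicate (width U) False \<in> bits (width U)" by (simp add: bits_def)
  ultimately show ?thesis using assms by (simp add: circuit_state_def circuit_apply_def zero_ket_def wf_circuit_def)
qed

subsection \<open>Binding\<close>

lemma conj_by_ketbra: "conj_by n A (ketbra \<psi>) = ketbra (op_apply n A \<psi>)"
  by (simp add: conj_by_def op_mult_def adj_def ketbra_def op_apply_def fun_eq_iff sum_distrib_left sum_distrib_right mult_ac)

text \<open>The basis of \<open>E\<close> in which the trace is taken becomes the index of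
  amplitudes, so that the probability is a squared norm.\<close>

lemma expect_trace_left: "expect n \<psi> (trace_left e (ketbra \<Phi>)) = sqnorm (bits e) (\<lambda>u. ip (bits n) \<psi> (\<lambda>x. \<Phi> (u @ x)))"
proof -
  have "(\<Sum>x\<in>bits n. \<Sum>y\<in>bits n. cnj (\<psi> x) * trace_left e (ketbra \<Phi>) x y * \<psi> y) =
    (\<Sum>x\<in>bits n. \<Sum>y\<in>bits n. \<Sum>u\<in>bits e. (cnj (\<psi> x) * \<Phi> (u @ x)) * (\<psi> y * cnj (\<Phi> (u @ y))))"
    by (simp add: trace_left_def ketbra_def sum_distrib_left sum_distrib_right mult_ac)
  also have "\<dots> = (\<Sum>x\<in>bits n. \<Sum>u\<in>bits e. \<Sum>y\<in>bits n. (cnj (\<psi> x) * \<Phi> (u @ x)) * (\<psi> y * cnj (\<Phi> (u @ y))))"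
    by (intro sum.cong refl sum.swap)
  also have "\<dots> = (\<Sum>u\<in>bits e. \<Sum>x\<in>bits n. \<Sum>y\<in>bits n. (cnj (\<psi> x) * \<Phi> (u @ x)) * (\<psi> y * cnj (\<Phi> (u @ y))))"
    by (rule sum.swap)
  also have "\<dots> = (\<Sum>u\<in>bits e. ip (bits n) \<psi> (\<lambda>x. \<Phi> (u @ x)) * cnj (ip (bits n) \<psi> (\<lambda>x. \<Phi> (u @ x))))"
    by (simp add: ip_def sum_product)
  also have "\<dots> = of_real (sqnorm (bits e) (\<lambda>u. ip (bits n) \<psi> (\<lambda>x. \<Phi> (u @ x))))"
    by (simp add: sqnorm_def complex_norm_square[symmetric])
  finally show ?thesis by (simp add: expect_def)
qed

lemma op_apply_tensor_id:
  assumes "w \<in> bits a" "y \<in> bits c"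
  shows "op_apply (a + c) (op_tensor a V id_op) \<Psi> (w @ y) = op_apply a V (\<lambda>w'. \<Psi> (w' @ y)) w"
proof -
  have "op_apply (a + c) (op_tensor a V id_op) \<Psi> (w @ y) =
      (\<Sum>w'\<in>bits a. \<Sum>y'\<in>bits c. if y = y' then V w w' * \<Psi> (w' @ y') else 0)"
    unfolding op_apply_def sum_bits_append using assms
    by (intro sum.cong refl) (auto simp: op_tensor_def id_op_def bits_def)
  then show ?thesis using assms by (simp add: op_apply_def)
qed


lemma sqnorm_product: "sqnorm (A \<times> B) f = (\<Sum>x\<in>A. sqnorm B (\<lambda>y. f (x, y)))"
  by (simp add: sqnorm_def sum.cartesian_product)

lemma sqnorm_product': "sqnorm (A \<times> B) f = (\<Sum>y\<in>B. sqnorm A (\<lambda>x. f (x, y)))"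
  unfolding sqnorm_product unfolding sqnorm_def by (rule sum.swap)

lemma ip_product': "ip (A \<times> B) f g = (\<Sum>y\<in>B. ip A (\<lambda>x. f (x, y)) (\<lambda>x. g (x, y)))"
  unfolding ip_def sum.cartesian_product' by (subst sum.swap) simp

lemma sqnorm_scale: "sqnorm A (\<lambda>x. c * f x) = (cmod c)\<^sup>2 * sqnorm A f"
  by (simp add: sqnorm_def norm_mult power_mult_distrib sum_distrib_left)

lemma sqnorm_bits_append:
  "sqnorm (bits (a + b)) (\<lambda>w. f (take a w) * g (drop a w)) = sqnorm (bits a) f * sqnorm (bits b) g"
proof -
  have "sqnorm (bits (a + b)) (\<lambda>w. f (take a w) * g (drop a w)) = (\<Sum>x\<in>bits a. \<Sum>y\<in>bits b. (cmod (f x))\<^sup>2 * (cmod (g y))\<^sup>2)"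
    unfolding sqnorm_def sum_bits_append by (intro sum.cong refl) (auto simp: bits_def norm_mult power_mult_distrib)
  then show ?thesis by (simp add: sqnorm_def sum_product)
qed

text \<open>
  The opening amplitudes \<open>a\<close> for \<open>\<psi>\<close> define the (unnormalised) vector \<open>V\<^sup>\<dagger>(a \<otimes> \<psi>)\<close>
  whose inner product with \<open>\<Psi>\<close> is the opening probability.
\<close>

locale reveal =
  fixes e r c :: nat and V :: op and \<Psi> \<psi> :: ket
  assumes V: "unitary_op (e + r) V"
begin

definition amp :: "bool list \<Rightarrow> complex" where
  "amp u = ip (bits (r + c)) \<psi> (\<lambda>x. op_apply (e + r + c) (op_tensor (e + r) V id_op) \<Psi> (u @ x))"

definition prob :: real where "prob = sqnorm (bits e) amp"

definition vec :: "bool list \<times> bool list \<Rightarrow> complex" where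
  "vec = (\<lambda>(w, y). adj_apply (e + r) V (\<lambda>w. amp (take e w) * \<psi> (drop e w @ y)) w)"

text \<open>For normalised \<open>\<psi>\<close>, \<open>vec\<close> is the image of
  \<open>\<Psi>\<close> under the projection onto the accepted states, pulled back by
  \<open>V\<close>. Therefore the inner product with \<open>\<Psi>\<close> and, in the next lemma,
  the squared norm both equal the probability.\<close>

lemma ip_vec: "ip (bits (e + r) \<times> bits c) vec (\<lambda>(w, y). \<Psi> (w @ y)) = prob"
proof -
  have "ip (bits (e + r) \<times> bits c) vec (\<lambda>(w, y). \<Psi> (w @ y)) =
    (\<Sum>y\<in>bits c. ip (bits (e + r)) (\<lambda>w. amp (take e w) * \<psi> (drop e w @ y)) (op_apply (e + r) V (\<lambda>w. \<Psi> (w @ y))))"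
    unfolding ip_product' by (simp add: vec_def ip_adj_apply_left)
  also have "\<dots> = (\<Sum>y\<in>bits c. \<Sum>u\<in>bits e. \<Sum>x\<in>bits r. cnj (amp u * \<psi> (x @ y)) *
      op_apply (e + r + c) (op_tensor (e + r) V id_op) \<Psi> (u @ x @ y))"
    unfolding ip_def sum_bits_append
    by (intro sum.cong refl) (auto simp: bits_def op_apply_tensor_id[unfolded bits_def, symmetric])
  also have "\<dots> = (\<Sum>u\<in>bits e. \<Sum>y\<in>bits c. \<Sum>x\<in>bits r. cnj (amp u * \<psi> (x @ y)) *
      op_apply (e + r + c) (op_tensor (e + r) V id_op) \<Psi> (u @ x @ y))"
    by (rule sum.swap)
  also have "\<dots> = (\<Sum>u\<in>bits e. \<Sum>x\<in>bits r. \<Sum>y\<in>bits c. cnj (amp u * \<psi> (x @ y)) *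
      op_apply (e + r + c) (op_tensor (e + r) V id_op) \<Psi> (u @ x @ y))"
    by (intro sum.cong refl sum.swap)
  also have "\<dots> = (\<Sum>u\<in>bits e. cnj (amp u) * amp u)"
  proof (intro sum.cong refl)
    fix u
    have "amp u = (\<Sum>x\<in>bits r. \<Sum>y\<in>bits c. cnj (\<psi> (x @ y)) * op_apply (e + r + c) (op_tensor (e + r) V id_op) \<Psi> (u @ x @ y))"
      by (simp add: amp_def ip_def sum_bits_append)
    then have "cnj (amp u) * amp u = cnj (amp u) * \<dots>" by simp
    then show "(\<Sum>x\<in>bits r. \<Sum>y\<in>bits c. cnj (amp u * \<psi> (x @ y)) * op_apply (e + r + c) (op_tensor (e + r) V id_op) \<Psi> (u @ x @ y)) = cnj (amp u) * amp u"
      by (simp add: sum_distrib_left mult_ac)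
  qed
  also have "\<dots> = prob" unfolding prob_def ip_self[symmetric] by (simp add: ip_def)
  finally show ?thesis .
qed

lemma sqnorm_vec: 
  assumes "sqnorm (bits (r + c)) \<psi> = 1"
  shows "sqnorm (bits (e + r) \<times> bits c) vec = prob"
proof -
  have "sqnorm (bits (e + r) \<times> bits c) vec = (\<Sum>y\<in>bits c. sqnorm (bits (e + r)) (\<lambda>w. amp (take e w) * \<psi> (drop e w @ y)))"
    unfolding sqnorm_product' by (simp add: vec_def sqnorm_adj_apply[OF V])
  also have "\<dots> = (\<Sum>y\<in>bits c. prob * sqnorm (bits r) (\<lambda>x. \<psi> (x @ y)))"
    by (simp add: sqnorm_bits_append[of e r amp "\<lambda>x. \<psi> (x @ _)"] prob_def)
  also have "\<dots> = prob * sqnorm (bits (r + c)) \<psi>"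
    unfolding sum_distrib_left[symmetric] sqnorm_def sum_bits_append by (subst sum.swap) simp
  finally show ?thesis using assms by simp
qed

end


lemma adj_apply_cong: "(\<And>w. w \<in> bits n \<Longrightarrow> f w = g w) \<Longrightarrow> adj_apply n V f = adj_apply n V g"
  by (simp add: adj_apply_def)

lemma adj_apply_sum: "adj_apply n V (\<lambda>w. a * (\<Sum>k\<in>A. d k * f k w)) = (\<lambda>w'. a * (\<Sum>k\<in>A. d k * adj_apply n V (f k) w'))"
  unfolding adj_apply_def sum_distrib_left by (subst sum.swap) (simp add: mult_ac)

lemma ip_sum_left: "ip I (\<lambda>x. a * (\<Sum>k\<in>A. d k * f k x)) g = cnj a * (\<Sum>k\<in>A. cnj (d k) * ip I (f k) g)"
  unfolding ip_def cnj_sum complex_cnj_mult sum_distrib_left sum_distrib_right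
  by (subst sum.swap) (simp add: mult_ac)

lemma ip_sum_right: "ip I g (\<lambda>x. a * (\<Sum>k\<in>A. d k * f k x)) = a * (\<Sum>k\<in>A. d k * ip I g (f k))"
  unfolding ip_def sum_distrib_left by (subst sum.swap) (simp add: mult_ac)

text \<open>Let \<open>v\<close> and \<open>w\<close> be the vectors of the two openings and
  \<open>S\<close> the sum of the probabilities \<open>p\<close> and \<open>q\<close>.
  Cauchy-Schwarz against \<open>\<Psi>\<close> gives
  \<open>S^2 \<le> |v + w|^2 = S + 2 Re <v, w>\<close>. The inner product has one term for each of
  the \<open>2^n\<close> keys, and unitarity bounds each by \<open>sqrt (p q)\<close> up to the
  normalisation. By the inequality of the means, \<open>2 |<v, w>| \<le> \<delta> S\<close>, and
  \<open>S\<close> cancels.\<close>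

theorem sum_binding_bound:
  fixes e r c n :: nat and V\<^sub>0 V\<^sub>1 :: op and \<Psi> \<psi>\<^sub>0 \<psi>\<^sub>1 :: ket
  assumes V: "unitary_op (e + r) V\<^sub>0" "unitary_op (e + r) V\<^sub>1"
    and \<Psi>: "sqnorm (bits (e + r + c)) \<Psi> = 1"
    and \<psi>: "sqnorm (bits (r + c)) \<psi>\<^sub>0 = 1" "sqnorm (bits (r + c)) \<psi>\<^sub>1 = 1"
    and \<psi>\<^sub>0: "\<And>x y. x \<in> bits r \<Longrightarrow> y \<in> bits c \<Longrightarrow> \<psi>\<^sub>0 (x @ y) = N\<^sub>0 * (\<Sum>k\<in>bits n. if x = \<xi>\<^sub>0 k then \<phi> k y else 0)"
    and \<psi>\<^sub>1: "\<And>x y. x \<in> bits r \<Longrightarrow> y \<in> bits c \<Longrightarrow> \<psi>\<^sub>1 (x @ y) = N\<^sub>1 * (\<Sum>k\<in>bits c. if x = \<xi>\<^sub>1 k then basis_ket k y else 0)"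
    and \<xi>: "\<xi>\<^sub>0 ` bits n \<subseteq> bits r" "inj_on \<xi>\<^sub>1 (bits c)" "\<xi>\<^sub>1 ` bits c \<subseteq> bits r"
    and \<phi>: "\<And>k. k \<in> bits n \<Longrightarrow> sqnorm (bits c) (\<phi> k) = 1"
  shows "reveal.prob e r c V\<^sub>0 \<Psi> \<psi>\<^sub>0 + reveal.prob e r c V\<^sub>1 \<Psi> \<psi>\<^sub>1 \<le> 1 + cmod N\<^sub>0 * cmod N\<^sub>1 * 2 ^ n"
proof -
  interpret A: reveal e r c V\<^sub>0 \<Psi> \<psi>\<^sub>0 by unfold_locales (rule V)
  interpret B: reveal e r c V\<^sub>1 \<Psi> \<psi>\<^sub>1 by unfold_locales (rule V)
  define J where "J = bits (e + r) \<times> bits c"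
  define \<delta> where "\<delta> = cmod N\<^sub>0 * cmod N\<^sub>1 * 2 ^ n"
  define v where "v k w = A.amp (take e w) * (if drop e w = \<xi>\<^sub>0 k then 1 else 0)" for k w
  define v' where "v' y w = B.amp (take e w) * (if drop e w = \<xi>\<^sub>1 y then 1 else 0)" for y w
  \<comment> \<open>Contracting the register \<open>C\<close> of a maximally entangled state with
    \<open>\<phi> k\<close> leaves the conjugate of \<open>\<phi> k\<close> on \<open>R\<close>,
    again of norm 1. The factor 1 matches the form of \<open>adj_apply_sum\<close>.\<close>
  define Z where "Z k w = 1 * (\<Sum>y\<in>bits c. cnj (\<phi> k y) * v' y w)" for k w
  have p0: "A.prob \<ge> 0" "B.prob \<ge> 0" by (simp_all add: A.prob_def B.prob_def)
  have splitw: "take e w \<in> bits e" "drop e w \<in> bits r" if "w \<in> bits (e + r)" for w using that by (auto simp: bits_def)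
  have vecA: "A.vec (w', y) = N\<^sub>0 * (\<Sum>k\<in>bits n. \<phi> k y * adj_apply (e + r) V\<^sub>0 (v k) w')" if "y \<in> bits c" for w' y
  proof -
    have "adj_apply (e + r) V\<^sub>0 (\<lambda>w. A.amp (take e w) * \<psi>\<^sub>0 (drop e w @ y)) = adj_apply (e + r) V\<^sub>0 (\<lambda>w. N\<^sub>0 * (\<Sum>k\<in>bits n. \<phi> k y * v k w))"
      using that splitw by (intro adj_apply_cong) (auto simp: \<psi>\<^sub>0 v_def sum_distrib_left mult_ac intro!: sum.cong)
    then show ?thesis unfolding adj_apply_sum by (simp add: A.vec_def)
  qed
  have vecB: "B.vec (w', y) = N\<^sub>1 * (\<Sum>k\<in>{y}. 1 * adj_apply (e + r) V\<^sub>1 (v' k) w')" if "y \<in> bits c" for w' y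
  proof -
    have "(\<Sum>k\<in>bits c. if x = \<xi>\<^sub>1 k then basis_ket k y else 0) = (if x = \<xi>\<^sub>1 y then 1 else 0)" for x
    proof -
      have "(\<Sum>k\<in>bits c. if x = \<xi>\<^sub>1 k then basis_ket k y else 0) = (\<Sum>k\<in>bits c. if y = k then (if x = \<xi>\<^sub>1 k then 1 else 0) else 0)"
        by (intro sum.cong) (auto simp: basis_ket_def)
      then show ?thesis using that by simp
    qed
    then have "adj_apply (e + r) V\<^sub>1 (\<lambda>w. B.amp (take e w) * \<psi>\<^sub>1 (drop e w @ y)) = adj_apply (e + r) V\<^sub>1 (\<lambda>w. N\<^sub>1 * (\<Sum>k\<in>{y}. 1 * v' k w))"
      using that splitw by (intro adj_apply_cong) (auto simp: \<psi>\<^sub>1 v'_def)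
    then show ?thesis unfolding adj_apply_sum by (simp add: B.vec_def)
  qed
  have "ip J A.vec B.vec = (\<Sum>y\<in>bits c. ip (bits (e + r)) (\<lambda>w'. N\<^sub>0 * (\<Sum>k\<in>bits n. \<phi> k y * adj_apply (e + r) V\<^sub>0 (v k) w'))
      (\<lambda>w'. N\<^sub>1 * (\<Sum>k\<in>{y}. 1 * adj_apply (e + r) V\<^sub>1 (v' k) w')))"
    unfolding J_def ip_product' by (intro sum.cong refl) (simp add: vecA vecB)
  also have "\<dots> = (\<Sum>y\<in>bits c. \<Sum>k\<in>bits n. cnj N\<^sub>0 * N\<^sub>1 * (cnj (\<phi> k y) * ip (bits (e + r)) (adj_apply (e + r) V\<^sub>0 (v k)) (adj_apply (e + r) V\<^sub>1 (v' y))))"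
    unfolding ip_sum_left ip_sum_right by (simp add: sum_distrib_left mult_ac)
  also have "\<dots> = (\<Sum>k\<in>bits n. \<Sum>y\<in>bits c. cnj N\<^sub>0 * N\<^sub>1 * (cnj (\<phi> k y) * ip (bits (e + r)) (adj_apply (e + r) V\<^sub>0 (v k)) (adj_apply (e + r) V\<^sub>1 (v' y))))"
    by (rule sum.swap)
  also have "\<dots> = cnj N\<^sub>0 * N\<^sub>1 * (\<Sum>k\<in>bits n. ip (bits (e + r)) (adj_apply (e + r) V\<^sub>0 (v k)) (adj_apply (e + r) V\<^sub>1 (Z k)))"
    unfolding Z_def adj_apply_sum ip_sum_right by (simp add: sum_distrib_left mult_ac)
  finally have ipJ: "ip J A.vec B.vec = \<dots>" .
  have cs: "cmod (ip (bits (e + r)) (adj_apply (e + r) V\<^sub>0 (v k)) (adj_apply (e + r) V\<^sub>1 (Z k))) \<le> sqrt (A.prob * B.prob)"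
    if k: "k \<in> bits n" for k
  proof -
    have "sqnorm (bits r) (\<lambda>x. if x = \<xi>\<^sub>0 k then 1 else 0) = (\<Sum>x\<in>bits r. if x = \<xi>\<^sub>0 k then 1 else 0)"
      unfolding sqnorm_def by (intro sum.cong) auto
    also have "\<dots> = 1" using k \<xi>(1) by auto
    finally have "sqnorm (bits r) (\<lambda>x. if x = \<xi>\<^sub>0 k then 1 else 0) = 1" .
    then have v: "sqnorm (bits (e + r)) (v k) = A.prob"
      using sqnorm_bits_append[of e r A.amp "\<lambda>x. if x = \<xi>\<^sub>0 k then 1 else 0"]
      by (simp add: A.prob_def v_def[abs_def])
    have "Z k w = B.amp (take e w) * (\<Sum>y\<in>bits c. if drop e w = \<xi>\<^sub>1 y then cnj (\<phi> k y) else 0)" for w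
      unfolding Z_def v'_def by (simp add: sum_distrib_left mult_ac if_distrib cong: if_cong)
    then have "sqnorm (bits (e + r)) (Z k) = B.prob * sqnorm (bits r) (\<lambda>x. \<Sum>y\<in>bits c. if x = \<xi>\<^sub>1 y then cnj (\<phi> k y) else 0)"
      using sqnorm_bits_append[of e r B.amp "\<lambda>x. \<Sum>y\<in>bits c. if x = \<xi>\<^sub>1 y then cnj (\<phi> k y) else 0"]
      by (simp add: B.prob_def sqnorm_def)
    also have "\<dots> = B.prob"
      using \<phi>[OF k] \<xi>(2,3) by (subst sqnorm_inj) (auto simp: sqnorm_def)
    finally have Z: "sqnorm (bits (e + r)) (Z k) = B.prob" .
    show ?thesis
      using ip_Cauchy_Schwarz[of "bits (e + r)" "adj_apply (e + r) V\<^sub>0 (v k)" "adj_apply (e + r) V\<^sub>1 (Z k)"]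
      unfolding sqnorm_adj_apply[OF V(1)] sqnorm_adj_apply[OF V(2)] v Z by (rule real_le_rsqrt)
  qed
  have "cmod (ip J A.vec B.vec) \<le> cmod N\<^sub>0 * cmod N\<^sub>1 * (\<Sum>k\<in>bits n. sqrt (A.prob * B.prob))"
    unfolding ipJ norm_mult complex_mod_cnj by (intro mult_left_mono order.trans[OF norm_sum] sum_mono cs) auto
  also have "\<dots> = \<delta> * sqrt (A.prob * B.prob)" by (simp add: \<delta>_def card_bits)
  also have "\<dots> \<le> \<delta> * ((A.prob + B.prob) / 2)"
    using p0 by (intro mult_left_mono arith_geo_mean_sqrt) (auto simp: \<delta>_def)
  finally have cross: "2 * cmod (ip J A.vec B.vec) \<le> \<delta> * (A.prob + B.prob)" by simp
  define S where "S = A.prob + B.prob"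
  define P where "P = (\<lambda>(w, y). \<Psi> (w @ y))"
  have nP: "sqnorm J P = 1"
    using \<Psi> unfolding J_def P_def sqnorm_product by (simp add: sqnorm_def sum_bits_append[of _ "e + r" c])
  have "ip J (\<lambda>x. A.vec x + B.vec x) P = of_real S"
    using A.ip_vec B.ip_vec unfolding S_def J_def P_def by (simp add: ip_def sum.distrib algebra_simps)
  then have "S\<^sup>2 \<le> sqnorm J (\<lambda>x. A.vec x + B.vec x)"
    using ip_Cauchy_Schwarz[of J "\<lambda>x. A.vec x + B.vec x" P] nP by simp
  also have "\<dots> = S + 2 * Re (ip J A.vec B.vec)"
    unfolding sqnorm_add S_def J_def by (simp add: A.sqnorm_vec[OF \<psi>(1)] B.sqnorm_vec[OF \<psi>(2)])
  also have "\<dots> \<le> S + \<delta> * S" using cross complex_Re_le_cmod[of "ip J A.vec B.vec"] unfolding S_def by simp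
  finally have "S * S \<le> (1 + \<delta>) * S" by (simp add: power2_eq_square algebra_simps)
  moreover have "S \<ge> 0" "\<delta> \<ge> 0" using p0 by (auto simp: S_def \<delta>_def)
  ultimately have "S \<le> 1 + \<delta>" by (cases "S = 0") auto
  then show ?thesis by (simp add: S_def \<delta>_def)
qed

subsection \<open>Existence of the Haar measure\<close>

definition cspace :: "nat \<Rightarrow> ket measure" where
  "cspace m = (\<Pi>\<^sub>M x\<in>bits m. (borel :: complex measure))"

text \<open>Translation invariance is inherited from the factors. Unitary operators mix the
  coordinates, so invariance under them needs an argument of its own.\<close>

definition leb :: "nat \<Rightarrow> ket measure" where
  "leb m = (\<Pi>\<^sub>M x\<in>bits m. (lborel :: complex measure))"

definition act :: "nat \<Rightarrow> op \<Rightarrow> ket \<Rightarrow> ket" where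
  "act m U \<psi> = restrict (op_apply m U \<psi>) (bits m)"

definition shift :: "nat \<Rightarrow> ket \<Rightarrow> ket \<Rightarrow> ket" where
  "shift m v \<psi> = (\<lambda>x\<in>bits m. \<psi> x + v x)"

lemma sets_leb [measurable_cong, simp]: "sets (leb m) = sets (cspace m)"
  unfolding leb_def cspace_def by (intro sets_PiM_cong) auto

lemma space_leb: "space (leb m) = (\<Pi>\<^sub>E x\<in>bits m. UNIV)"
  by (simp add: leb_def space_PiM)

interpretation lborel_prod: product_sigma_finite "\<lambda>_ :: bool list. lborel :: complex measure"
  by unfold_locales

lemma sigma_finite_leb: "sigma_finite_measure (leb m)"
  unfolding leb_def by (rule lborel_prod.sigma_finite) simp

lemma measurable_component_cspace [measurable]: "x \<in> bits m \<Longrightarrow> (\<lambda>\<psi>. \<psi> x) \<in> borel_measurable (cspace m)"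
  unfolding cspace_def by (rule measurable_component_singleton)

lemma measurable_cspaceI:
  assumes "\<And>x. x \<in> bits m \<Longrightarrow> (\<lambda>w. f w x) \<in> borel_measurable M"
  shows "(\<lambda>w. restrict (f w) (bits m)) \<in> measurable M (cspace m)"
  unfolding cspace_def by (rule measurable_restrict) (use assms in auto)

lemma measurable_act [measurable]: "act m U \<in> measurable (cspace m) (cspace m)"
  unfolding act_def[abs_def] op_apply_def[abs_def] by (rule measurable_cspaceI) measurable

lemma measurable_shift_pair [measurable]:
  assumes "f \<in> measurable M (cspace m)" "g \<in> measurable M (cspace m)"
  shows "(\<lambda>w. shift m (f w) (g w)) \<in> measurable M (cspace m)"
  unfolding shift_def[abs_def]
proof (rule measurable_cspaceI)
  fix x assume x: "x \<in> bits m"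
  have "(\<lambda>w. f w x) \<in> borel_measurable M" "(\<lambda>w. g w x) \<in> borel_measurable M"
    using measurable_compose[OF assms(1) measurable_component_cspace[OF x]] measurable_compose[OF assms(2) measurable_component_cspace[OF x]] by auto
  then show "(\<lambda>w. g w x + f w x) \<in> borel_measurable M" by measurable
qed

lemma distr_shift: "distr (leb m) (leb m) (shift m v) = leb m"
  unfolding leb_def
proof (rule lborel_prod.PiM_eqI)
  fix A :: "bool list \<Rightarrow> complex set" assume A: "\<And>i. i \<in> bits m \<Longrightarrow> A i \<in> sets lborel"
  have meas: "shift m v \<in> measurable (Pi\<^sub>M (bits m) (\<lambda>_. lborel)) (Pi\<^sub>M (bits m) (\<lambda>_. lborel :: complex measure))"
    unfolding shift_def[abs_def] by (rule measurable_restrict) measurable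
  have "emeasure (distr (Pi\<^sub>M (bits m) (\<lambda>_. lborel)) (Pi\<^sub>M (bits m) (\<lambda>_. lborel)) (shift m v)) (Pi\<^sub>E (bits m) A) =
    emeasure (Pi\<^sub>M (bits m) (\<lambda>_. lborel)) (Pi\<^sub>E (bits m) (\<lambda>x. (\<lambda>z. z + v x) -` A x))"
  proof -
    have S: "Pi\<^sub>E (bits m) A \<in> sets (Pi\<^sub>M (bits m) (\<lambda>_. lborel))" using A by (intro sets_PiM_I_finite) auto
    show ?thesis unfolding emeasure_distr[OF meas S]
      by (rule arg_cong[where f = "emeasure _"]) (auto simp: shift_def space_PiM PiE_def Pi_def extensional_def)
  qed
  also have "\<dots> = (\<Prod>x\<in>bits m. emeasure lborel ((\<lambda>z. z + v x) -` A x))"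
  proof (rule lborel_prod.emeasure_PiM)
    fix x assume "x \<in> bits m"
    then show "(\<lambda>z. z + v x) -` A x \<in> sets lborel"
      using measurable_sets_borel[of "\<lambda>z. z + v x" borel "A x"] A by simp
  qed simp
  also have "\<dots> = (\<Prod>x\<in>bits m. emeasure lborel (A x))"
  proof (intro prod.cong refl)
    fix x assume "x \<in> bits m"
    then have "emeasure (distr lborel borel ((+) (v x))) (A x) = emeasure lborel ((\<lambda>z. z + v x) -` A x)"
      using A by (subst emeasure_distr) (auto simp: add.commute[of _ "v x"])
    then show "emeasure lborel ((\<lambda>z. z + v x) -` A x) = emeasure lborel (A x)"
      by (simp add: lborel_distr_plus)
  qed
  finally show "emeasure (distr (Pi\<^sub>M (bits m) (\<lambda>_. lborel)) (Pi\<^sub>M (bits m) (\<lambda>_. lborel)) (shift m v)) (Pi\<^sub>E (bits m) A) = (\<Prod>i\<in>bits m. emeasure lborel (A i))" .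
qed auto


lemma measurable_shift [measurable]: "shift m v \<in> measurable (cspace m) (cspace m)"
proof -
  have "(\<lambda>\<psi>. shift m (restrict v (bits m)) \<psi>) \<in> measurable (cspace m) (cspace m)"
    by (rule measurable_shift_pair) (auto simp: cspace_def space_PiM intro!: measurable_const)
  moreover have "shift m (restrict v (bits m)) = shift m v" by (auto simp: shift_def fun_eq_iff restrict_def)
  ultimately show ?thesis by simp
qed

lemma measurable_leb: "measurable (leb m) M = measurable (cspace m) M" "measurable M (leb m) = measurable M (cspace m)"
  by (auto intro!: measurable_cong_sets)

lemma nn_integral_shift:
  assumes "f \<in> borel_measurable (cspace m)"
  shows "(\<integral>\<^sup>+\<psi>. f (shift m v \<psi>) \<partial>leb m) = (\<integral>\<^sup>+\<psi>. f \<psi> \<partial>leb m)"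
proof -
  have "(\<integral>\<^sup>+\<psi>. f (shift m v \<psi>) \<partial>leb m) = (\<integral>\<^sup>+\<psi>. f \<psi> \<partial>distr (leb m) (leb m) (shift m v))"
    by (rule nn_integral_distr[symmetric]) (use assms in \<open>auto simp: measurable_leb\<close>)
  then show ?thesis by (simp add: distr_shift)
qed

definition wt :: "nat \<Rightarrow> ket \<Rightarrow> real" where
  "wt m \<psi> = sqnorm (bits m) \<psi>"

lemma measurable_wt [measurable]: "wt m \<in> borel_measurable (cspace m)"
  unfolding wt_def[abs_def] sqnorm_def by measurable

lemma sqnorm_restrict: "sqnorm I (restrict f I) = sqnorm I f"
  by (simp add: sqnorm_def)

lemma unitary_adj: "unitary_op m U \<Longrightarrow> unitary_op m (adj U)"
  by (auto simp: unitary_op_def adj_def op_mult_def)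

lemma adj_apply_eq: "adj_apply m U = op_apply m (adj U)"
  by (simp add: adj_apply_def op_apply_def adj_def fun_eq_iff)

lemma adj_adj [simp]: "adj (adj U) = U"
  by (simp add: adj_def)

lemma sqnorm_op_apply: "unitary_op m U \<Longrightarrow> sqnorm (bits m) (op_apply m U \<psi>) = sqnorm (bits m) \<psi>"
  using sqnorm_adj_apply[OF unitary_adj, of m U \<psi>] by (simp add: adj_apply_eq)

lemma wt_act: "unitary_op m U \<Longrightarrow> wt m (act m U \<psi>) = wt m \<psi>"
  by (simp add: wt_def act_def sqnorm_restrict sqnorm_op_apply)

lemma op_apply_op_apply:
  assumes "\<And>x y. x \<in> bits m \<Longrightarrow> y \<in> bits m \<Longrightarrow> op_mult m A B x y = id_op x y" "x \<in> bits m"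
  shows "op_apply m A (op_apply m B \<psi>) x = \<psi> x"
proof -
  have "op_apply m A (op_apply m B \<psi>) x = (\<Sum>z\<in>bits m. op_mult m A B x z * \<psi> z)"
    unfolding op_apply_def op_mult_def sum_distrib_left sum_distrib_right
    by (subst sum.swap) (simp add: mult_ac)
  also have "\<dots> = (\<Sum>z\<in>bits m. if x = z then \<psi> z else 0)"
    using assms by (intro sum.cong) (auto simp: id_op_def)
  finally show ?thesis using assms(2) by simp
qed

lemma op_apply_cong: "(\<And>x. x \<in> bits m \<Longrightarrow> \<psi> x = \<phi> x) \<Longrightarrow> op_apply m U \<psi> = op_apply m U \<phi>"
  by (simp add: op_apply_def)

lemma op_apply_add: "op_apply m U (\<lambda>x. \<psi> x + \<phi> x) = (\<lambda>x. op_apply m U \<psi> x + op_apply m U \<phi> x)"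
  by (simp add: op_apply_def algebra_simps sum.distrib fun_eq_iff)

lemma act_shift:
  assumes "unitary_op m U"
  shows "act m U (shift m (op_apply m (adj U) v) \<psi>) = shift m v (act m U \<psi>)"
proof -
  have "op_apply m U (shift m (op_apply m (adj U) v) \<psi>) x = op_apply m U \<psi> x + v x" if "x \<in> bits m" for x
  proof -
    have "op_apply m U (shift m (op_apply m (adj U) v) \<psi>) = op_apply m U (\<lambda>x. \<psi> x + op_apply m (adj U) v x)"
      by (rule op_apply_cong) (simp add: shift_def)
    then show ?thesis
      using assms that by (simp add: op_apply_add op_apply_op_apply unitary_op_def)
  qed
  then show ?thesis by (auto simp: act_def shift_def fun_eq_iff)
qed

text \<open>
  Uniqueness of translation-invariant measures, with the unit shell as test function: for all
  \<open>f\<close> and \<open>g\<close>, \<open>\<integral>f(Ux) dx \<cdot> \<integral>g = \<integral>f \<cdot> \<integral>g(-Ux) dx\<close> by Fubini and two translations.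
\<close>

lemma nn_integral_act_mult:
  fixes f g :: "ket \<Rightarrow> ennreal"
  assumes U: "unitary_op m U" and f [measurable]: "f \<in> borel_measurable (cspace m)" and g [measurable]: "g \<in> borel_measurable (cspace m)"
  defines "neg \<equiv> \<lambda>v x. - v x"
  shows "(\<integral>\<^sup>+x. f (act m U x) \<partial>leb m) * (\<integral>\<^sup>+y. g y \<partial>leb m) =
    (\<integral>\<^sup>+y. f y \<partial>leb m) * (\<integral>\<^sup>+x. g (restrict (neg (act m U x)) (bits m)) \<partial>leb m)"
proof -
  interpret S: sigma_finite_measure "leb m" by (rule sigma_finite_leb)
  interpret P: pair_sigma_finite "leb m" "leb m" ..
  have neg [measurable]: "(\<lambda>w. restrict (neg (h w)) (bits m)) \<in> measurable M (cspace m)" if h [measurable]: "h \<in> measurable M (cspace m)" for h :: "'z \<Rightarrow> ket" and M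
  proof (rule measurable_cspaceI)
    fix x assume x: "x \<in> bits m"
    have "(\<lambda>w. h w x) \<in> borel_measurable M" using measurable_compose[OF h measurable_component_cspace[OF x]] .
    then show "(\<lambda>w. neg (h w) x) \<in> borel_measurable M" by (simp add: neg_def)
  qed
  have sn: "shift m (neg v) = shift m (restrict (neg v) (bits m))" for v by (auto simp: shift_def fun_eq_iff)
  have meas1: "(\<lambda>(x, y). f (act m U x) * g (shift m (neg (act m U x)) y)) \<in> borel_measurable (leb m \<Otimes>\<^sub>M leb m)"
  proof -
    have [measurable]: "fst \<in> measurable (leb m \<Otimes>\<^sub>M leb m) (cspace m)" "snd \<in> measurable (leb m \<Otimes>\<^sub>M leb m) (cspace m)"
      using measurable_fst[of "leb m" "leb m"] measurable_snd[of "leb m" "leb m"] by (simp_all add: measurable_leb)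
    show ?thesis unfolding sn split_beta' by measurable
  qed
  have meas2: "(\<lambda>(x, y). f (shift m (act m U x) y) * g (restrict (neg (act m U x)) (bits m))) \<in> borel_measurable (leb m \<Otimes>\<^sub>M leb m)"
  proof -
    have [measurable]: "fst \<in> measurable (leb m \<Otimes>\<^sub>M leb m) (cspace m)" "snd \<in> measurable (leb m \<Otimes>\<^sub>M leb m) (cspace m)"
      using measurable_fst[of "leb m" "leb m"] measurable_snd[of "leb m" "leb m"] by (simp_all add: measurable_leb)
    show ?thesis unfolding split_beta' by measurable
  qed
  have "(\<integral>\<^sup>+x. f (act m U x) \<partial>leb m) * (\<integral>\<^sup>+y. g y \<partial>leb m) = (\<integral>\<^sup>+x. f (act m U x) * (\<integral>\<^sup>+y. g y \<partial>leb m) \<partial>leb m)"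
    by (rule nn_integral_multc[symmetric]) (simp add: measurable_leb)
  \<comment> \<open>The integral of \<open>g\<close> is replaced by that of its translate by
    \<open>- U x\<close>.\<close>
  also have "\<dots> = (\<integral>\<^sup>+x. (\<integral>\<^sup>+y. f (act m U x) * g (shift m (neg (act m U x)) y) \<partial>leb m) \<partial>leb m)"
    by (intro nn_integral_cong, subst nn_integral_cmult) (simp_all add: measurable_leb nn_integral_shift)
  also have "\<dots> = (\<integral>\<^sup>+y. (\<integral>\<^sup>+x. f (act m U x) * g (shift m (neg (act m U x)) y) \<partial>leb m) \<partial>leb m)"
    by (rule P.Fubini'[OF meas1, symmetric])
  also have "\<dots> = (\<integral>\<^sup>+y. (\<integral>\<^sup>+x. f (shift m (act m U x) y) * g (restrict (neg (act m U x)) (bits m)) \<partial>leb m) \<partial>leb m)"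
  proof (rule nn_integral_cong)
    fix y assume y: "y \<in> space (leb m)"
    have [measurable]: "(\<lambda>x. y) \<in> measurable (cspace m) (cspace m)"
      using y sets_eq_imp_space_eq[OF sets_leb] by (intro measurable_const) auto
    have "(\<lambda>x. f (act m U x) * g (shift m (neg (act m U x)) y)) \<in> borel_measurable (cspace m)"
      unfolding sn by measurable
    \<comment> \<open>Translating \<open>x\<close> by the adjoint of \<open>U\<close> applied to
      \<open>y\<close> turns \<open>U x\<close> into \<open>U x + y\<close>, so that the argument of
      \<open>g\<close> becomes \<open>- U x\<close>.\<close>
    from nn_integral_shift[OF this, of "op_apply m (adj U) y"]
    have "(\<integral>\<^sup>+x. f (act m U x) * g (shift m (neg (act m U x)) y) \<partial>leb m) =
      (\<integral>\<^sup>+x. f (shift m y (act m U x)) * g (shift m (neg (shift m y (act m U x))) y) \<partial>leb m)"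
      by (simp add: act_shift[OF U])
    moreover have "shift m y a = shift m a y" "shift m (neg (shift m y a)) y = restrict (neg a) (bits m)" for a
      by (auto simp: shift_def neg_def fun_eq_iff)
    ultimately show "(\<integral>\<^sup>+x. f (act m U x) * g (shift m (neg (act m U x)) y) \<partial>leb m) =
      (\<integral>\<^sup>+x. f (shift m (act m U x) y) * g (restrict (neg (act m U x)) (bits m)) \<partial>leb m)"
      by (simp only:)
  qed
  also have "\<dots> = (\<integral>\<^sup>+x. (\<integral>\<^sup>+y. f (shift m (act m U x) y) * g (restrict (neg (act m U x)) (bits m)) \<partial>leb m) \<partial>leb m)"
    by (rule P.Fubini'[OF meas2])
  also have "\<dots> = (\<integral>\<^sup>+x. (\<integral>\<^sup>+y. f y \<partial>leb m) * g (restrict (neg (act m U x)) (bits m)) \<partial>leb m)"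
    by (intro nn_integral_cong, subst nn_integral_multc) (simp_all add: measurable_leb nn_integral_shift)
  also have "\<dots> = (\<integral>\<^sup>+y. f y \<partial>leb m) * (\<integral>\<^sup>+x. g (restrict (neg (act m U x)) (bits m)) \<partial>leb m)"
    by (rule nn_integral_cmult) (simp add: measurable_leb)
  finally show ?thesis .
qed


text \<open>Invariant under unitary operators and negation, of positive finite measure, and away
  from the origin, so that its vectors can be normalised. The 5 leaves room for one unit square per
  coordinate on which the squared modulus lies between 1 and 5.\<close>

definition shell :: "nat \<Rightarrow> ket set" where
  "shell m = {\<psi> \<in> space (leb m). 1 \<le> wt m \<psi> \<and> wt m \<psi> \<le> 5 * 2 ^ m}"

lemma space_cspace: "space (cspace m) = space (leb m)"
  using sets_eq_imp_space_eq[OF sets_leb] by simp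

lemma shell_sets [measurable]: "shell m \<in> sets (leb m)"
proof -
  have "{\<psi> \<in> space (cspace m). 1 \<le> wt m \<psi> \<and> wt m \<psi> \<le> 5 * 2 ^ m} \<in> sets (cspace m)" by measurable
  then show ?thesis by (simp add: shell_def space_cspace)
qed

lemma emeasure_shell: "emeasure (leb m) (shell m) \<noteq> 0" "emeasure (leb m) (shell m) \<noteq> \<infinity>"
proof -
  define Q where "Q = cbox (1 :: complex) (2 + \<i>)"
  have Q: "1 \<le> (cmod z)\<^sup>2" "(cmod z)\<^sup>2 \<le> 5" if "z \<in> Q" for z
  proof -
    have z: "1 \<le> Re z" "Re z \<le> 2" "0 \<le> Im z" "Im z \<le> 1" using that by (auto simp: Q_def in_cbox_complex_iff)
    have "1 \<le> (Re z)\<^sup>2" "(Re z)\<^sup>2 \<le> 4" "(Im z)\<^sup>2 \<le> 1"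
      using z power_mono[of 1 "Re z" 2] power_mono[of "Re z" 2 2] power_mono[of "Im z" 1 2] by auto
    then show "1 \<le> (cmod z)\<^sup>2" "(cmod z)\<^sup>2 \<le> 5" by (auto simp: cmod_power2 intro: add_increasing2)
  qed
  have eQ: "emeasure lborel Q = 1"
    by (simp add: Q_def emeasure_lborel_cbox_eq Basis_complex_def)
  have "emeasure (leb m) (Pi\<^sub>E (bits m) (\<lambda>_. Q)) = (\<Prod>x\<in>bits m. emeasure lborel Q)"
    unfolding leb_def by (rule lborel_prod.emeasure_PiM) (auto simp: Q_def)
  then have "emeasure (leb m) (Pi\<^sub>E (bits m) (\<lambda>_. Q)) = 1" by (simp add: eQ)
  moreover have "Pi\<^sub>E (bits m) (\<lambda>_. Q) \<subseteq> shell m"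
  proof
    fix \<psi> assume \<psi>: "\<psi> \<in> Pi\<^sub>E (bits m) (\<lambda>_. Q)"
    have "(\<Sum>x\<in>bits m. (cmod (\<psi> x))\<^sup>2) \<le> (\<Sum>x\<in>bits m. 5)" using \<psi> Q by (intro sum_mono) auto
    moreover have "(\<Sum>x\<in>bits m. 1) \<le> (\<Sum>x\<in>bits m. (cmod (\<psi> x))\<^sup>2)" using \<psi> Q by (intro sum_mono) auto
    ultimately have "2 ^ m \<le> wt m \<psi>" "wt m \<psi> \<le> 5 * 2 ^ m" unfolding wt_def sqnorm_def card_bits sum_constant by simp_all
    moreover from this(1) have "1 \<le> wt m \<psi>" by (rule order.trans[rotated]) simp
    ultimately have "1 \<le> wt m \<psi>" "wt m \<psi> \<le> 5 * 2 ^ m" by auto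
    then show "\<psi> \<in> shell m" using \<psi> by (auto simp: shell_def space_leb)
  qed
  ultimately have "1 \<le> emeasure (leb m) (shell m)" using emeasure_mono[OF _ shell_sets] by metis
  then show "emeasure (leb m) (shell m) \<noteq> 0" by auto
  define R :: real where "R = 5 * 2 ^ m"
  \<comment> \<open>A box that contains every number of squared modulus at most \<open>R\<close>,
    because \<open>R \<le> (R + 1)^2\<close>.\<close>
  define D where "D = cbox (- (R + 1) - \<i> * (R + 1)) (R + 1 + \<i> * (R + 1) :: complex)"
  have "shell m \<subseteq> Pi\<^sub>E (bits m) (\<lambda>_. D)"
  proof
    fix \<psi> assume \<psi>: "\<psi> \<in> shell m"
    have "\<psi> x \<in> D" if x: "x \<in> bits m" for x
    proof -
      have "(cmod (\<psi> x))\<^sup>2 \<le> wt m \<psi>" unfolding wt_def sqnorm_def using x by (intro member_le_sum) auto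
      also have "\<dots> \<le> R" using \<psi> by (simp add: shell_def R_def)
      also have "R \<le> (R + 1)\<^sup>2" by (simp add: R_def power2_eq_square algebra_simps)
      finally have "cmod (\<psi> x) \<le> R + 1" by (rule power2_le_imp_le) (simp add: R_def)
      then have "\<bar>Re (\<psi> x)\<bar> \<le> R + 1" "\<bar>Im (\<psi> x)\<bar> \<le> R + 1" using abs_Re_le_cmod abs_Im_le_cmod order.trans by blast+
      then show ?thesis by (auto simp: D_def in_cbox_complex_iff)
    qed
    then show "\<psi> \<in> Pi\<^sub>E (bits m) (\<lambda>_. D)" using \<psi> by (auto simp: shell_def space_leb)
  qed
  moreover have "Pi\<^sub>E (bits m) (\<lambda>_. D) \<in> sets (leb m)" unfolding leb_def by (intro sets_PiM_I_finite) (auto simp: D_def)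
  ultimately have "emeasure (leb m) (shell m) \<le> emeasure (leb m) (Pi\<^sub>E (bits m) (\<lambda>_. D))" by (intro emeasure_mono)
  also have "\<dots> = (\<Prod>x\<in>bits m. emeasure lborel D)"
    unfolding leb_def by (rule lborel_prod.emeasure_PiM) (auto simp: D_def)
  also have "\<dots> < \<infinity>"
  proof -
    have "emeasure lborel D < \<infinity>" unfolding D_def by (rule emeasure_lborel_cbox_finite)
    then show ?thesis by (simp add: power_less_top_ennreal)
  qed
  finally show "emeasure (leb m) (shell m) \<noteq> \<infinity>" by simp
qed

text \<open>If \<open>g\<close> is the indicator of the shell, both integrals of \<open>g\<close>
  are the measure of the shell, which is positive and finite and so cancels.\<close>

lemma nn_integral_act:
  assumes U: "unitary_op m U" and f [measurable]: "f \<in> borel_measurable (cspace m)"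
  shows "(\<integral>\<^sup>+x. f (act m U x) \<partial>leb m) = (\<integral>\<^sup>+x. f x \<partial>leb m)"
proof -
  have "shell m \<in> sets (cspace m)" using shell_sets by simp
  then have g: "indicator (shell m) \<in> borel_measurable (cspace m)" by (rule borel_measurable_indicator)
  have "indicator (shell m) (restrict (\<lambda>y. - act m U x y) (bits m)) = (indicator (shell m) x :: ennreal)" if "x \<in> space (leb m)" for x
  proof -
    have "wt m (restrict (\<lambda>y. - act m U x y) (bits m)) = wt m (act m U x)"
      by (simp add: wt_def sqnorm_def)
    then show ?thesis using that wt_act[OF U] by (auto simp: indicator_def shell_def space_leb)
  qed
  then have "(\<integral>\<^sup>+x. indicator (shell m) (restrict (\<lambda>y. - act m U x y) (bits m)) \<partial>leb m) = emeasure (leb m) (shell m)"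
    using nn_integral_indicator[OF shell_sets[of m]] by (simp cong: nn_integral_cong)
  moreover have "integral\<^sup>N (leb m) (indicator (shell m)) = emeasure (leb m) (shell m)"
    using nn_integral_indicator[OF shell_sets] .
  moreover note nn_integral_act_mult[OF U f g]
  ultimately
  have "(\<integral>\<^sup>+x. f (act m U x) \<partial>leb m) * emeasure (leb m) (shell m) = (\<integral>\<^sup>+x. f x \<partial>leb m) * emeasure (leb m) (shell m)"
    by simp
  then show ?thesis using emeasure_shell[of m] by (metis mult_divide_eq_ennreal infinity_ennreal_def)
qed


section \<open>Normalisation onto the unit sphere\<close>

definition nrm :: "nat \<Rightarrow> ket \<Rightarrow> ket" where
  "nrm m \<psi> = restrict (\<lambda>x. \<psi> x / complex_of_real (sqrt (wt m \<psi>))) (bits m)"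

lemma measurable_nrm [measurable]: "nrm m \<in> measurable (cspace m) (cspace m)"
  unfolding nrm_def[abs_def] by (rule measurable_cspaceI) measurable

lemma wt_nrm: "1 \<le> wt m \<psi> \<Longrightarrow> wt m (nrm m \<psi>) = 1"
proof -
  assume w: "1 \<le> wt m \<psi>"
  have "wt m (nrm m \<psi>) = sqnorm (bits m) (\<lambda>x. complex_of_real (1 / sqrt (wt m \<psi>)) * \<psi> x)"
    unfolding wt_def[of m "nrm m \<psi>"] unfolding nrm_def sqnorm_restrict by (simp add: mult.commute divide_inverse)
  also have "\<dots> = (1 / sqrt (wt m \<psi>))\<^sup>2 * wt m \<psi>"
    unfolding sqnorm_scale norm_of_real power2_abs by (simp add: wt_def)
  finally show ?thesis using w by (simp add: power_divide)
qed

lemma nrm_act: "unitary_op m U \<Longrightarrow> nrm m (act m U \<psi>) = act m U (nrm m \<psi>)"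
proof -
  assume U: "unitary_op m U"
  have "op_apply m U (nrm m \<psi>) = op_apply m U (\<lambda>x. \<psi> x / complex_of_real (sqrt (wt m \<psi>)))"
    by (rule op_apply_cong) (simp add: nrm_def)
  also have "\<dots> = (\<lambda>x. op_apply m U \<psi> x / complex_of_real (sqrt (wt m \<psi>)))"
    by (simp add: op_apply_def sum_divide_distrib)
  finally show ?thesis using wt_act[OF U] by (auto simp: nrm_def act_def fun_eq_iff)
qed

text \<open>The measure is the uniform distribution on the shell, normalised to length 1. Unitary
  operators preserve that distribution and commute with normalisation.\<close>

theorem haar_exists: "\<exists>\<mu>. is_haar m \<mu>"
proof
  define \<nu> where "\<nu> = uniform_measure (leb m) (shell m)"
  define \<mu> where "\<mu> = distr \<nu> (cspace m) (nrm m)"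
  have pn: "prob_space \<nu>" unfolding \<nu>_def using emeasure_shell by (intro prob_space_uniform_measure) auto
  have sn: "sets \<nu> = sets (cspace m)" by (simp add: \<nu>_def)
  have mn: "nrm m \<in> measurable \<nu> (cspace m)" using measurable_nrm by (simp add: measurable_cong_sets[OF sn refl])
  have prob: "prob_space \<mu>" unfolding \<mu>_def by (rule prob_space.prob_space_distr[OF pn mn])
  have sp: "space \<nu> = space (leb m)" using sn sets_eq_imp_space_eq space_cspace by metis
  have em: "emeasure \<mu> B = emeasure (leb m) (shell m \<inter> {\<psi> \<in> space (leb m). nrm m \<psi> \<in> B}) / emeasure (leb m) (shell m)"
    if B: "B \<in> sets (cspace m)" for B
  proof -
    have eq: "nrm m -` B \<inter> space \<nu> = {\<psi> \<in> space (leb m). nrm m \<psi> \<in> B}" by (auto simp: sp)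
    have "nrm m -` B \<inter> space \<nu> \<in> sets (leb m)" using measurable_sets[OF mn B] by (simp add: sn)
    then show ?thesis unfolding \<mu>_def emeasure_distr[OF mn B] using eq shell_sets by (simp add: \<nu>_def)
  qed
  have "AE \<psi> in \<nu>. wt m (nrm m \<psi>) = 1"
    unfolding \<nu>_def by (rule AE_uniform_measureI[OF shell_sets]) (auto simp: shell_def wt_nrm)
  moreover have "{\<psi> \<in> space (cspace m). wt m \<psi> = 1} \<in> sets (cspace m)" by measurable
  ultimately have "AE \<psi> in \<mu>. wt m \<psi> = 1" unfolding \<mu>_def by (simp add: AE_distr_iff[OF mn])
  then have ae: "AE \<psi> in \<mu>. unit_ket m \<psi>" by (simp add: unit_ket_def wt_def sqnorm_def)
  have inv: "distr \<mu> \<mu> (act m U) = \<mu>" if U: "unitary_op m U" for U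
  proof (rule measure_eqI)
    have ma: "act m U \<in> measurable \<mu> \<mu>" unfolding \<mu>_def by simp
    fix B assume "B \<in> sets (distr \<mu> \<mu> (act m U))"
    then have B: "B \<in> sets (cspace m)" by (simp add: \<mu>_def)
    have B': "act m U -` B \<inter> space (cspace m) \<in> sets (cspace m)" using measurable_sets[OF measurable_act B] .
    define D where "D = shell m \<inter> {\<psi> \<in> space (leb m). nrm m \<psi> \<in> B}"
    define D' where "D' = shell m \<inter> {\<psi> \<in> space (leb m). nrm m \<psi> \<in> act m U -` B \<inter> space (cspace m)}"
    have DD: "shell m \<inter> {\<psi> \<in> space (leb m). nrm m \<psi> \<in> E} \<in> sets (cspace m)" if "E \<in> sets (cspace m)" for E
    proof -
      have "nrm m -` E \<inter> space (cspace m) \<in> sets (cspace m)" using measurable_sets[OF measurable_nrm that] .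
      moreover have "nrm m -` E \<inter> space (cspace m) = {\<psi> \<in> space (leb m). nrm m \<psi> \<in> E}" by (auto simp: space_cspace)
      ultimately show ?thesis using shell_sets by (metis sets.Int sets_leb)
    qed
    have ind: "indicator D (act m U \<psi>) = (indicator D' \<psi> :: ennreal)" if "\<psi> \<in> space (leb m)" for \<psi>
    proof -
      have "act m U \<psi> \<in> space (leb m)" "nrm m \<psi> \<in> space (leb m)" by (auto simp: act_def nrm_def space_leb)
      then show ?thesis using that nrm_act[OF U] wt_act[OF U] by (auto simp: D_def D'_def shell_def indicator_def space_cspace)
    qed
    have "emeasure (leb m) D = (\<integral>\<^sup>+\<psi>. indicator D \<psi> \<partial>leb m)" using DD[OF B] by (simp add: D_def)
    also have "\<dots> = (\<integral>\<^sup>+\<psi>. indicator D (act m U \<psi>) \<partial>leb m)"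
      by (rule nn_integral_act[OF U, symmetric]) (use DD[OF B] in \<open>auto simp: D_def\<close>)
    also have "\<dots> = (\<integral>\<^sup>+\<psi>. indicator D' \<psi> \<partial>leb m)" by (rule nn_integral_cong) (rule ind)
    also have "\<dots> = emeasure (leb m) D'" using DD[OF B'] by (simp add: D'_def)
    finally have eq: "emeasure (leb m) D = emeasure (leb m) D'" .
    have "emeasure (distr \<mu> \<mu> (act m U)) B = emeasure \<mu> (act m U -` B \<inter> space \<mu>)"
      by (rule emeasure_distr[OF ma]) (use B in \<open>simp add: \<mu>_def\<close>)
    also have "space \<mu> = space (cspace m)" by (simp add: \<mu>_def)
    also have "emeasure \<mu> (act m U -` B \<inter> space (cspace m)) = emeasure \<mu> B"
      unfolding em[OF B] em[OF B'] using eq by (simp add: D_def D'_def)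
    finally show "emeasure (distr \<mu> \<mu> (act m U)) B = emeasure \<mu> B" .
  qed simp
  show "is_haar m \<mu>"
    unfolding is_haar_def using prob ae inv
    by (auto simp: \<mu>_def cspace_def act_def[abs_def])
qed

lemma is_haar_haar: "is_haar m (haar m)"
  unfolding haar_def using haar_exists by (rule someI_ex)

subsection \<open>Second moments of the Haar measure\<close>

text \<open>Sign changes and transpositions of basis vectors have this form, and they already
  determine the second moments. The permutation is its own inverse, which makes the adjoint
  explicit.\<close>

lemma unitary_monomial:
  assumes "\<And>x. x \<in> bits m \<Longrightarrow> \<tau> x \<in> bits m \<and> \<tau> (\<tau> x) = x" "\<And>x. cmod (d x) = 1"
  defines "U \<equiv> \<lambda>z w. if w = \<tau> z then d z else 0"
  shows "unitary_op m U" "x \<in> bits m \<Longrightarrow> act m U \<psi> x = d x * \<psi> (\<tau> x)"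
proof -
  have dd: "cnj (d z) * d z = 1" for z using assms(2)[of z] complex_norm_square[of "d z"] by (simp add: mult.commute)
  have "op_mult m (adj U) U x y = id_op x y \<and> op_mult m U (adj U) x y = id_op x y" if x: "x \<in> bits m" and y: "y \<in> bits m" for x y
  proof
    have "op_mult m (adj U) U x y = (\<Sum>z\<in>bits m. if z = \<tau> x then id_op x y else 0)"
      unfolding op_mult_def using assms(1) x y by (intro sum.cong) (auto simp: adj_def U_def id_op_def dd)
    then show "op_mult m (adj U) U x y = id_op x y" using assms(1)[OF x] by simp
    have "op_mult m U (adj U) x y = (\<Sum>z\<in>bits m. if z = \<tau> x then id_op x y else 0)"
      unfolding op_mult_def using assms(1) x y dd by (intro sum.cong) (auto simp: adj_def U_def id_op_def mult.commute, metis)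
    then show "op_mult m U (adj U) x y = id_op x y" using assms(1)[OF x] by simp
  qed
  then show "unitary_op m U" by (simp add: unitary_op_def)
  show "x \<in> bits m \<Longrightarrow> act m U \<psi> x = d x * \<psi> (\<tau> x)"
    using assms(1)[of x] by (simp add: act_def op_apply_def U_def if_distrib[of "\<lambda>c. c * _"] cong: if_cong)
qed

text \<open>A sign change at one index kills the off-diagonal moments, a transposition makes the
  diagonal ones equal, and these sum to the squared norm 1. So a single Haar-random copy is
  maximally mixed.\<close>

lemma haar_moments:
  assumes "y \<in> bits m" "y' \<in> bits m"
  shows "integrable (haar m) (\<lambda>\<psi>. \<psi> y * cnj (\<psi> y'))"
    "(\<integral>\<psi>. \<psi> y * cnj (\<psi> y') \<partial>haar m) = (if y = y' then 1 / 2 ^ m else 0)"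
proof -
  define \<mu> where "\<mu> = haar m"
  have H: "prob_space \<mu>" "sets \<mu> = sets (cspace m)" "AE \<psi> in \<mu>. wt m \<psi> = 1"
    "\<And>U. unitary_op m U \<Longrightarrow> distr \<mu> \<mu> (act m U) = \<mu>"
    using is_haar_haar[of m] unfolding is_haar_def \<mu>_def[symmetric] act_def[abs_def] cspace_def wt_def sqnorm_def unit_ket_def by auto
  interpret prob_space \<mu> by (rule H(1))
  have ms: "measurable \<mu> M = measurable (cspace m) M" for M :: "complex measure" by (rule measurable_cong_sets[OF H(2) refl])
  have le1: "cmod (\<psi> x) \<le> 1" if "wt m \<psi> = 1" "x \<in> bits m" for \<psi> x
  proof -
    have "(cmod (\<psi> x))\<^sup>2 \<le> wt m \<psi>" unfolding wt_def sqnorm_def using that(2) by (intro member_le_sum) auto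
    then show ?thesis using that(1) by (simp add: power_le_one_iff)
  qed
  have meas: "(\<lambda>\<psi>. \<psi> x * cnj (\<psi> x')) \<in> borel_measurable (cspace m)" if [measurable]: "x \<in> bits m" "x' \<in> bits m" for x x'
  proof -
    have "cnj \<in> borel_measurable borel" by (intro borel_measurable_continuous_onI continuous_intros)
    then have "(\<lambda>\<psi>. cnj (\<psi> x')) \<in> borel_measurable (cspace m)"
      using measurable_compose[OF measurable_component_cspace[OF that(2)]] by blast
    then show ?thesis by measurable
  qed
  have int: "integrable \<mu> (\<lambda>\<psi>. \<psi> x * cnj (\<psi> x'))" if x: "x \<in> bits m" "x' \<in> bits m" for x x'
  proof (rule integrable_const_bound[where B = 1])
    show "AE \<psi> in \<mu>. norm (\<psi> x * cnj (\<psi> x')) \<le> 1"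
      using H(3) by eventually_elim (use le1 x in \<open>auto simp: norm_mult intro: mult_le_one\<close>)
  qed (use meas[OF x] in \<open>simp add: ms\<close>)
  define E where "E x x' = (\<integral>\<psi>. \<psi> x * cnj (\<psi> x') \<partial>\<mu>)" for x x'
  have inv: "E x x' = (\<integral>\<psi>. act m U \<psi> x * cnj (act m U \<psi> x') \<partial>\<mu>)" if U: "unitary_op m U" and x: "x \<in> bits m" "x' \<in> bits m" for U x x'
  proof -
    have "E x x' = (\<integral>\<psi>. \<psi> x * cnj (\<psi> x') \<partial>distr \<mu> \<mu> (act m U))" by (simp add: E_def H(4)[OF U])
    also have "\<dots> = (\<integral>\<psi>. act m U \<psi> x * cnj (act m U \<psi> x') \<partial>\<mu>)"
    proof (rule integral_distr)
      show "act m U \<in> measurable \<mu> \<mu>" unfolding measurable_cong_sets[OF H(2) H(2)] by (rule measurable_act)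
      show "(\<lambda>\<psi>. \<psi> x * cnj (\<psi> x')) \<in> borel_measurable \<mu>" using meas[OF x] by (simp add: ms)
    qed
    finally show ?thesis .
  qed
  have off: "E x x' = 0" if x: "x \<in> bits m" "x' \<in> bits m" "x \<noteq> x'" for x x'
  proof -
    note U = unitary_monomial[of m "\<lambda>x. x" "\<lambda>z. if z = x then - 1 else 1"]
    have "E x x' = (\<integral>\<psi>. - (\<psi> x * cnj (\<psi> x')) \<partial>\<mu>)"
      using inv[OF U(1) x(1,2)] U(2)[OF _ _ x(1)] U(2)[OF _ _ x(2)] x(3) by simp
    also have "\<dots> = - E x x'" by (simp add: E_def)
    finally show ?thesis by simp
  qed
  have diag: "E x x = E x' x'" if x: "x \<in> bits m" "x' \<in> bits m" for x x'
  proof -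
    note U = unitary_monomial[of m "\<lambda>z. if z = x then x' else if z = x' then x else z" "\<lambda>_. 1"]
    show ?thesis using inv[OF U(1) x(1) x(1)] U(2)[OF _ _ x(1)] x by (simp add: E_def)
  qed
  have "(\<Sum>x\<in>bits m. E x x) = (\<integral>\<psi>. (\<Sum>x\<in>bits m. \<psi> x * cnj (\<psi> x)) \<partial>\<mu>)"
    unfolding E_def by (rule Bochner_Integration.integral_sum[symmetric]) (rule int)
  also have "\<dots> = (\<integral>\<psi>. 1 \<partial>\<mu>)"
  proof (rule integral_cong_AE)
    show "AE \<psi> in \<mu>. (\<Sum>x\<in>bits m. \<psi> x * cnj (\<psi> x)) = 1"
      using H(3) by eventually_elim (simp add: wt_def sqnorm_def complex_norm_square[symmetric] flip: of_real_power of_real_sum)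
    show "(\<lambda>\<psi>. \<Sum>x\<in>bits m. \<psi> x * cnj (\<psi> x)) \<in> borel_measurable \<mu>"
      by (rule borel_measurable_sum) (use meas in \<open>simp add: ms\<close>)
  qed simp
  also have "\<dots> = 1" by (simp add: prob_space)
  finally have sum1: "(\<Sum>x\<in>bits m. E x x) = 1" .
  have "(\<Sum>x\<in>bits m. E x x) = (\<Sum>x\<in>bits m. E y y)" by (intro sum.cong refl diag assms(1))
  then have "E y y = 1 / 2 ^ m" using sum1 by (simp add: card_bits field_simps)
  then show "(\<integral>\<psi>. \<psi> y * cnj (\<psi> y') \<partial>haar m) = (if y = y' then 1 / 2 ^ m else 0)"
    using off[OF assms] by (auto simp: E_def \<mu>_def)
  show "integrable (haar m) (\<lambda>\<psi>. \<psi> y * cnj (\<psi> y'))" using int[OF assms] by (simp add: \<mu>_def)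
qed

subsection \<open>Hiding\<close>

text \<open>Hiding uses nothing but linearity in the input state, which lets the acceptance
  probability pass through mixtures and the Haar integral. The exchanges of sums collect the
  coefficient of each matrix entry.\<close>

lemma accept_prob_linear:
  assumes "adversary_circuit i A"
  shows "\<exists>c. \<forall>\<rho>. accept_prob A i \<rho> = Re (\<Sum>y\<in>bits i. \<Sum>y'\<in>bits i. c y y' * \<rho> y y')"
proof -
  define w where "w = width A"
  define Z where "Z = ketbra (zero_ket (w - i))"
  define V where "V = circuit_op A"
  define X where "X = {x \<in> bits w. x ! 0}"
  define d where "d z z' = (\<Sum>x\<in>X. V x z * Z (drop i z) (drop i z') * cnj (V x z'))" for z z'
  define c where "c y y' = (\<Sum>z\<in>bits w. \<Sum>z'\<in>bits w. if take i z = y \<and> take i z' = y' then d z z' else 0)" for y y'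
  have iw: "i \<le> w" using assms by (simp add: adversary_circuit_def w_def)
  have "accept_prob A i \<rho> = Re (\<Sum>y\<in>bits i. \<Sum>y'\<in>bits i. c y y' * \<rho> y y')" for \<rho>
  proof -
    have "(\<Sum>x\<in>X. conj_by w V (op_tensor i \<rho> Z) x x) =
      (\<Sum>x\<in>X. \<Sum>z'\<in>bits w. \<Sum>z\<in>bits w. V x z * (\<rho> (take i z) (take i z') * Z (drop i z) (drop i z')) * cnj (V x z'))"
      by (simp add: conj_by_def op_mult_def op_tensor_def adj_def sum_distrib_right)
    also have "\<dots> = (\<Sum>z'\<in>bits w. \<Sum>x\<in>X. \<Sum>z\<in>bits w. V x z * (\<rho> (take i z) (take i z') * Z (drop i z) (drop i z')) * cnj (V x z'))"
      by (rule sum.swap)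
    also have "\<dots> = (\<Sum>z'\<in>bits w. \<Sum>z\<in>bits w. \<Sum>x\<in>X. V x z * (\<rho> (take i z) (take i z') * Z (drop i z) (drop i z')) * cnj (V x z'))"
      by (intro sum.cong refl sum.swap)
    also have "\<dots> = (\<Sum>z'\<in>bits w. \<Sum>z\<in>bits w. d z z' * \<rho> (take i z) (take i z'))"
      by (simp add: d_def sum_distrib_left sum_distrib_right mult_ac)
    also have "\<dots> = (\<Sum>z'\<in>bits w. \<Sum>z\<in>bits w. \<Sum>y\<in>bits i. \<Sum>y'\<in>bits i. if take i z = y \<and> take i z' = y' then d z z' * \<rho> y y' else 0)"
    proof (intro sum.cong refl)
      fix z z' assume "z \<in> bits w" "z' \<in> bits w"
      then have t: "take i z \<in> bits i" "take i z' \<in> bits i" using iw by (auto simp: bits_def)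
      have "(\<Sum>y\<in>bits i. \<Sum>y'\<in>bits i. if take i z = y \<and> take i z' = y' then d z z' * \<rho> y y' else 0) =
        (\<Sum>y\<in>bits i. if take i z = y then (\<Sum>y'\<in>bits i. if take i z' = y' then d z z' * \<rho> y y' else 0) else 0)"
        by (intro sum.cong refl) auto
      also have "\<dots> = d z z' * \<rho> (take i z) (take i z')" using t by simp
      finally show "d z z' * \<rho> (take i z) (take i z') = (\<Sum>y\<in>bits i. \<Sum>y'\<in>bits i. if take i z = y \<and> take i z' = y' then d z z' * \<rho> y y' else 0)" ..
    qed
    also have "\<dots> = (\<Sum>z\<in>bits w. \<Sum>z'\<in>bits w. \<Sum>y\<in>bits i. \<Sum>y'\<in>bits i. if take i z = y \<and> take i z' = y' then d z z' * \<rho> y y' else 0)"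
      by (rule sum.swap)
    also have "\<dots> = (\<Sum>z\<in>bits w. \<Sum>y\<in>bits i. \<Sum>z'\<in>bits w. \<Sum>y'\<in>bits i. if take i z = y \<and> take i z' = y' then d z z' * \<rho> y y' else 0)"
      by (intro sum.cong refl sum.swap)
    also have "\<dots> = (\<Sum>y\<in>bits i. \<Sum>z\<in>bits w. \<Sum>z'\<in>bits w. \<Sum>y'\<in>bits i. if take i z = y \<and> take i z' = y' then d z z' * \<rho> y y' else 0)"
      by (rule sum.swap)
    also have "\<dots> = (\<Sum>y\<in>bits i. \<Sum>z\<in>bits w. \<Sum>y'\<in>bits i. \<Sum>z'\<in>bits w. if take i z = y \<and> take i z' = y' then d z z' * \<rho> y y' else 0)"
      by (intro sum.cong refl sum.swap)
    also have "\<dots> = (\<Sum>y\<in>bits i. \<Sum>y'\<in>bits i. \<Sum>z\<in>bits w. \<Sum>z'\<in>bits w. if take i z = y \<and> take i z' = y' then d z z' * \<rho> y y' else 0)"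
      by (intro sum.cong refl sum.swap)
    also have "\<dots> = (\<Sum>y\<in>bits i. \<Sum>y'\<in>bits i. c y y' * \<rho> y y')"
      unfolding c_def sum_distrib_right by (intro sum.cong refl) auto
    finally show ?thesis by (simp add: accept_prob_def w_def V_def Z_def X_def)
  qed
  then show ?thesis by blast
qed

lemma accept_prob_cong:
  assumes "adversary_circuit i A" "\<And>y y'. y \<in> bits i \<Longrightarrow> y' \<in> bits i \<Longrightarrow> \<rho> y y' = \<sigma> y y'"
  shows "accept_prob A i \<rho> = accept_prob A i \<sigma>"
  using accept_prob_linear[OF assms(1)] assms(2) by auto

lemma accept_prob_mixture:
  assumes "adversary_circuit i A" "finite B" "\<And>y y'. y \<in> bits i \<Longrightarrow> y' \<in> bits i \<Longrightarrow> \<rho> y y' = of_real a * (\<Sum>k\<in>B. \<sigma> k y y')"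
  shows "accept_prob A i \<rho> = a * (\<Sum>k\<in>B. accept_prob A i (\<sigma> k))"
proof -
  obtain c where c: "\<And>\<rho>. accept_prob A i \<rho> = Re (\<Sum>y\<in>bits i. \<Sum>y'\<in>bits i. c y y' * \<rho> y y')"
    using accept_prob_linear[OF assms(1)] by blast
  have "(\<Sum>y\<in>bits i. \<Sum>y'\<in>bits i. c y y' * \<rho> y y') = (\<Sum>y\<in>bits i. \<Sum>y'\<in>bits i. \<Sum>k\<in>B. of_real a * (c y y' * \<sigma> k y y'))"
    by (intro sum.cong refl) (simp add: assms(3) sum_distrib_left mult_ac)
  also have "\<dots> = (\<Sum>y\<in>bits i. \<Sum>k\<in>B. \<Sum>y'\<in>bits i. of_real a * (c y y' * \<sigma> k y y'))"
    by (intro sum.cong refl sum.swap)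
  also have "\<dots> = (\<Sum>k\<in>B. \<Sum>y\<in>bits i. \<Sum>y'\<in>bits i. of_real a * (c y y' * \<sigma> k y y'))"
    by (rule sum.swap)
  also have "\<dots> = of_real a * (\<Sum>k\<in>B. \<Sum>y\<in>bits i. \<Sum>y'\<in>bits i. c y y' * \<sigma> k y y')"
    by (simp add: sum_distrib_left)
  finally show ?thesis by (simp add: c)
qed

lemma accept_prob_haar:
  assumes "adversary_circuit i A"
  shows "(\<integral>\<psi>. accept_prob A i (ketbra \<psi>) \<partial>haar i) = accept_prob A i (\<lambda>y y'. if y = y' then 1 / 2 ^ i else 0)"
proof -
  obtain c where c: "\<And>\<rho>. accept_prob A i \<rho> = Re (\<Sum>y\<in>bits i. \<Sum>y'\<in>bits i. c y y' * \<rho> y y')"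
    using accept_prob_linear[OF assms(1)] by blast
  have int: "integrable (haar i) (\<lambda>\<psi>. \<Sum>y'\<in>bits i. c y y' * ketbra \<psi> y y')" if "y \<in> bits i" for y
    unfolding ketbra_def using haar_moments(1)[OF that]
    by (intro Bochner_Integration.integrable_sum integrable_mult_right) auto
  have "(\<integral>\<psi>. accept_prob A i (ketbra \<psi>) \<partial>haar i) = Re (\<integral>\<psi>. (\<Sum>y\<in>bits i. \<Sum>y'\<in>bits i. c y y' * ketbra \<psi> y y') \<partial>haar i)"
    unfolding c by (rule integral_Re, rule Bochner_Integration.integrable_sum, rule int)
  also have "(\<integral>\<psi>. (\<Sum>y\<in>bits i. \<Sum>y'\<in>bits i. c y y' * ketbra \<psi> y y') \<partial>haar i) = (\<Sum>y\<in>bits i. \<integral>\<psi>. (\<Sum>y'\<in>bits i. c y y' * ketbra \<psi> y y') \<partial>haar i)"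
    by (rule Bochner_Integration.integral_sum) (rule int)
  also have "\<dots> = (\<Sum>y\<in>bits i. \<Sum>y'\<in>bits i. c y y' * (if y = y' then 1 / 2 ^ i else 0))"
  proof (rule sum.cong[OF refl])
    fix y assume y: "y \<in> bits i"
    have "(\<integral>\<psi>. (\<Sum>y'\<in>bits i. c y y' * ketbra \<psi> y y') \<partial>haar i) = (\<Sum>y'\<in>bits i. \<integral>\<psi>. c y y' * ketbra \<psi> y y' \<partial>haar i)"
      unfolding ketbra_def using haar_moments(1)[OF y] by (intro Bochner_Integration.integral_sum integrable_mult_right) auto
    also have "\<dots> = (\<Sum>y'\<in>bits i. c y y' * (if y = y' then 1 / 2 ^ i else 0))"
      unfolding ketbra_def using haar_moments[OF y] by (intro sum.cong refl) (simp only: integral_mult_right_zero)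
    finally show "(\<integral>\<psi>. (\<Sum>y'\<in>bits i. c y y' * ketbra \<psi> y y') \<partial>haar i) = (\<Sum>y'\<in>bits i. c y y' * (if y = y' then 1 / 2 ^ i else 0))" .
  qed
  finally show ?thesis by (simp add: c)
qed

lemma split_append:
  assumes "x \<in> bits w" "y \<in> bits k"
  shows "length (x @ y) = w + k" "take w (x @ y) = x" "drop w (x @ y) = y"
  using assms by (simp_all add: bits_def)

text \<open>Tracing out \<open>R\<close> kills the cross terms, because distinct keys come with
  distinct basis states; a uniform mixture remains.\<close>

lemma purified_trace:
  assumes "purified \<psi> W m a \<phi>" "y \<in> bits (m l)" "y' \<in> bits (m l)"
  shows "trace_left (W l) (ketbra (\<psi> l)) y y' = of_real ((1 / 2) ^ a l) * (\<Sum>k\<in>bits (a l). ketbra (\<phi> l k) y y')"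
proof -
  obtain \<xi> where \<xi>: "inj_on \<xi> (bits (a l))" "\<xi> ` bits (a l) \<subseteq> bits (W l)" "\<psi> l =
     (\<lambda>z. (1 / complex_of_real (sqrt 2)) ^ a l *
       (\<Sum>k\<in>bits (a l). if length z = W l + m l \<and> take (W l) z = \<xi> k then \<phi> l k (drop (W l) z) else 0))"
    using assms(1) unfolding purified_def by blast
  define N where "N = (1 / complex_of_real (sqrt 2)) ^ a l"
  have "N * cnj N = (1 / complex_of_real (sqrt 2) * (1 / complex_of_real (sqrt 2))) ^ a l"
    unfolding N_def power_mult_distrib by simp
  also have "1 / complex_of_real (sqrt 2) * (1 / complex_of_real (sqrt 2)) = of_real (1 / 2)"
    by (simp flip: of_real_mult)
  finally have N: "N * cnj N = of_real ((1 / 2) ^ a l)" by simp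
  have \<psi>: "\<psi> l (x @ v) = N * (\<Sum>k\<in>bits (a l). if x = \<xi> k then \<phi> l k v else 0)" if "x \<in> bits (W l)" "v \<in> bits (m l)" for x v
    unfolding \<xi>(3) N_def split_append[OF that] by simp
  have at: "(\<Sum>k'\<in>bits (a l). if \<xi> k = \<xi> k' then g k' else 0) = g k" if "k \<in> bits (a l)" for k and g :: "bool list \<Rightarrow> complex"
  proof -
    have "(\<Sum>k'\<in>bits (a l). if \<xi> k = \<xi> k' then g k' else 0) = (\<Sum>k'\<in>bits (a l). if k = k' then g k' else 0)"
      using \<xi>(1) that by (intro sum.cong) (auto dest: inj_onD)
    then show ?thesis using that by simp
  qed
  have "trace_left (W l) (ketbra (\<psi> l)) y y' = (\<Sum>x\<in>bits (W l). \<psi> l (x @ y) * cnj (\<psi> l (x @ y')))"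
    by (simp add: trace_left_def ketbra_def)
  also have "\<dots> = (\<Sum>x\<in>bits (W l). (N * cnj N) * ((\<Sum>k\<in>bits (a l). if x = \<xi> k then \<phi> l k y else 0) * cnj (\<Sum>k\<in>bits (a l). if x = \<xi> k then \<phi> l k y' else 0)))"
    by (intro sum.cong refl) (simp add: \<psi> assms mult_ac)
  also have "\<dots> = (N * cnj N) * (\<Sum>x\<in>\<xi> ` bits (a l). (\<Sum>k\<in>bits (a l). if x = \<xi> k then \<phi> l k y else 0) * cnj (\<Sum>k\<in>bits (a l). if x = \<xi> k then \<phi> l k y' else 0))"
    unfolding sum_distrib_left[symmetric]
    by (rule arg_cong[where f = "\<lambda>s. _ * s"], rule sum.mono_neutral_right) (use \<xi>(2) in \<open>auto intro!: sum.neutral\<close>)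
  also have "\<dots> = (N * cnj N) * (\<Sum>k\<in>bits (a l). ketbra (\<phi> l k) y y')"
    unfolding sum.reindex[OF \<xi>(1)] o_def by (intro arg_cong[where f = "\<lambda>s. _ * s"] sum.cong refl) (simp only: at ketbra_def)
  finally show ?thesis by (simp add: N)
qed

text \<open>A description printed in polynomial time has polynomial length, which bounds the numbers
  of wires and gates.\<close>

lemma uniform_imp_nonuniform:
  assumes "uniform_QPT i A"
  shows "nonuniform_QPT i A"
proof -
  obtain P p where *: "\<forall>x\<in>range (\<lambda>n. replicate n True). \<exists>k s. exec P ((\<lambda>r. [])(0 := x)) k s \<and> s 0 = enc_circuit (A (length x)) \<and> k \<le> poly p (length x)"
    using assms unfolding uniform_QPT_def poly_time_family_def poly_time_on_def by blast
  have Pp: "\<exists>k s. exec P ((\<lambda>r. [])(0 := replicate n True)) k s \<and> s 0 = enc_circuit (A n) \<and> k \<le> poly p n" for n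
    using bspec[OF *, of "replicate n True"] by simp
  have "width (A n) + length (gates (A n)) \<le> n + poly p n" for n
  proof -
    obtain k s where ks: "exec P ((\<lambda>r. [])(0 := replicate n True)) k s" "s 0 = enc_circuit (A n)" "k \<le> poly p n" using Pp by blast
    have "length (s 0) \<le> n + k" using exec_length[OF ks(1), of 0] by simp
    then show ?thesis using length_enc_circuit[of "A n"] ks by simp
  qed
  then have "poly_bounded (\<lambda>n. width (A n) + length (gates (A n)))"
    by (rule poly_bounded_mono[OF poly_bounded_add[OF poly_bounded_id poly_bounded_poly[OF poly_bounded_id]]])
  then show ?thesis using assms by (simp add: nonuniform_QPT_def uniform_QPT_def)
qed

section \<open>The two security properties\<close>

lemma hiding:
  assumes "PRSG m U" "reg_C S = m"
    and p0: "purified (commit_state S False) (reg_R S) m (\<lambda>l. l) (\<lambda>l k. circuit_state (U k))"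
    and p1: "purified (commit_state S True) (reg_R S) m m (\<lambda>l. basis_ket)"
  shows "computationally_hiding S"
  unfolding computationally_hiding_def
proof (intro allI impI)
  fix A assume A: "uniform_QPT (reg_C S) A"
  then have adv: "adversary_circuit (m l) (A l)" for l using assms(2) by (simp add: uniform_QPT_def)
  have h0: "hiding_prob S A False l = (\<Sum>k\<in>bits l. accept_prob (A l) (m l) (ketbra (circuit_state (U k)))) / 2 ^ l" for l
  proof -
    have "hiding_prob S A False l = (1 / 2) ^ l * (\<Sum>k\<in>bits l. accept_prob (A l) (m l) (ketbra (circuit_state (U k))))"
      unfolding hiding_prob_def assms(2)
      by (rule accept_prob_mixture[OF adv finite_bits purified_trace[where l = l, OF p0]])
    then show ?thesis by (simp add: power_one_over field_simps)
  qed
  have h1: "hiding_prob S A True l = accept_prob (A l) (m l) (\<lambda>y y'. if y = y' then 1 / 2 ^ m l else 0)" for l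
    unfolding hiding_prob_def assms(2)
  proof (rule accept_prob_cong[OF adv])
    fix y y' assume y: "y \<in> bits (m l)" "y' \<in> bits (m l)"
    have "(\<Sum>k\<in>bits (m l). ketbra (basis_ket k) y y') = (\<Sum>k\<in>bits (m l). if y = k then (if y = y' then 1 else 0) else 0)"
      by (intro sum.cong) (auto simp: ketbra_def basis_ket_def)
    also have "\<dots> = (if y = y' then 1 else 0)" using y by simp
    finally show "trace_left (reg_R S l) (ketbra (commit_state S True l)) y y' = (if y = y' then 1 / 2 ^ m l else 0)"
      using purified_trace[OF p1 y] by (simp add: power_one_over)
  qed
  \<comment> \<open>A power of one copy still carries an empty tensor factor. With one copy, the
    hiding adversary itself attacks the generator, with exactly the same advantage.\<close>
  have kp: "accept_prob (A l) (m l) (ketbra (ket_power (m l) \<psi> 1)) = accept_prob (A l) (m l) (ketbra \<psi>)" for l \<psi>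
    by (rule accept_prob_cong[OF adv]) (auto simp: ketbra_def ket_tensor_def zero_ket_def basis_ket_def bits_def)
  have "\<bar>hiding_prob S A False l - hiding_prob S A True l\<bar> = prs_advantage m U (poly [:1:]) A l" for l
    using kp[of l] by (simp add: prs_advantage_def h0 h1 accept_prob_haar[OF adv])
  moreover have "nonuniform_QPT (\<lambda>n. m n * poly [:1:] n) A"
    using uniform_imp_nonuniform[OF A] assms(2) by simp
  ultimately show "\<exists>negl. negligible negl \<and> (\<forall>l. \<bar>hiding_prob S A False l - hiding_prob S A True l\<bar> \<le> negl l)"
    using assms(1) unfolding PRSG_def by metis
qed

lemma negligible_exp:
  assumes "a > 0"
  shows "negligible (\<lambda>n. 2 powr (- a * real n))"
  unfolding negligible_def
proof (intro allI impI)
  fix c :: real assume "c > 0"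
  define b where "b = a * ln 2"
  have "b > 0" using assms by (simp add: b_def)
  then have "filterlim (\<lambda>n. b * real n - c * ln (real n)) at_top sequentially" by real_asymp
  then have "\<forall>\<^sub>F n in sequentially. b * real n - c * ln (real n) > 0" by (rule filterlim_at_top_dense[THEN iffD1, rule_format])
  then show "\<forall>\<^sub>F n in sequentially. 2 powr (- a * real n) < real n powr - c"
    using eventually_gt_at_top[of 0] by eventually_elim (simp add: powr_def b_def mult_ac)
qed

lemma binding:
  fixes c :: real
  assumes S: "commitment_scheme S" "reg_C S = m" and m: "c > 1" "\<And>n. real (m n) \<ge> c * real n"
    and U: "\<And>k. wf_circuit (U k) \<and> width (U k) = m (length k)"
    and p0: "purified (commit_state S False) (reg_R S) m (\<lambda>l. l) (\<lambda>l k. circuit_state (U k))"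
    and p1: "purified (commit_state S True) (reg_R S) m m (\<lambda>l. basis_ket)"
  shows "statistically_sum_binding S"
  unfolding statistically_sum_binding_def
proof (intro allI impI, elim conjE)
  fix e :: "nat \<Rightarrow> nat" and \<Psi> :: "nat \<Rightarrow> ket" and V :: "bool \<Rightarrow> nat \<Rightarrow> op"
  assume \<Psi>: "\<forall>l. unit_ket (e l + reg_R S l + reg_C S l) (\<Psi> l)" and V: "\<forall>b l. unitary_op (e l + reg_R S l) (V b l)"
  define W where "W = reg_R S"
  have le: "opening_prob S False l (e l) (\<Psi> l) (V False l) + opening_prob S True l (e l) (\<Psi> l) (V True l)
      \<le> 1 + 2 powr (- ((c - 1) / 2) * real l)" for l
  proof -
    define N where "N k = (1 / complex_of_real (sqrt 2)) ^ k" for k :: nat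
    obtain \<xi>0 where \<xi>0: "\<xi>0 ` bits l \<subseteq> bits (W l)" "commit_state S False l =
     (\<lambda>z. N l * (\<Sum>k\<in>bits l. if length z = W l + m l \<and> take (W l) z = \<xi>0 k then circuit_state (U k) (drop (W l) z) else 0))"
      using p0 unfolding purified_def N_def W_def by blast
    obtain \<xi>1 where \<xi>1: "inj_on \<xi>1 (bits (m l))" "\<xi>1 ` bits (m l) \<subseteq> bits (W l)" "commit_state S True l =
     (\<lambda>z. N (m l) * (\<Sum>k\<in>bits (m l). if length z = W l + m l \<and> take (W l) z = \<xi>1 k then basis_ket k (drop (W l) z) else 0))"
      using p1 unfolding purified_def N_def W_def by blast
    have sq: "sqnorm (bits (W l + m l)) (commit_state S b l) = 1" for b
      using sqnorm_circuit[of "prep S b l"] S unfolding commitment_scheme_def by (simp add: commit_state_def W_def)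
    have pr: "opening_prob S b l (e l) (\<Psi> l) (V b l) = reveal.prob (e l) (W l) (m l) (V b l) (\<Psi> l) (commit_state S b l)" for b
    proof -
      interpret reveal "e l" "W l" "m l" "V b l" "\<Psi> l" "commit_state S b l"
        by unfold_locales (use V in \<open>simp add: W_def\<close>)
      show ?thesis
        unfolding opening_prob_def Let_def S(2) W_def[symmetric] conj_by_ketbra expect_trace_left prob_def amp_def[abs_def] ..
    qed
    have "reveal.prob (e l) (W l) (m l) (V False l) (\<Psi> l) (commit_state S False l) +
        reveal.prob (e l) (W l) (m l) (V True l) (\<Psi> l) (commit_state S True l) \<le> 1 + cmod (N l) * cmod (N (m l)) * 2 ^ l"
    proof (rule sum_binding_bound)
      show "unitary_op (e l + W l) (V False l)" "unitary_op (e l + W l) (V True l)" using V by (auto simp: W_def)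
      show "sqnorm (bits (e l + W l + m l)) (\<Psi> l) = 1" using \<Psi> S(2) by (simp add: unit_ket_def sqnorm_def W_def)
      show "commit_state S False l (x @ y) = N l * (\<Sum>k\<in>bits l. if x = \<xi>0 k then circuit_state (U k) y else 0)"
        if "x \<in> bits (W l)" "y \<in> bits (m l)" for x y unfolding \<xi>0(2) split_append[OF that] by simp
      show "commit_state S True l (x @ y) = N (m l) * (\<Sum>k\<in>bits (m l). if x = \<xi>1 k then basis_ket k y else 0)"
        if "x \<in> bits (W l)" "y \<in> bits (m l)" for x y unfolding \<xi>1(3) split_append[OF that] by simp
      show "sqnorm (bits (m l)) (circuit_state (U k)) = 1" if "k \<in> bits l" for k
        using sqnorm_circuit[of "U k"] U[of k] that by (simp add: bits_def)
    qed (rule sq \<xi>0(1) \<xi>1(1,2))+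
    note bound = this
    have N: "cmod (N k) = 2 powr (- (real k / 2))" for k
    proof -
      have "cmod (N k) = (1 / sqrt 2) ^ k" by (simp add: N_def norm_power norm_divide)
      also have "1 / sqrt 2 = 2 powr (- (1 / 2))" by (simp add: powr_minus powr_half_sqrt inverse_eq_divide)
      also have "(2 powr (- (1 / 2))) ^ k = 2 powr (- (real k / 2))" by (simp add: powr_power mult.commute)
      finally show ?thesis .
    qed
    \<comment> \<open>The exponents are \<open>- l / 2\<close>, \<open>- m / 2\<close> and
      \<open>l\<close>; as \<open>m \<ge> c * l\<close>, their sum is at most
      \<open>- (c - 1) * l / 2\<close>.\<close>
    have "cmod (N l) * cmod (N (m l)) * 2 ^ l = 2 powr (real l / 2 - real (m l) / 2)"
    proof -
      have "(2 :: real) ^ l = 2 powr real l" by (simp add: powr_realpow)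
      then show ?thesis unfolding N by (simp flip: powr_add)
    qed
    also have "\<dots> \<le> 2 powr (- ((c - 1) / 2) * real l)"
      using m(2)[of l] by (intro powr_mono) (auto simp: field_simps)
    finally have "cmod (N l) * cmod (N (m l)) * 2 ^ l \<le> 2 powr (- ((c - 1) / 2) * real l)" .
    with bound show ?thesis unfolding pr by linarith
  qed
  have "negligible (\<lambda>l. 2 powr (- ((c - 1) / 2) * real l))" using m(1) by (intro negligible_exp) simp
  then show "\<exists>negl. negligible negl \<and> (\<forall>l. opening_prob S False l (e l) (\<Psi> l) (V False l)
               + opening_prob S True l (e l) (\<Psi> l) (V True l) \<le> 1 + negl l)"
    using le by blast
qed

theorem theorem1p1:
  fixes m :: "nat \<Rightarrow> nat" and U :: "bool list \<Rightarrow> circuit" and c :: real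
  assumes "PRSG m U"
    and "c > 1"
    and "\<forall>n. real (m n) \<ge> c * real n"
  shows "\<exists>S :: commitment. commitment_scheme S \<and> computationally_hiding S \<and> statistically_sum_binding S"
proof -
  have sg: "state_gen m U" using assms(1) by (simp add: PRSG_def)
  from exists_scheme[OF sg] obtain S where S: "commitment_scheme S" "reg_C S = m"
    "purified (commit_state S False) (reg_R S) m (\<lambda>l. l) (\<lambda>l k. circuit_state (U k))"
    "purified (commit_state S True) (reg_R S) m m (\<lambda>l. basis_ket)" by blast
  moreover have "computationally_hiding S" using hiding[OF assms(1) S(2-4)] .
  moreover have "statistically_sum_binding S"
    using binding[OF S(1,2) assms(2) _ _ S(3,4)] assms(3) sg by (simp add: state_gen_def)
  ultimately show ?thesis by blast
qed

end
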